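(* Let $\psi(x,y,F)$ be a $\Sigma_0$ formula with exactly the displayed free variables. Assume that $$\mathsf{WKL}_0 + \mathsf{B}\Sigma^0_2 + T \vdash \forall x\,\forall X\,(X \text{ is infinite} \rightarrow \exists F\subseteq_{\mathtt{fin}} X\ \exists y\ \psi(x,y,F)).$$ Then there exists some $n\in\omega$ such that $\mathsf{I}\Sigma^0_1$ proves: for all $x$ and all finite $Z\subseteq (x,\infty)$, if $Z$ is $\omega^n$-large$(T)$ and exp-sparse, then $\exists F\subseteq Z\ \exists y<\max Z\ \psi(x,y,F)$.
   Context: Fix a number constant $a$ and a set constant $A$ added to the language, and a $\Sigma^0_0$ formula $\theta(x,y,z)$ (possibly mentioning $a$ and $A$); let $T$ be the $\Pi^0_3$ sentence $\forall x\exists y\forall z\,\theta(x,y,z)$. All theories mentioned are in the language expanded with $a,A$. For finite sets, $X<Y$ means every element of $X$ is below every element of $Y$. Finite sets $X<Y$ are $T$-apart if $\forall x<\max X\ \exists y<\min Y\ \forall z<\max Y\ \theta(x,y,z)$. For a finite set $X\subseteq\mathbb{N}$: $X$ is $\omega^0$-large$(T)$ iff $X\neq\emptyset$; $X$ is $\omega^{b+1}$-large$(T)$ iff $X\setminus\{\min X\}$ is $\omega^b\cdot(\min X)$-large$(T)$; $X$ is $\omega^b\cdot k$-large$(T)$ iff there are $k$ pairwise $T$-apart $\omega^b$-large$(T)$ subsets $X_0<X_1<\dots<X_{k-1}$ of $X$. By convention, only sets $X$ with $\min X\geq 3$ and $\min X\ge a$ are considered. A set $X$ is exp-sparse if $4^x<y$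 for all $x<y$ in $X$. *)

theory Defs
  imports Main
begin

section \<open>Two-sorted language of second-order arithmetic with constants \<open>a\<close> and \<open>A\<close>\<close>

text \<open>The syntax is in de Bruijn style, with separate index spaces for number variables (bound by
  \<^verbatim>\<open>Forall\<close>) and set variables (bound by \<^verbatim>\<open>ForallS\<close>). As usual for this language, equality is
  primitive for numbers only.\<close>

datatype tm = NVar nat | NConst | Zero | One | Add tm tm | Mul tm tm

datatype st = SVar nat | SConst

datatype fm =
    Fls
  | Eq tm tm
  | Less tm tm
  | Mem tm st
  | Imp fm fm (infixr \<open>\<^bold>\<longrightarrow>\<close> 25)
  | Forall fm
  | ForallS fm

notation Add (infixl \<open>\<^bold>+\<close> 65)
notation Mul (infixl \<open>\<^bold>*\<close> 70)
notation Eq (infix \<open>\<^bold>=\<close> 50)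
notation Less (infix \<open>\<^bold><\<close> 50)
notation Mem (infix \<open>\<^bold>\<in>\<close> 50)

abbreviation Neg :: "fm \<Rightarrow> fm" (\<open>\<^bold>\<not> _\<close> [40] 40) where
  "\<^bold>\<not> \<phi> \<equiv> \<phi> \<^bold>\<longrightarrow> Fls"

abbreviation Conj :: "fm \<Rightarrow> fm \<Rightarrow> fm" (infixr \<open>\<^bold>\<and>\<close> 35) where
  "\<phi> \<^bold>\<and> \<psi> \<equiv> \<^bold>\<not> (\<phi> \<^bold>\<longrightarrow> \<^bold>\<not> \<psi>)"

abbreviation Disj :: "fm \<Rightarrow> fm \<Rightarrow> fm" (infixr \<open>\<^bold>\<or>\<close> 30) where
  "\<phi> \<^bold>\<or> \<psi> \<equiv> \<^bold>\<not> \<phi> \<^bold>\<longrightarrow> \<psi>"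

abbreviation Iff :: "fm \<Rightarrow> fm \<Rightarrow> fm" (infix \<open>\<^bold>\<longleftrightarrow>\<close> 25) where
  "\<phi> \<^bold>\<longleftrightarrow> \<psi> \<equiv> (\<phi> \<^bold>\<longrightarrow> \<psi>) \<^bold>\<and> (\<psi> \<^bold>\<longrightarrow> \<phi>)"

abbreviation Exists :: "fm \<Rightarrow> fm" where
  "Exists \<phi> \<equiv> \<^bold>\<not> Forall (\<^bold>\<not> \<phi>)"

abbreviation ExistsS :: "fm \<Rightarrow> fm" where
  "ExistsS \<phi> \<equiv> \<^bold>\<not> ForallS (\<^bold>\<not> \<phi>)"

abbreviation Leq :: "tm \<Rightarrow> tm \<Rightarrow> fm" (infix \<open>\<^bold>\<le>\<close> 50) where
  "s \<^bold>\<le> t \<equiv> s \<^bold>< t \<^bold>\<or> s \<^bold>= t"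

section \<open>Substitution and scoping\<close>

primrec tsub :: "(nat \<Rightarrow> tm) \<Rightarrow> tm \<Rightarrow> tm" where
  "tsub \<sigma> (NVar i) = \<sigma> i"
| "tsub \<sigma> NConst = NConst"
| "tsub \<sigma> Zero = Zero"
| "tsub \<sigma> One = One"
| "tsub \<sigma> (s \<^bold>+ t) = tsub \<sigma> s \<^bold>+ tsub \<sigma> t"
| "tsub \<sigma> (s \<^bold>* t) = tsub \<sigma> s \<^bold>* tsub \<sigma> t"

primrec ssub :: "(nat \<Rightarrow> st) \<Rightarrow> st \<Rightarrow> st" where
  "ssub \<tau> (SVar i) = \<tau> i"
| "ssub \<tau> SConst = SConst"

text \<open>\<^verbatim>\<open>t \<up> k\<close> is \<^verbatim>\<open>t\<close> read underneath \<^verbatim>\<open>k\<close> further number quantifiers.\<close>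

definition tlift :: "tm \<Rightarrow> nat \<Rightarrow> tm" (infixl \<open>\<up>\<close> 80) where
  "t \<up> k = tsub (\<lambda>i. NVar (i + k)) t"

primrec fsub :: "(nat \<Rightarrow> tm) \<Rightarrow> (nat \<Rightarrow> st) \<Rightarrow> fm \<Rightarrow> fm" where
  "fsub \<sigma> \<tau> Fls = Fls"
| "fsub \<sigma> \<tau> (s \<^bold>= t) = (tsub \<sigma> s \<^bold>= tsub \<sigma> t)"
| "fsub \<sigma> \<tau> (s \<^bold>< t) = (tsub \<sigma> s \<^bold>< tsub \<sigma> t)"
| "fsub \<sigma> \<tau> (s \<^bold>\<in> X) = (tsub \<sigma> s \<^bold>\<in> ssub \<tau> X)"
| "fsub \<sigma> \<tau> (\<phi> \<^bold>\<longrightarrow> \<psi>) = (fsub \<sigma> \<tau> \<phi> \<^bold>\<longrightarrow> fsub \<sigma> \<tau> \<psi>)"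
| "fsub \<sigma> \<tau> (Forall \<phi>) = Forall (fsub (case_nat (NVar 0) (\<lambda>i. \<sigma> i \<up> 1)) \<tau> \<phi>)"
| "fsub \<sigma> \<tau> (ForallS \<phi>) =
     ForallS (fsub \<sigma> (case_nat (SVar 0) (\<lambda>i. ssub (\<lambda>j. SVar (Suc j)) (\<tau> i))) \<phi>)"

definition flift :: "fm \<Rightarrow> fm" where
  "flift = fsub (\<lambda>i. NVar (Suc i)) SVar"

definition fliftS :: "fm \<Rightarrow> fm" where
  "fliftS = fsub NVar (\<lambda>i. SVar (Suc i))"

definition inst :: "fm \<Rightarrow> tm \<Rightarrow> fm" where
  "inst \<phi> t = fsub (case_nat t NVar) SVar \<phi>"

definition instS :: "fm \<Rightarrow> st \<Rightarrow> fm" where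
  "instS \<phi> X = fsub NVar (case_nat X SVar) \<phi>"

text \<open>\<^verbatim>\<open>inst3 \<phi> s t u\<close> is \<open>\<phi>(s,t,u)\<close> for \<open>\<phi>\<close> with free variables among the number variables
  0, 1, 2.\<close>

definition inst3 :: "fm \<Rightarrow> tm \<Rightarrow> tm \<Rightarrow> tm \<Rightarrow> fm" where
  "inst3 \<phi> s t u = fsub (\<lambda>i. if i = 0 then s else if i = 1 then t else u) SVar \<phi>"

primrec tm_below :: "nat \<Rightarrow> tm \<Rightarrow> bool" where
  "tm_below m (NVar i) = (i < m)"
| "tm_below m NConst = True"
| "tm_below m Zero = True"
| "tm_below m One = True"
| "tm_below m (s \<^bold>+ t) = (tm_below m s \<and> tm_below m t)"
| "tm_below m (s \<^bold>* t) = (tm_below m s \<and> tm_below m t)"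

primrec st_below :: "nat \<Rightarrow> st \<Rightarrow> bool" where
  "st_below n (SVar i) = (i < n)"
| "st_below n SConst = True"

text \<open>All free number variables are below \<open>m\<close> and all free set variables are below \<open>n\<close>.\<close>

primrec fm_below :: "nat \<Rightarrow> nat \<Rightarrow> fm \<Rightarrow> bool" where
  "fm_below m n Fls = True"
| "fm_below m n (s \<^bold>= t) = (tm_below m s \<and> tm_below m t)"
| "fm_below m n (s \<^bold>< t) = (tm_below m s \<and> tm_below m t)"
| "fm_below m n (s \<^bold>\<in> X) = (tm_below m s \<and> st_below n X)"
| "fm_below m n (\<phi> \<^bold>\<longrightarrow> \<psi>) = (fm_below m n \<phi> \<and> fm_below m n \<psi>)"
| "fm_below m n (Forall \<phi>) = fm_below (Suc m) n \<phi>"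
| "fm_below m n (ForallS \<phi>) = fm_below m (Suc n) \<phi>"

abbreviation sentence :: "fm \<Rightarrow> bool" where
  "sentence \<equiv> fm_below 0 0"

section \<open>Provability: classical natural deduction\<close>

inductive proves :: "fm set \<Rightarrow> fm \<Rightarrow> bool" (infix \<open>\<turnstile>\<close> 20) where
  Hyp: "\<phi> \<in> \<Gamma> \<Longrightarrow> \<Gamma> \<turnstile> \<phi>"
| ImpI: "insert \<phi> \<Gamma> \<turnstile> \<psi> \<Longrightarrow> \<Gamma> \<turnstile> (\<phi> \<^bold>\<longrightarrow> \<psi>)"
| ImpE: "\<Gamma> \<turnstile> (\<phi> \<^bold>\<longrightarrow> \<psi>) \<Longrightarrow> \<Gamma> \<turnstile> \<phi> \<Longrightarrow> \<Gamma> \<turnstile> \<psi>"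
| Contr: "insert (\<^bold>\<not> \<phi>) \<Gamma> \<turnstile> Fls \<Longrightarrow> \<Gamma> \<turnstile> \<phi>"
| ForallI: "flift ` \<Gamma> \<turnstile> \<phi> \<Longrightarrow> \<Gamma> \<turnstile> Forall \<phi>"
| ForallE: "\<Gamma> \<turnstile> Forall \<phi> \<Longrightarrow> \<Gamma> \<turnstile> inst \<phi> t"
| ForallSI: "fliftS ` \<Gamma> \<turnstile> \<phi> \<Longrightarrow> \<Gamma> \<turnstile> ForallS \<phi>"
| ForallSE: "\<Gamma> \<turnstile> ForallS \<phi> \<Longrightarrow> \<Gamma> \<turnstile> instS \<phi> X"
| Refl: "\<Gamma> \<turnstile> (t \<^bold>= t)"
| Subst: "\<Gamma> \<turnstile> (s \<^bold>= t) \<Longrightarrow> \<Gamma> \<turnstile> inst \<phi> s \<Longrightarrow> \<Gamma> \<turnstile> inst \<phi> t"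

section \<open>Formula classes\<close>

abbreviation BForall :: "tm \<Rightarrow> fm \<Rightarrow> fm" where
  "BForall t \<phi> \<equiv> Forall (NVar 0 \<^bold>< t \<up> 1 \<^bold>\<longrightarrow> \<phi>)"

abbreviation BExists :: "tm \<Rightarrow> fm \<Rightarrow> fm" where
  "BExists t \<phi> \<equiv> Exists (NVar 0 \<^bold>< t \<up> 1 \<^bold>\<and> \<phi>)"

text \<open>With superscript (\<open>\<Sigma>\<^sup>0\<close>, \<open>\<Pi>\<^sup>0\<close>), set variables and the set constant may occur as parameters;
  without superscript (\<open>\<Sigma>\<^sub>0\<close>), they may not.\<close>

inductive Sigma00 :: "fm \<Rightarrow> bool" where
  "Sigma00 Fls"
| "Sigma00 (s \<^bold>= t)"
| "Sigma00 (s \<^bold>< t)"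
| "Sigma00 (s \<^bold>\<in> X)"
| "Sigma00 \<phi> \<Longrightarrow> Sigma00 \<psi> \<Longrightarrow> Sigma00 (\<phi> \<^bold>\<longrightarrow> \<psi>)"
| "Sigma00 \<phi> \<Longrightarrow> Sigma00 (BForall t \<phi>)"
| "Sigma00 \<phi> \<Longrightarrow> Sigma00 (BExists t \<phi>)"

primrec set_free :: "fm \<Rightarrow> bool" where
  "set_free Fls = True"
| "set_free (s \<^bold>= t) = True"
| "set_free (s \<^bold>< t) = True"
| "set_free (s \<^bold>\<in> X) = False"
| "set_free (\<phi> \<^bold>\<longrightarrow> \<psi>) = (set_free \<phi> \<and> set_free \<psi>)"
| "set_free (Forall \<phi>) = set_free \<phi>"
| "set_free (ForallS \<phi>) = False"

definition Sigma0 :: "fm \<Rightarrow> bool" where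
  "Sigma0 \<phi> \<longleftrightarrow> Sigma00 \<phi> \<and> set_free \<phi>"

definition Sigma01 :: "fm \<Rightarrow> bool" where
  "Sigma01 \<phi> \<longleftrightarrow> (\<exists>\<theta>. Sigma00 \<theta> \<and> \<phi> = Exists \<theta>)"

definition Pi01 :: "fm \<Rightarrow> bool" where
  "Pi01 \<phi> \<longleftrightarrow> (\<exists>\<theta>. Sigma00 \<theta> \<and> \<phi> = Forall \<theta>)"

definition Sigma02 :: "fm \<Rightarrow> bool" where
  "Sigma02 \<phi> \<longleftrightarrow> (\<exists>\<theta>. Sigma00 \<theta> \<and> \<phi> = Exists (Forall \<theta>))"

section \<open>Finite sets and finite sequences coded by numbers\<close>

abbreviation Two :: tm where "Two \<equiv> One \<^bold>+ One"
abbreviation Three :: tm where "Three \<equiv> Two \<^bold>+ One"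
abbreviation Four :: tm where "Four \<equiv> Three \<^bold>+ One"

text \<open>Goedel's beta function: \<open>r = b mod (1 + (i + 1) c)\<close>.\<close>

definition beta :: "tm \<Rightarrow> tm \<Rightarrow> tm \<Rightarrow> tm \<Rightarrow> fm" where
  "beta b c i r =
     (r \<^bold>< One \<^bold>+ (i \<^bold>+ One) \<^bold>* c \<^bold>\<and>
      Exists (b \<up> 1 \<^bold>= NVar 0 \<^bold>* (One \<^bold>+ (i \<up> 1 \<^bold>+ One) \<^bold>* c \<up> 1) \<^bold>+ r \<up> 1))"

text \<open>\<open>s\<^sup>t = u\<close>: there is a sequence \<open>(b, c)\<close> starting with 1, multiplied by \<open>s\<close> in each of
  \<open>t\<close> steps, and reaching \<open>u\<close>.\<close>

definition power_eq :: "tm \<Rightarrow> tm \<Rightarrow> tm \<Rightarrow> fm" where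
  "power_eq s t u =
     Exists (Exists
       (beta (NVar 1) (NVar 0) Zero One \<^bold>\<and>
        beta (NVar 1) (NVar 0) (t \<up> 2) (u \<up> 2) \<^bold>\<and>
        BForall (t \<up> 2) (Exists
          (beta (NVar 3) (NVar 2) (NVar 1) (NVar 0) \<^bold>\<and>
           beta (NVar 3) (NVar 2) (NVar 1 \<^bold>+ One) (s \<up> 4 \<^bold>* NVar 0)))))"

text \<open>Ackermann coding: \<open>x\<close> belongs to the finite set coded by \<open>F\<close> iff
  \<open>F = (2 q + 1) 2\<^sup>x + r\<close> for some \<open>q\<close> and some \<open>r < 2\<^sup>x\<close>. Every number codes a finite set.\<close>

definition in_code :: "tm \<Rightarrow> tm \<Rightarrow> fm" (infix \<open>\<^bold>\<in>\<^sub>c\<close> 50) where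
  "x \<^bold>\<in>\<^sub>c F =
     Exists (Exists (Exists
       (power_eq Two (x \<up> 3) (NVar 2) \<^bold>\<and> NVar 0 \<^bold>< NVar 2 \<^bold>\<and>
        F \<up> 3 \<^bold>= (Two \<^bold>* NVar 1 \<^bold>+ One) \<^bold>* NVar 2 \<^bold>+ NVar 0)))"

definition is_min :: "tm \<Rightarrow> tm \<Rightarrow> fm" where
  "is_min m F = (m \<^bold>\<in>\<^sub>c F \<^bold>\<and> Forall (NVar 0 \<^bold>\<in>\<^sub>c F \<up> 1 \<^bold>\<longrightarrow> m \<up> 1 \<^bold>\<le> NVar 0))"

definition is_max :: "tm \<Rightarrow> tm \<Rightarrow> fm" where
  "is_max m F = (m \<^bold>\<in>\<^sub>c F \<^bold>\<and> Forall (NVar 0 \<^bold>\<in>\<^sub>c F \<up> 1 \<^bold>\<longrightarrow> NVar 0 \<^bold>\<le> m \<up> 1))"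

definition subset_code :: "tm \<Rightarrow> tm \<Rightarrow> fm" (infix \<open>\<^bold>\<subseteq>\<^sub>c\<close> 50) where
  "F \<^bold>\<subseteq>\<^sub>c G = Forall (NVar 0 \<^bold>\<in>\<^sub>c F \<up> 1 \<^bold>\<longrightarrow> NVar 0 \<^bold>\<in>\<^sub>c G \<up> 1)"

definition fin_subset :: "tm \<Rightarrow> st \<Rightarrow> fm" (infix \<open>\<^bold>\<subseteq>\<^sub>f\<^sub>i\<^sub>n\<close> 50) where
  "F \<^bold>\<subseteq>\<^sub>f\<^sub>i\<^sub>n X = Forall (NVar 0 \<^bold>\<in>\<^sub>c F \<up> 1 \<^bold>\<longrightarrow> NVar 0 \<^bold>\<in> X)"

definition set_before :: "tm \<Rightarrow> tm \<Rightarrow> fm" where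
  "set_before F G =
     Forall (Forall (NVar 1 \<^bold>\<in>\<^sub>c F \<up> 2 \<^bold>\<and> NVar 0 \<^bold>\<in>\<^sub>c G \<up> 2 \<^bold>\<longrightarrow> NVar 1 \<^bold>< NVar 0))"

definition exp_sparse :: "tm \<Rightarrow> fm" where
  "exp_sparse F =
     Forall (Forall
       (NVar 1 \<^bold>\<in>\<^sub>c F \<up> 2 \<^bold>\<and> NVar 0 \<^bold>\<in>\<^sub>c F \<up> 2 \<^bold>\<and> NVar 1 \<^bold>< NVar 0 \<^bold>\<longrightarrow>
        Exists (power_eq Four (NVar 2) (NVar 0) \<^bold>\<and> NVar 0 \<^bold>< NVar 1)))"

definition infinite_set :: "st \<Rightarrow> fm" where
  "infinite_set X = Forall (Exists (NVar 1 \<^bold>< NVar 0 \<^bold>\<and> NVar 0 \<^bold>\<in> X))"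

section \<open>Theories\<close>

text \<open>Axiom schemes are turned into sets of sentences by universally closing over all parameters.\<close>

definition closures :: "fm set \<Rightarrow> fm set" where
  "closures S =
     {\<chi>. sentence \<chi> \<and> (\<exists>\<phi>\<in>S. \<exists>m n. \<chi> = (ForallS ^^ n) ((Forall ^^ m) \<phi>))}"

definition basic_axioms :: "fm set" where
  "basic_axioms =
     (let m = NVar 0; n = NVar 1 in
      {\<^bold>\<not> (n \<^bold>+ One \<^bold>= Zero),
       m \<^bold>+ One \<^bold>= n \<^bold>+ One \<^bold>\<longrightarrow> m \<^bold>= n,
       m \<^bold>+ Zero \<^bold>= m,
       m \<^bold>+ (n \<^bold>+ One) \<^bold>= (m \<^bold>+ n) \<^bold>+ One,
       m \<^bold>* Zero \<^bold>= Zero,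
       m \<^bold>* (n \<^bold>+ One) \<^bold>= m \<^bold>* n \<^bold>+ m,
       \<^bold>\<not> (m \<^bold>< Zero),
       m \<^bold>< n \<^bold>+ One \<^bold>\<longleftrightarrow> m \<^bold>\<le> n})"

text \<open>In the schemes below, the distinguished variable of \<open>\<phi>\<close> is number variable 0 and the
  remaining free variables are parameters.\<close>

definition induction_axiom :: "fm \<Rightarrow> fm" where
  "induction_axiom \<phi> =
     (inst \<phi> Zero \<^bold>\<and> Forall (\<phi> \<^bold>\<longrightarrow> fsub (NVar(0 := NVar 0 \<^bold>+ One)) SVar \<phi>) \<^bold>\<longrightarrow> Forall \<phi>)"

definition comprehension_axiom :: "fm \<Rightarrow> fm \<Rightarrow> fm" where
  "comprehension_axiom \<phi> \<psi> =
     (Forall (\<phi> \<^bold>\<longleftrightarrow> \<psi>) \<^bold>\<longrightarrow> ExistsS (Forall (NVar 0 \<^bold>\<in> SVar 0 \<^bold>\<longleftrightarrow> fliftS \<phi>)))"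

text \<open>\<open>(\<forall>x<u. \<exists>y. \<phi>(x,y)) \<longrightarrow> (\<exists>v. \<forall>x<u. \<exists>y<v. \<phi>(x,y))\<close>. In \<open>\<phi>\<close>, number variable 0 is \<open>y\<close>,
  number variable 1 is \<open>x\<close> and number variable 2 is \<open>u\<close> (which, like any parameter, may occur);
  the substitution on the right makes room for \<open>v\<close>.\<close>

definition bounding_axiom :: "fm \<Rightarrow> fm" where
  "bounding_axiom \<phi> =
     (BForall (NVar 0) (Exists \<phi>) \<^bold>\<longrightarrow>
      Exists (BForall (NVar 1) (BExists (NVar 1)
        (fsub (\<lambda>i. if i < 2 then NVar i else NVar (Suc i)) SVar \<phi>))))"

definition ISigma01 :: "fm set" where
  "ISigma01 = closures basic_axioms \<union> closures {induction_axiom \<phi> | \<phi>. Sigma01 \<phi>}"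

definition RCA0 :: "fm set" where
  "RCA0 = ISigma01 \<union> closures {comprehension_axiom \<phi> \<psi> | \<phi> \<psi>. Sigma01 \<phi> \<and> Pi01 \<psi>}"

definition BSigma02 :: "fm set" where
  "BSigma02 = closures {bounding_axiom \<phi> | \<phi>. Sigma02 \<phi>}"

text \<open>A binary string of length \<open>l\<close> is coded by the finite set with maximum \<open>l\<close> whose elements
  below \<open>l\<close> are the positions carrying a 1 (i.e. its bits, topped by a leading 1).\<close>

definition initial_segment :: "tm \<Rightarrow> tm \<Rightarrow> fm" where
  "initial_segment t s =
     Exists (Exists
       (is_max (NVar 1) (t \<up> 2) \<^bold>\<and> is_max (NVar 0) (s \<up> 2) \<^bold>\<and> NVar 1 \<^bold>\<le> NVar 0 \<^bold>\<and>
        BForall (NVar 1) (NVar 0 \<^bold>\<in>\<^sub>c t \<up> 3 \<^bold>\<longleftrightarrow> NVar 0 \<^bold>\<in>\<^sub>c s \<up> 3)))"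

definition binary_tree :: "st \<Rightarrow> fm" where
  "binary_tree X =
     (Forall (NVar 0 \<^bold>\<in> X \<^bold>\<longrightarrow> Exists (is_max (NVar 0) (NVar 1))) \<^bold>\<and>
      Forall (Forall (NVar 1 \<^bold>\<in> X \<^bold>\<and> initial_segment (NVar 0) (NVar 1) \<^bold>\<longrightarrow> NVar 0 \<^bold>\<in> X)))"

definition path_through :: "st \<Rightarrow> st \<Rightarrow> fm" where
  "path_through P X =
     Forall (Exists
       (NVar 0 \<^bold>\<in> X \<^bold>\<and> is_max (NVar 1) (NVar 0) \<^bold>\<and>
        BForall (NVar 1) (NVar 0 \<^bold>\<in>\<^sub>c NVar 1 \<^bold>\<longleftrightarrow> NVar 0 \<^bold>\<in> P)))"

definition weak_Koenig :: fm where
  "weak_Koenig =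
     ForallS (binary_tree (SVar 0) \<^bold>\<and> infinite_set (SVar 0) \<^bold>\<longrightarrow>
       ExistsS (path_through (SVar 0) (SVar 1)))"

definition WKL0 :: "fm set" where
  "WKL0 = RCA0 \<union> {weak_Koenig}"

section \<open>Largeness relative to the sentence \<open>T\<close>\<close>

text \<open>Below, \<open>\<theta>(x,y,z)\<close> is the matrix of \<open>T\<close>.\<close>

definition T_sentence :: "fm \<Rightarrow> fm" where
  "T_sentence \<theta> = Forall (Exists (Forall (inst3 \<theta> (NVar 2) (NVar 1) (NVar 0))))"

text \<open>The three outermost quantifiers pick \<open>max X\<close>, \<open>min Y\<close> and \<open>max Y\<close>.\<close>

definition T_apart :: "fm \<Rightarrow> tm \<Rightarrow> tm \<Rightarrow> fm" where
  "T_apart \<theta> X Y =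
     (set_before X Y \<^bold>\<and>
      Exists (Exists (Exists
        (is_max (NVar 2) (X \<up> 3) \<^bold>\<and> is_min (NVar 1) (Y \<up> 3) \<^bold>\<and> is_max (NVar 0) (Y \<up> 3) \<^bold>\<and>
         BForall (NVar 2) (BExists (NVar 2) (BForall (NVar 2)
           (inst3 \<theta> (NVar 2) (NVar 1) (NVar 0))))))))"

text \<open>\<open>X\<close> has \<open>k\<close> pairwise \<open>T\<close>-apart subsets \<open>X\<^sub>0 < \<dots> < X\<^bsub>k-1\<^esub>\<close> satisfying \<open>L\<close>, given as a
  sequence \<open>(b, c)\<close>; here \<open>k\<close> is a number of the theory, possibly nonstandard.\<close>

definition multiple_large :: "fm \<Rightarrow> (tm \<Rightarrow> fm) \<Rightarrow> tm \<Rightarrow> tm \<Rightarrow> fm" where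
  "multiple_large \<theta> L k X =
     Exists (Exists
       (BForall (k \<up> 2) (Exists
          (beta (NVar 3) (NVar 2) (NVar 1) (NVar 0) \<^bold>\<and> NVar 0 \<^bold>\<subseteq>\<^sub>c X \<up> 4 \<^bold>\<and> L (NVar 0))) \<^bold>\<and>
        BForall (k \<up> 2) (BForall (NVar 0) (Exists (Exists
          (beta (NVar 5) (NVar 4) (NVar 2) (NVar 1) \<^bold>\<and>
           beta (NVar 5) (NVar 4) (NVar 3) (NVar 0) \<^bold>\<and>
           T_apart \<theta> (NVar 1) (NVar 0)))))))"

text \<open>In the successor case, number variable 1 is \<open>min X\<close> and number variable 0 is
  \<open>X - {min X}\<close>.\<close>

primrec power_large :: "fm \<Rightarrow> nat \<Rightarrow> tm \<Rightarrow> fm" where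
  "power_large \<theta> 0 = (\<lambda>X. Exists (NVar 0 \<^bold>\<in>\<^sub>c X \<up> 1))"
| "power_large \<theta> (Suc b) = (\<lambda>X.
     Exists (Exists
       (is_min (NVar 1) (X \<up> 2) \<^bold>\<and>
        Forall (NVar 0 \<^bold>\<in>\<^sub>c NVar 1 \<^bold>\<longleftrightarrow> NVar 0 \<^bold>\<in>\<^sub>c X \<up> 3 \<^bold>\<and> \<^bold>\<not> (NVar 0 \<^bold>= NVar 2)) \<^bold>\<and>
        multiple_large \<theta> (power_large \<theta> b) (NVar 1) (NVar 0))))"

text \<open>\<open>\<omega>\<^sup>n\<close>-largeness\<open>(T)\<close>, including the convention that only sets \<open>X\<close> with \<open>min X \<ge> 3\<close> and
  \<open>min X \<ge> a\<close> are considered (subsets inherit this).\<close>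

definition omega_power_large :: "fm \<Rightarrow> nat \<Rightarrow> tm \<Rightarrow> fm" where
  "omega_power_large \<theta> n X =
     (Exists (is_min (NVar 0) (X \<up> 1) \<^bold>\<and> Three \<^bold>\<le> NVar 0 \<^bold>\<and> NConst \<^bold>\<le> NVar 0) \<^bold>\<and>
      power_large \<theta> n X)"

text \<open>\<open>\<forall>x \<forall>X (X is infinite \<rightarrow> \<exists>F \<subseteq>\<^sub>f\<^sub>i\<^sub>n X \<exists>y \<psi>(x,y,F))\<close>\<close>

definition infinite_sentence :: "fm \<Rightarrow> fm" where
  "infinite_sentence \<psi> =
     Forall (ForallS (infinite_set (SVar 0) \<^bold>\<longrightarrow>
       Exists (NVar 0 \<^bold>\<subseteq>\<^sub>f\<^sub>i\<^sub>n SVar 0 \<^bold>\<and> Exists (inst3 \<psi> (NVar 2) (NVar 0) (NVar 1)))))"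

text \<open>\<open>\<forall>x \<forall>Z (Z \<subseteq> (x,\<infinity>)\<close> and \<open>Z\<close> is \<open>\<omega>\<^sup>n\<close>-large\<open>(T)\<close> and exp-sparse
  \<open>\<rightarrow> \<exists>F \<subseteq> Z \<exists>y < max Z \<psi>(x,y,F))\<close>, where \<open>Z\<close> ranges over codes of finite sets.\<close>

definition finite_sentence :: "fm \<Rightarrow> fm \<Rightarrow> nat \<Rightarrow> fm" where
  "finite_sentence \<theta> \<psi> n =
     Forall (Forall
       (Forall (NVar 0 \<^bold>\<in>\<^sub>c NVar 1 \<^bold>\<longrightarrow> NVar 2 \<^bold>< NVar 0) \<^bold>\<and>
        omega_power_large \<theta> n (NVar 0) \<^bold>\<and> exp_sparse (NVar 0) \<^bold>\<longrightarrow>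
        Exists (NVar 0 \<^bold>\<subseteq>\<^sub>c NVar 1 \<^bold>\<and>
          Exists (is_max (NVar 0) (NVar 2) \<^bold>\<and>
            BExists (NVar 0) (inst3 \<psi> (NVar 4) (NVar 0) (NVar 2))))))"

end

theory Submission
  imports Defs "HOL-Library.Countable"
begin

text \<open>
  If the conclusion fails for every \<open>n\<close>, then \<open>I\<Sigma>\<^sub>1\<close> is consistent with a single exp-sparse counterexample \<open>Z\<close> that is
  \<open>\<omega>\<^sup>n\<close>-large for all standard \<open>n\<close>. The pigeonhole principle for large sets, provable in \<open>I\<Sigma>\<^sub>1\<close>, shrinks an
  \<open>\<omega>\<^bsup>4n+1\<^esup>\<close>-large set to an \<open>\<omega>\<^sup>n\<close>-large one on which a given bounded colouring is constant. A Henkin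
  construction interleaved with such steps gives a model of \<open>I\<Sigma>\<^sub>1\<close> with a descending sequence of coded sets,
  starting with \<open>Z\<close>, that treats every colouring in the model and keeps \<open>\<omega>\<^sup>n\<close>-largeness for all \<open>n\<close>. The initial
  segment \<open>I\<close> determined by the minima of these sets is then regular enough for \<open>I\<close>, with the traces of coded sets,
  to be a model of \<open>WKL\<^sub>0 + B\<Sigma>\<^sub>2\<close>, and the apartness of the blocks makes \<open>T\<close> true in it. As \<open>Z\<close> is unbounded in
  \<open>I\<close>, the assumption yields \<open>F\<close> and \<open>y\<close> in \<open>I\<close>, and \<open>\<psi>\<close> is absolute between \<open>I\<close> and the model: contradiction.

  Arithmetic inside models of \<open>I\<Sigma>\<^sub>1\<close> is carried out in a type class \<open>peano\<close> whose induction axiom is stated by means of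
  satisfaction; \<open>\<Sigma>\<^sub>1\<close> relations are tracked by an inductive closure of predicates on environments.
\<close>

section \<open>Structures, satisfaction and soundness\<close>

text \<open>Largeness is defined by recursion on the exponent, so the theory can speak of it only
  for one standard \<open>n\<close> at a time, and the set found by shrinking depends on
  \<open>n\<close>. A fixed model need not contain one shrunken set that serves all exponents. Hence
  each shrinking step of the construction introduces a fresh variable, and compactness makes it name
  a set that is large for every exponent.

  A colouring can be made constant only if the number of its colours lies below the minimum of the
  current set. Minima grow along the descent, so every colouring returns infinitely often, and the
  step formula leaves a way out for a colouring that comes too early.

  Closure of the cut under exponentiation does not yet make the formula for powers absolute, since
  the codes of the computations must lie in the cut as well. They are obtained late: once Sigma_1
  induction is known to hold in the cut, the totality of exponentiation in models of that theory is
  applied to the cut itself. This forces the transfer from the type class to arbitrary models to be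
  done for exponentiation before it is done for cuts.\<close>

record 'a model =
  Num :: "'a set"
  Sets :: "'a set set"
  ncst :: 'a
  scst :: "'a set"
  zro :: 'a
  uno :: 'a
  pls :: "'a \<Rightarrow> 'a \<Rightarrow> 'a"
  tms :: "'a \<Rightarrow> 'a \<Rightarrow> 'a"
  lss :: "'a \<Rightarrow> 'a \<Rightarrow> bool"

primrec tval :: "'a model \<Rightarrow> (nat \<Rightarrow> 'a) \<Rightarrow> tm \<Rightarrow> 'a" where
  "tval M e (NVar i) = e i"
| "tval M e NConst = ncst M"
| "tval M e Zero = zro M"
| "tval M e One = uno M"
| "tval M e (s \<^bold>+ t) = pls M (tval M e s) (tval M e t)"
| "tval M e (s \<^bold>* t) = tms M (tval M e s) (tval M e t)"

primrec sval :: "'a model \<Rightarrow> (nat \<Rightarrow> 'a set) \<Rightarrow> st \<Rightarrow> 'a set" where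
  "sval M s (SVar i) = s i"
| "sval M s SConst = scst M"

abbreviation econs :: "'a \<Rightarrow> (nat \<Rightarrow> 'a) \<Rightarrow> nat \<Rightarrow> 'a" (infixr \<open>##\<close> 65) where
  "x ## e \<equiv> case_nat x e"

primrec sat :: "'a model \<Rightarrow> fm \<Rightarrow> (nat \<Rightarrow> 'a) \<Rightarrow> (nat \<Rightarrow> 'a set) \<Rightarrow> bool" where
  "sat M Fls = (\<lambda>e s. False)"
| "sat M (t \<^bold>= u) = (\<lambda>e s. tval M e t = tval M e u)"
| "sat M (t \<^bold>< u) = (\<lambda>e s. lss M (tval M e t) (tval M e u))"
| "sat M (t \<^bold>\<in> X) = (\<lambda>e s. tval M e t \<in> sval M s X)"
| "sat M (\<phi> \<^bold>\<longrightarrow> \<psi>) = (\<lambda>e s. sat M \<phi> e s \<longrightarrow> sat M \<psi> e s)"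
| "sat M (Forall \<phi>) = (\<lambda>e s. \<forall>x\<in>Num M. sat M \<phi> (x ## e) s)"
| "sat M (ForallS \<phi>) = (\<lambda>e s. \<forall>X\<in>Sets M. sat M \<phi> e (X ## s))"

text \<open>Members of \<open>Sets\<close> need not be subsets of \<open>Num\<close>: formulas only
  test whether values of terms belong to them, so only the traces on \<open>Num\<close>
  matter.\<close>

definition wf_model :: "'a model \<Rightarrow> bool" where
  "wf_model M \<longleftrightarrow> zro M \<in> Num M \<and> uno M \<in> Num M \<and> ncst M \<in> Num M \<and> scst M \<in> Sets M \<and>
     (\<forall>x\<in>Num M. \<forall>y\<in>Num M. pls M x y \<in> Num M \<and> tms M x y \<in> Num M)"

definition envs :: "'a model \<Rightarrow> (nat \<Rightarrow> 'a) \<Rightarrow> (nat \<Rightarrow> 'a set) \<Rightarrow> bool" where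
  "envs M e s \<longleftrightarrow> (\<forall>i. e i \<in> Num M) \<and> (\<forall>i. s i \<in> Sets M)"

lemma tval_closed: "wf_model M \<Longrightarrow> envs M e s \<Longrightarrow> tval M e t \<in> Num M"
  by (induction t) (auto simp: wf_model_def envs_def)

lemma sval_closed: "wf_model M \<Longrightarrow> envs M e s \<Longrightarrow> sval M s X \<in> Sets M"
  by (cases X) (auto simp: wf_model_def envs_def)

lemma envs_cons: "envs M e s \<Longrightarrow> x \<in> Num M \<Longrightarrow> envs M (x ## e) s"
  by (auto simp: envs_def split: nat.splits)

lemma envs_consS: "envs M e s \<Longrightarrow> X \<in> Sets M \<Longrightarrow> envs M e (X ## s)"
  by (auto simp: envs_def split: nat.splits)

lemma tval_tsub: "tval M e (tsub \<sigma> t) = tval M (\<lambda>i. tval M e (\<sigma> i)) t"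
  by (induction t) auto

lemma sval_ssub: "sval M s (ssub \<tau> X) = sval M (\<lambda>i. sval M s (\<tau> i)) X"
  by (cases X) auto

lemma tval_lift [simp]: "tval M (x ## e) (t \<up> Suc k) = tval M e (t \<up> k)"
  by (simp add: tlift_def tval_tsub)

lemma tlift_0 [simp]: "t \<up> 0 = t"
  unfolding tlift_def by (induction t) auto

lemma tval_lift_numeral [simp]: "tval M (x ## e) (t \<up> numeral n) = tval M e (t \<up> pred_numeral n)"
  by (simp add: numeral_eq_Suc)

lemma tlift_var [simp]: "NVar i \<up> k = NVar (i + k)"
  by (simp add: tlift_def)

lemma tlift_simps [simp]:
  "NConst \<up> k = NConst" "Zero \<up> k = Zero" "One \<up> k = One"
  "(s \<^bold>+ t) \<up> k = s \<up> k \<^bold>+ t \<up> k" "(s \<^bold>* t) \<up> k = s \<up> k \<^bold>* t \<up> k"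
  by (simp_all add: tlift_def)

lemma sat_fsub:
  "sat M (fsub \<sigma> \<tau> \<phi>) e s = sat M \<phi> (\<lambda>i. tval M e (\<sigma> i)) (\<lambda>i. sval M s (\<tau> i))"
proof (induction \<phi> arbitrary: \<sigma> \<tau> e s)
  case (Forall \<phi>)
  have "(\<lambda>i. tval M (x ## e) (case_nat (NVar 0) (\<lambda>i. \<sigma> i \<up> Suc 0) i)) = x ## (\<lambda>i. tval M e (\<sigma> i))" for x
    by (auto split: nat.splits)
  then show ?case by (simp add: Forall)
next
  case (ForallS \<phi>)
  have "(\<lambda>i. sval M (X ## s) (case_nat (SVar 0) (\<lambda>i. ssub (\<lambda>j. SVar (Suc j)) (\<tau> i)) i))
      = X ## (\<lambda>i. sval M s (\<tau> i))" for X
    by (auto simp: sval_ssub split: nat.splits)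
  then show ?case by (simp add: ForallS)
qed (auto simp: tval_tsub sval_ssub)

lemma sat_flift [simp]: "sat M (flift \<phi>) (x ## e) s = sat M \<phi> e s"
  by (simp add: flift_def sat_fsub)

lemma sat_fliftS [simp]: "sat M (fliftS \<phi>) e (X ## s) = sat M \<phi> e s"
  by (simp add: fliftS_def sat_fsub)

lemma sat_inst: "sat M (inst \<phi> t) e s = sat M \<phi> (tval M e t ## e) s"
proof -
  have "(\<lambda>i. tval M e (case_nat t NVar i)) = tval M e t ## e" by (auto split: nat.splits)
  then show ?thesis by (simp add: inst_def sat_fsub)
qed

lemma sat_instS: "sat M (instS \<phi> X) e s = sat M \<phi> e (sval M s X ## s)"
proof -
  have "(\<lambda>i. sval M s (case_nat X SVar i)) = sval M s X ## s" by (auto split: nat.splits)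
  then show ?thesis by (simp add: instS_def sat_fsub)
qed

theorem soundness:
  assumes "\<Gamma> \<turnstile> \<phi>" and M: "wf_model M" and "envs M e s" and "\<And>\<gamma>. \<gamma> \<in> \<Gamma> \<Longrightarrow> sat M \<gamma> e s"
  shows "sat M \<phi> e s"
  using assms(1,3,4)
proof (induction arbitrary: e s)
  case (ImpI \<phi> \<Gamma> \<psi>)
  then show ?case by (metis sat.simps(5) insertE)
next
  case (Contr \<phi> \<Gamma>)
  then show ?case by (metis sat.simps(1,5) insertE)
next
  case (ForallI \<Gamma> \<phi>)
  have "sat M \<phi> (x ## e) s" if "x \<in> Num M" for x
    by (rule ForallI.IH) (use that ForallI.prems in \<open>auto simp: envs_cons\<close>)
  then show ?case by simp
next
  case (ForallE \<Gamma> \<phi> t)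
  then show ?case by (auto simp: sat_inst intro: tval_closed[OF M])
next
  case (ForallSI \<Gamma> \<phi>)
  have "sat M \<phi> e (X ## s)" if "X \<in> Sets M" for X
    by (rule ForallSI.IH) (use that ForallSI.prems in \<open>auto simp: envs_consS\<close>)
  then show ?case by simp
next
  case (ForallSE \<Gamma> \<phi> X)
  then show ?case by (auto simp: sat_instS intro: sval_closed[OF M])
next
  case (Subst \<Gamma> s' t \<phi>)
  then show ?case by (metis sat.simps(2) sat_inst)
qed auto

lemma tval_cong: "tm_below m t \<Longrightarrow> (\<And>i. i < m \<Longrightarrow> e i = e' i) \<Longrightarrow> tval M e t = tval M e' t"
  by (induction t) auto

lemma sval_cong: "st_below n X \<Longrightarrow> (\<And>i. i < n \<Longrightarrow> s i = s' i) \<Longrightarrow> sval M s X = sval M s' X"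
  by (cases X) auto

lemma sat_cong:
  "fm_below m n \<phi> \<Longrightarrow> (\<And>i. i < m \<Longrightarrow> e i = e' i) \<Longrightarrow> (\<And>i. i < n \<Longrightarrow> s i = s' i) \<Longrightarrow>
   sat M \<phi> e s = sat M \<phi> e' s'"
proof (induction \<phi> arbitrary: m n e e' s s')
  case (Eq t u) then show ?case using tval_cong[of m _ e e'] by auto
next
  case (Less t u) then show ?case using tval_cong[of m _ e e'] by auto
next
  case (Mem t X) then show ?case using tval_cong[of m _ e e'] sval_cong[of n _ s s'] by auto
next
  case (Imp \<phi> \<psi>)
  then show ?case by (simp only: sat.simps fm_below.simps) metis
next
  case (Forall \<phi>)
  have "sat M \<phi> (x ## e) s = sat M \<phi> (x ## e') s'" for x
    by (rule Forall.IH[of "Suc m" n]) (use Forall.prems in \<open>auto split: nat.splits\<close>)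
  then show ?case by simp
next
  case (ForallS \<phi>)
  have "sat M \<phi> e (X ## s) = sat M \<phi> e' (X ## s')" for X
    by (rule ForallS.IH[of m "Suc n"]) (use ForallS.prems in \<open>auto split: nat.splits\<close>)
  then show ?case by simp
qed auto

lemma sentence_sat: "sentence \<phi> \<Longrightarrow> sat M \<phi> e s \<Longrightarrow> sat M \<phi> e' s'"
  using sat_cong[of 0 0 \<phi> e e' s s' M] by auto

section \<open>Structural properties of derivations\<close>

lemma tsub_tsub: "tsub \<sigma> (tsub \<sigma>' t) = tsub (\<lambda>i. tsub \<sigma> (\<sigma>' i)) t"
  by (induction t) auto

lemma ssub_ssub: "ssub \<tau> (ssub \<tau>' X) = ssub (\<lambda>i. ssub \<tau> (\<tau>' i)) X"
  by (cases X) auto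

lemma tsub_NVar: "tsub NVar t = t"
  by (induction t) auto

lemma ssub_SVar: "ssub SVar X = X"
  by (cases X) auto

lemma fsub_fsub:
  "fsub \<sigma> \<tau> (fsub \<sigma>' \<tau>' \<phi>) = fsub (\<lambda>i. tsub \<sigma> (\<sigma>' i)) (\<lambda>i. ssub \<tau> (\<tau>' i)) \<phi>"
proof (induction \<phi> arbitrary: \<sigma> \<tau> \<sigma>' \<tau>')
  case (Forall \<phi>)
  have "(\<lambda>i. tsub (case_nat (NVar 0) (\<lambda>i. \<sigma> i \<up> Suc 0)) (case_nat (NVar 0) (\<lambda>i. \<sigma>' i \<up> Suc 0) i))
     = case_nat (NVar 0) (\<lambda>i. tsub \<sigma> (\<sigma>' i) \<up> Suc 0)"
    by (auto simp: tlift_def tsub_tsub split: nat.splits)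
  then show ?case by (simp add: Forall)
next
  case (ForallS \<phi>)
  have "(\<lambda>i. ssub (case_nat (SVar 0) (\<lambda>i. ssub (\<lambda>j. SVar (Suc j)) (\<tau> i)))
          (case_nat (SVar 0) (\<lambda>i. ssub (\<lambda>j. SVar (Suc j)) (\<tau>' i)) i))
     = case_nat (SVar 0) (\<lambda>i. ssub (\<lambda>j. SVar (Suc j)) (ssub \<tau> (\<tau>' i)))"
    by (auto simp: ssub_ssub split: nat.splits)
  then show ?case by (simp add: ForallS)
qed (auto simp: tsub_tsub ssub_ssub)

lemma fsub_id: "fsub NVar SVar \<phi> = \<phi>"
proof (induction \<phi>)
  case (Forall \<phi>)
  have "case_nat (NVar 0) (\<lambda>i. NVar i \<up> Suc 0) = NVar" by (auto split: nat.splits)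
  then show ?case by (simp add: Forall)
next
  case (ForallS \<phi>)
  have "case_nat (SVar 0) (\<lambda>i. ssub (\<lambda>j. SVar (Suc j)) (SVar i)) = SVar" by (auto split: nat.splits)
  then show ?case by (simp add: ForallS)
qed (auto simp: tsub_NVar ssub_SVar)

lemma fsub_inst:
  "fsub \<sigma> \<tau> (inst \<phi> t) = inst (fsub (case_nat (NVar 0) (\<lambda>i. \<sigma> i \<up> Suc 0)) \<tau> \<phi>) (tsub \<sigma> t)"
  unfolding inst_def fsub_fsub
  by (rule arg_cong2[where f = "\<lambda>x y. fsub x y \<phi>"])
     (auto simp: tlift_def tsub_tsub tsub_NVar ssub_SVar split: nat.splits)

lemma fsub_instS:
  "fsub \<sigma> \<tau> (instS \<phi> X) =
   instS (fsub \<sigma> (case_nat (SVar 0) (\<lambda>i. ssub (\<lambda>j. SVar (Suc j)) (\<tau> i))) \<phi>) (ssub \<tau> X)"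
  unfolding instS_def fsub_fsub
  by (rule arg_cong2[where f = "\<lambda>x y. fsub x y \<phi>"])
     (auto simp: ssub_ssub tsub_NVar ssub_SVar split: nat.splits)

lemma fsub_flift:
  "fsub (case_nat (NVar 0) (\<lambda>i. \<sigma> i \<up> Suc 0)) \<tau> (flift \<gamma>) = flift (fsub \<sigma> \<tau> \<gamma>)"
  unfolding flift_def fsub_fsub by (simp add: tlift_def ssub_SVar)

lemma fsub_fliftS:
  "fsub \<sigma> (case_nat (SVar 0) (\<lambda>i. ssub (\<lambda>j. SVar (Suc j)) (\<tau> i))) (fliftS \<gamma>) = fliftS (fsub \<sigma> \<tau> \<gamma>)"
  unfolding fliftS_def fsub_fsub by (simp add: tsub_NVar)

text \<open>The quantifier rules survive because substitution commutes with shifting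
  (\<open>fsub_flift\<close>, \<open>fsub_fliftS\<close>). The purpose is the renaming of fresh
  variables below.\<close>

lemma proves_fsub: "\<Gamma> \<turnstile> \<phi> \<Longrightarrow> fsub \<sigma> \<tau> ` \<Gamma> \<turnstile> fsub \<sigma> \<tau> \<phi>"
proof (induction arbitrary: \<sigma> \<tau> rule: proves.induct)
  case (ForallI \<Gamma> \<phi>)
  from ForallI.IH[of "case_nat (NVar 0) (\<lambda>i. \<sigma> i \<up> Suc 0)" \<tau>]
  show ?case by (auto simp: image_image fsub_flift intro: proves.ForallI)
next
  case (ForallSI \<Gamma> \<phi>)
  from ForallSI.IH[of \<sigma> "case_nat (SVar 0) (\<lambda>i. ssub (\<lambda>j. SVar (Suc j)) (\<tau> i))"]
  show ?case by (auto simp: image_image fsub_fliftS intro: proves.ForallSI)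
next
  case (ImpE \<Gamma> \<phi> \<psi>)
  then show ?case by (metis fsub.simps(5) proves.ImpE)
next
  case (Subst \<Gamma> s t \<phi>)
  then show ?case by (metis fsub.simps(2) proves.Subst fsub_inst)
qed (auto simp: fsub_inst fsub_instS intro: proves.intros)

lemma proves_mono: "\<Gamma> \<turnstile> \<phi> \<Longrightarrow> \<Gamma> \<subseteq> \<Delta> \<Longrightarrow> \<Delta> \<turnstile> \<phi>"
proof (induction arbitrary: \<Delta> rule: proves.induct)
  case (ImpI \<phi> \<Gamma> \<psi>) then show ?case by (meson insert_mono proves.ImpI)
next
  case (Contr \<phi> \<Gamma>) then show ?case by (meson insert_mono proves.Contr)
next
  case (ForallI \<Gamma> \<phi>) then show ?case by (meson image_mono proves.ForallI)
next
  case (ForallSI \<Gamma> \<phi>) then show ?case by (meson image_mono proves.ForallSI)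
qed (blast intro: proves.intros)+

lemma proves_finite: "\<Gamma> \<turnstile> \<phi> \<Longrightarrow> \<exists>\<Gamma>0 \<subseteq> \<Gamma>. finite \<Gamma>0 \<and> (\<Gamma>0 \<turnstile> \<phi>)"
proof (induction rule: proves.induct)
  case (Hyp \<phi> \<Gamma>)
  then show ?case by (intro exI[of _ "{\<phi>}"]) (auto intro: proves.Hyp)
next
  case (ImpI \<phi> \<Gamma> \<psi>)
  then obtain G where G: "G \<subseteq> insert \<phi> \<Gamma>" "finite G" "G \<turnstile> \<psi>" by blast
  then have "insert \<phi> (G - {\<phi>}) \<turnstile> \<psi>" using G(1) by (elim proves_mono) auto
  then show ?case using G by (intro exI[of _ "G - {\<phi>}"]) (auto intro: proves.ImpI)
next
  case (ImpE \<Gamma> \<phi> \<psi>)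
  then obtain G1 G2 where "G1 \<subseteq> \<Gamma>" "finite G1" "G1 \<turnstile> (\<phi> \<^bold>\<longrightarrow> \<psi>)" "G2 \<subseteq> \<Gamma>" "finite G2" "G2 \<turnstile> \<phi>" by blast
  then show ?case
    by (intro exI[of _ "G1 \<union> G2"]) (meson Un_least Un_upper1 Un_upper2 finite_UnI proves.ImpE proves_mono)
next
  case (Contr \<phi> \<Gamma>)
  then obtain G where G: "G \<subseteq> insert (\<^bold>\<not> \<phi>) \<Gamma>" "finite G" "G \<turnstile> Fls" by blast
  then have "insert (\<^bold>\<not> \<phi>) (G - {\<^bold>\<not> \<phi>}) \<turnstile> Fls" using G(1) by (elim proves_mono) auto
  then show ?case using G by (intro exI[of _ "G - {\<^bold>\<not> \<phi>}"]) (auto intro: proves.Contr)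
next
  case (ForallI \<Gamma> \<phi>)
  then obtain G where "G \<subseteq> flift ` \<Gamma>" "finite G" "G \<turnstile> \<phi>" by blast
  then obtain G' where "G' \<subseteq> \<Gamma>" "finite G'" "flift ` G' \<turnstile> \<phi>" by (metis finite_subset_image)
  then show ?case by (blast intro: proves.ForallI)
next
  case (ForallSI \<Gamma> \<phi>)
  then obtain G where "G \<subseteq> fliftS ` \<Gamma>" "finite G" "G \<turnstile> \<phi>" by blast
  then obtain G' where "G' \<subseteq> \<Gamma>" "finite G'" "fliftS ` G' \<turnstile> \<phi>" by (metis finite_subset_image)
  then show ?case by (blast intro: proves.ForallSI)
next
  case (ForallE \<Gamma> \<phi> t) then show ?case by (meson proves.ForallE)
next
  case (ForallSE \<Gamma> \<phi> X) then show ?case by (meson proves.ForallSE)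
next
  case (Refl \<Gamma> t) then show ?case by (meson proves.Refl empty_subsetI finite.emptyI)
next
  case (Subst \<Gamma> s t \<phi>)
  then obtain G1 G2 where "G1 \<subseteq> \<Gamma>" "finite G1" "G1 \<turnstile> (s \<^bold>= t)" "G2 \<subseteq> \<Gamma>" "finite G2" "G2 \<turnstile> inst \<phi> s" by blast
  then show ?case
    by (intro exI[of _ "G1 \<union> G2"]) (meson Un_least Un_upper1 Un_upper2 finite_UnI proves.Subst proves_mono)
qed

section \<open>Free variables and fresh variables\<close>

lemma tsub_cong: "tm_below m t \<Longrightarrow> (\<And>i. i < m \<Longrightarrow> \<sigma> i = \<sigma>' i) \<Longrightarrow> tsub \<sigma> t = tsub \<sigma>' t"
  by (induction t) auto

lemma ssub_cong: "st_below n X \<Longrightarrow> (\<And>i. i < n \<Longrightarrow> \<tau> i = \<tau>' i) \<Longrightarrow> ssub \<tau> X = ssub \<tau>' X"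
  by (cases X) auto

lemma fsub_cong:
  "fm_below m n \<phi> \<Longrightarrow> (\<And>i. i < m \<Longrightarrow> \<sigma> i = \<sigma>' i) \<Longrightarrow> (\<And>i. i < n \<Longrightarrow> \<tau> i = \<tau>' i) \<Longrightarrow>
   fsub \<sigma> \<tau> \<phi> = fsub \<sigma>' \<tau>' \<phi>"
proof (induction \<phi> arbitrary: m n \<sigma> \<sigma>' \<tau> \<tau>')
  case (Eq t u) then show ?case using tsub_cong[of m _ \<sigma> \<sigma>'] by auto
next
  case (Less t u) then show ?case using tsub_cong[of m _ \<sigma> \<sigma>'] by auto
next
  case (Mem t X) then show ?case using tsub_cong[of m _ \<sigma> \<sigma>'] ssub_cong[of n _ \<tau> \<tau>'] by auto
next
  case (Imp \<phi> \<psi>)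
  then show ?case by (simp only: fsub.simps fm_below.simps) metis
next
  case (Forall \<phi>)
  show ?case unfolding fsub.simps One_nat_def
    by (rule arg_cong[of _ _ Forall], rule Forall.IH[of "Suc m" n])
       (use Forall.prems in \<open>auto split: nat.splits\<close>)
next
  case (ForallS \<phi>)
  show ?case unfolding fsub.simps One_nat_def
    by (rule arg_cong[of _ _ ForallS], rule ForallS.IH[of m "Suc n"])
       (use ForallS.prems in \<open>auto split: nat.splits\<close>)
qed auto

lemma tm_below_mono: "tm_below m t \<Longrightarrow> m \<le> m' \<Longrightarrow> tm_below m' t"
  by (induction t) auto

lemma st_below_mono: "st_below n X \<Longrightarrow> n \<le> n' \<Longrightarrow> st_below n' X"
  by (cases X) auto

lemma fm_below_mono: "fm_below m n \<phi> \<Longrightarrow> m \<le> m' \<Longrightarrow> n \<le> n' \<Longrightarrow> fm_below m' n' \<phi>"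
  by (induction \<phi> arbitrary: m n m' n') (auto intro: tm_below_mono st_below_mono)

lemma tm_below_ex: "\<exists>m. tm_below m t"
proof (induction t)
  case (Add s t) then show ?case by (metis tm_below_mono tm_below.simps(5) max.cobounded1 max.cobounded2)
next
  case (Mul s t) then show ?case by (metis tm_below_mono tm_below.simps(6) max.cobounded1 max.cobounded2)
qed auto

lemma st_below_ex: "\<exists>n. st_below n X"
  by (cases X) auto

lemma fm_below_ex: "\<exists>m. fm_below m m \<phi>"
proof (induction \<phi>)
  case (Eq s t)
  obtain m m' where "tm_below m s" "tm_below m' t" using tm_below_ex by metis
  then show ?case by (intro exI[of _ "max m m'"]) (auto intro: tm_below_mono)
next
  case (Less s t)
  obtain m m' where "tm_below m s" "tm_below m' t" using tm_below_ex by metis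
  then show ?case by (intro exI[of _ "max m m'"]) (auto intro: tm_below_mono)
next
  case (Mem s X)
  obtain m m' where "tm_below m s" "st_below m' X" using tm_below_ex st_below_ex by metis
  then show ?case by (intro exI[of _ "max m m'"]) (auto intro: tm_below_mono st_below_mono)
next
  case (Imp \<phi> \<psi>)
  then obtain m m' where "fm_below m m \<phi>" "fm_below m' m' \<psi>" by blast
  then show ?case by (intro exI[of _ "max m m'"]) (auto intro: fm_below_mono)
next
  case (Forall \<phi>)
  then obtain m where "fm_below m m \<phi>" by blast
  then show ?case by (intro exI[of _ m]) (auto intro: fm_below_mono)
next
  case (ForallS \<phi>)
  then obtain m where "fm_below m m \<phi>" by blast
  then show ?case by (intro exI[of _ m]) (auto intro: fm_below_mono)
qed auto

text \<open>Variables play the role of Henkin constants. A common bound on the free variables of a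
  theory guarantees that a fresh one is left.\<close>

definition bounded :: "fm set \<Rightarrow> bool" where
  "bounded \<Gamma> \<longleftrightarrow> (\<exists>m. \<forall>\<gamma>\<in>\<Gamma>. fm_below m m \<gamma>)"

lemma bounded_Un: "bounded \<Gamma> \<Longrightarrow> bounded \<Delta> \<Longrightarrow> bounded (\<Gamma> \<union> \<Delta>)"
  unfolding bounded_def by (meson UnE fm_below_mono max.cobounded1 max.cobounded2)

lemma bounded_insert: "bounded (insert \<phi> \<Gamma>) \<longleftrightarrow> bounded \<Gamma>"
proof
  assume "bounded \<Gamma>"
  moreover have "bounded {\<phi>}" using fm_below_ex by (auto simp: bounded_def)
  ultimately show "bounded (insert \<phi> \<Gamma>)" using bounded_Un by fastforce
qed (auto simp: bounded_def)

lemma bounded_finite: "finite \<Gamma> \<Longrightarrow> bounded \<Gamma>"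
proof (induction rule: finite_induct)
  case (insert x F) then show ?case by (simp add: bounded_insert)
qed (simp add: bounded_def)

text \<open>Renaming the fresh variable \<open>k\<close> to 0 and moving all others up by one turns
  the hypotheses into their \<open>flift\<close> and the instance back into \<open>\<phi>\<close>,
  which is the shape that \<open>ForallI\<close> wants.\<close>

lemma generalize_number:
  assumes "\<Gamma> \<turnstile> inst \<phi> (NVar k)" and G: "\<And>\<gamma>. \<gamma> \<in> \<Gamma> \<Longrightarrow> fm_below k n \<gamma>" and "fm_below (Suc k) n \<phi>"
  shows "\<Gamma> \<turnstile> Forall \<phi>"
proof -
  let ?\<sigma> = "\<lambda>i. if i = k then NVar 0 else NVar (Suc i)"
  have "fsub ?\<sigma> SVar \<gamma> = flift \<gamma>" if "\<gamma> \<in> \<Gamma>" for \<gamma>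
    unfolding flift_def by (rule fsub_cong[OF G[OF that]]) auto
  then have 1: "fsub ?\<sigma> SVar ` \<Gamma> = flift ` \<Gamma>" by auto
  have "fsub ?\<sigma> SVar (inst \<phi> (NVar k)) = fsub NVar SVar \<phi>"
    unfolding inst_def fsub_fsub by (rule fsub_cong[OF assms(3)]) (auto split: nat.splits)
  then show ?thesis using proves_fsub[OF assms(1), of ?\<sigma> SVar] 1 by (auto simp: fsub_id intro: proves.ForallI)
qed

lemma generalize_set:
  assumes "\<Gamma> \<turnstile> instS \<phi> (SVar k)" and G: "\<And>\<gamma>. \<gamma> \<in> \<Gamma> \<Longrightarrow> fm_below n k \<gamma>" and "fm_below n (Suc k) \<phi>"
  shows "\<Gamma> \<turnstile> ForallS \<phi>"
proof -
  let ?\<tau> = "\<lambda>i. if i = k then SVar 0 else SVar (Suc i)"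
  have "fsub NVar ?\<tau> \<gamma> = fliftS \<gamma>" if "\<gamma> \<in> \<Gamma>" for \<gamma>
    unfolding fliftS_def by (rule fsub_cong[OF G[OF that]]) auto
  then have 1: "fsub NVar ?\<tau> ` \<Gamma> = fliftS ` \<Gamma>" by auto
  have "fsub NVar ?\<tau> (instS \<phi> (SVar k)) = fsub NVar SVar \<phi>"
    unfolding instS_def fsub_fsub by (rule fsub_cong[OF assms(3)]) (auto split: nat.splits)
  then show ?thesis using proves_fsub[OF assms(1), of NVar ?\<tau>] 1 by (auto simp: fsub_id intro: proves.ForallSI)
qed

section \<open>Model existence\<close>

definition con :: "fm set \<Rightarrow> bool" where
  "con \<Gamma> \<longleftrightarrow> \<not> (\<Gamma> \<turnstile> Fls)"

lemma con_decide: "con \<Gamma> \<Longrightarrow> \<not> con (insert \<phi> \<Gamma>) \<Longrightarrow> con (insert (\<^bold>\<not> \<phi>) \<Gamma>)"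
  unfolding con_def by (meson Contr ImpE ImpI)

text \<open>Existential quantifiers abbreviate negated universal ones, so witnesses are demanded
  exactly for refuted universal formulas.\<close>

definition decides :: "fm \<Rightarrow> fm set \<Rightarrow> bool" where
  "decides \<phi> \<Gamma> \<longleftrightarrow> \<phi> \<in> \<Gamma> \<or> (\<^bold>\<not> \<phi>) \<in> \<Gamma> \<and>
     (\<forall>\<chi>. \<phi> = Forall \<chi> \<longrightarrow> (\<exists>t. (\<^bold>\<not> inst \<chi> t) \<in> \<Gamma>)) \<and>
     (\<forall>\<chi>. \<phi> = ForallS \<chi> \<longrightarrow> (\<exists>X. (\<^bold>\<not> instS \<chi> X) \<in> \<Gamma>))"

text \<open>A refuted universal formula gets a counterexample at a fresh variable. If that were
  inconsistent, the instance would be derivable, and generalizing it would contradict the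
  refutation.\<close>

lemma decide_extension:
  assumes "con \<Gamma>" "bounded \<Gamma>"
  shows "\<exists>\<Gamma>'. \<Gamma> \<subseteq> \<Gamma>' \<and> con \<Gamma>' \<and> bounded \<Gamma>' \<and> decides \<phi> \<Gamma>'"
proof (cases "con (insert \<phi> \<Gamma>)")
  case True
  then show ?thesis using assms
    by (intro exI[of _ "insert \<phi> \<Gamma>"]) (auto simp: bounded_insert decides_def)
next
  case False
  let ?D = "insert (\<^bold>\<not> \<phi>) \<Gamma>"
  have con: "con ?D" by (rule con_decide[OF assms(1) False])
  obtain m where m: "\<And>\<gamma>. \<gamma> \<in> insert \<phi> ?D \<Longrightarrow> fm_below m m \<gamma>"
    using assms(2) bounded_insert[of _ ?D] bounded_insert[of "\<^bold>\<not> \<phi>" \<Gamma>] unfolding bounded_def by metis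
  show ?thesis
  proof (cases "(\<exists>\<chi>. \<phi> = Forall \<chi>) \<or> (\<exists>\<chi>. \<phi> = ForallS \<chi>)")
    case False
    then show ?thesis using con assms
      by (intro exI[of _ ?D]) (auto simp: bounded_insert decides_def)
  next
    case True
    then consider \<chi> where "\<phi> = Forall \<chi>" | \<chi> where "\<phi> = ForallS \<chi>" by blast
    then show ?thesis
    proof cases
      case 1
      have "con (insert (\<^bold>\<not> inst \<chi> (NVar m)) ?D)"
      proof (rule ccontr)
        assume "\<not> ?thesis"
        then have "?D \<turnstile> inst \<chi> (NVar m)" unfolding con_def by (blast intro: Contr)
        then have "?D \<turnstile> Forall \<chi>"
          by (rule generalize_number[of _ _ m m]) (use m m[of \<phi>] 1 in auto)
        then show False using con 1 unfolding con_def by (meson ImpE Hyp insertI1)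
      qed
      then show ?thesis using assms 1
        by (intro exI[of _ "insert (\<^bold>\<not> inst \<chi> (NVar m)) ?D"]) (auto simp: bounded_insert decides_def)
    next
      case 2
      have "con (insert (\<^bold>\<not> instS \<chi> (SVar m)) ?D)"
      proof (rule ccontr)
        assume "\<not> ?thesis"
        then have "?D \<turnstile> instS \<chi> (SVar m)" unfolding con_def by (blast intro: Contr)
        then have "?D \<turnstile> ForallS \<chi>"
          by (rule generalize_set[of _ _ m m]) (use m m[of \<phi>] 2 in auto)
        then show False using con 2 unfolding con_def by (meson ImpE Hyp insertI1)
      qed
      then show ?thesis using assms 2
        by (intro exI[of _ "insert (\<^bold>\<not> instS \<chi> (SVar m)) ?D"]) (auto simp: bounded_insert decides_def)
    qed
  qed
qed

instance tm :: countable by countable_datatype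
instance st :: countable by countable_datatype
instance fm :: countable by countable_datatype

section \<open>The term model of a complete theory with witnesses\<close>

locale henkin =
  fixes H :: "fm set"
  assumes con: "con H" and decided: "\<And>\<phi>. decides \<phi> H"
begin

lemma closed: "H \<turnstile> \<phi> \<Longrightarrow> \<phi> \<in> H"
  using con decided[of \<phi>] unfolding con_def decides_def by (meson Hyp ImpE)

lemma mem_iff: "\<phi> \<in> H \<longleftrightarrow> (H \<turnstile> \<phi>)"
  using closed Hyp by blast

lemma neg_iff: "(\<^bold>\<not> \<phi>) \<in> H \<longleftrightarrow> \<phi> \<notin> H"
  using con decided[of \<phi>] unfolding con_def decides_def by (meson Hyp ImpE)

lemma imp_iff: "(\<phi> \<^bold>\<longrightarrow> \<psi>) \<in> H \<longleftrightarrow> (\<phi> \<in> H \<longrightarrow> \<psi> \<in> H)"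
proof
  assume "(\<phi> \<^bold>\<longrightarrow> \<psi>) \<in> H" then show "\<phi> \<in> H \<longrightarrow> \<psi> \<in> H" using closed Hyp by (meson ImpE)
next
  assume *: "\<phi> \<in> H \<longrightarrow> \<psi> \<in> H"
  have "insert \<phi> H \<turnstile> \<psi>"
  proof (cases "\<psi> \<in> H")
    case True then show ?thesis by (auto intro: Hyp)
  next
    case False
    then have "(\<^bold>\<not> \<phi>) \<in> H" using * neg_iff by blast
    then have "insert (\<^bold>\<not> \<psi>) (insert \<phi> H) \<turnstile> Fls" by (intro ImpE[of _ \<phi> Fls] Hyp) auto
    then show ?thesis by (rule Contr)
  qed
  then show "(\<phi> \<^bold>\<longrightarrow> \<psi>) \<in> H" by (intro closed ImpI)
qed

lemma Forall_iff: "Forall \<phi> \<in> H \<longleftrightarrow> (\<forall>t. inst \<phi> t \<in> H)"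
proof
  assume "Forall \<phi> \<in> H" then show "\<forall>t. inst \<phi> t \<in> H" using mem_iff ForallE by metis
next
  assume "\<forall>t. inst \<phi> t \<in> H" then show "Forall \<phi> \<in> H"
    using decided[of "Forall \<phi>"] unfolding decides_def by (auto simp: neg_iff)
qed

lemma ForallS_iff: "ForallS \<phi> \<in> H \<longleftrightarrow> (\<forall>X. instS \<phi> X \<in> H)"
proof
  assume "ForallS \<phi> \<in> H" then show "\<forall>X. instS \<phi> X \<in> H" using mem_iff ForallSE by metis
next
  assume "\<forall>X. instS \<phi> X \<in> H" then show "ForallS \<phi> \<in> H"
    using decided[of "ForallS \<phi>"] unfolding decides_def by (auto simp: neg_iff)
qed

lemma eq_refl: "(t \<^bold>= t) \<in> H"
  by (intro closed Refl)

lemma eq_subst: "(t \<^bold>= u) \<in> H \<Longrightarrow> inst \<phi> t \<in> H \<Longrightarrow> inst \<phi> u \<in> H"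
  using mem_iff Subst by metis

lemma tsub_lift_inst: "tsub (case_nat t NVar) (u \<up> Suc 0) = u"
  by (simp add: tlift_def tsub_tsub tsub_NVar)

lemma eq_sym: "(t \<^bold>= u) \<in> H \<Longrightarrow> (u \<^bold>= t) \<in> H"
  using eq_subst[of t u "NVar 0 \<^bold>= t \<up> Suc 0"] eq_refl[of t] by (simp add: inst_def tsub_lift_inst)

lemma eq_trans: "(t \<^bold>= u) \<in> H \<Longrightarrow> (u \<^bold>= v) \<in> H \<Longrightarrow> (t \<^bold>= v) \<in> H"
  using eq_subst[of u v "t \<up> Suc 0 \<^bold>= NVar 0"] by (simp add: inst_def tsub_lift_inst)

text \<open>Each class of provably equal terms is represented by one of its members.\<close>

definition rep :: "tm \<Rightarrow> tm" where
  "rep t = (SOME u. (t \<^bold>= u) \<in> H)"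

lemma eq_rep: "(t \<^bold>= rep t) \<in> H"
  unfolding rep_def by (rule someI[of _ t]) (rule eq_refl)

lemma rep_eq_iff: "rep t = rep u \<longleftrightarrow> (t \<^bold>= u) \<in> H"
proof
  assume "rep t = rep u" then show "(t \<^bold>= u) \<in> H" using eq_rep eq_sym eq_trans by metis
next
  assume "(t \<^bold>= u) \<in> H"
  then have "(t \<^bold>= v) \<in> H \<longleftrightarrow> (u \<^bold>= v) \<in> H" for v using eq_sym eq_trans by blast
  then show "rep t = rep u" by (simp add: rep_def)
qed

text \<open>All terms provably in \<open>X\<close> are collected, not only the chosen
  representatives; by \<open>rep_Mem\<close> the two readings agree on the domain.\<close>

definition set_of :: "st \<Rightarrow> tm set" where
  "set_of X = {t. (t \<^bold>\<in> X) \<in> H}"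

definition term_model :: "tm model" where
  "term_model = \<lparr>Num = range rep, Sets = range set_of, ncst = rep NConst, scst = set_of SConst,
     zro = rep Zero, uno = rep One, pls = (\<lambda>s t. rep (s \<^bold>+ t)), tms = (\<lambda>s t. rep (s \<^bold>* t)),
     lss = (\<lambda>s t. (s \<^bold>< t) \<in> H)\<rparr>"

lemma wf_term_model: "wf_model term_model"
  by (auto simp: wf_model_def term_model_def)

lemma rep_Add: "rep (rep s \<^bold>+ rep t) = rep (s \<^bold>+ t)"
proof -
  have "(s \<^bold>+ t \<^bold>= rep s \<^bold>+ t) \<in> H"
    using eq_subst[OF eq_rep[of s], of "s \<up> Suc 0 \<^bold>+ t \<up> Suc 0 \<^bold>= NVar 0 \<^bold>+ t \<up> Suc 0"] eq_refl[of "s \<^bold>+ t"]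
    by (simp add: inst_def tsub_lift_inst)
  moreover have "(rep s \<^bold>+ t \<^bold>= rep s \<^bold>+ rep t) \<in> H"
    using eq_subst[OF eq_rep[of t], of "rep s \<up> Suc 0 \<^bold>+ t \<up> Suc 0 \<^bold>= rep s \<up> Suc 0 \<^bold>+ NVar 0"] eq_refl[of "rep s \<^bold>+ t"]
    by (simp add: inst_def tsub_lift_inst)
  ultimately show ?thesis using rep_eq_iff by metis
qed

lemma rep_Mul: "rep (rep s \<^bold>* rep t) = rep (s \<^bold>* t)"
proof -
  have "(s \<^bold>* t \<^bold>= rep s \<^bold>* t) \<in> H"
    using eq_subst[OF eq_rep[of s], of "s \<up> Suc 0 \<^bold>* t \<up> Suc 0 \<^bold>= NVar 0 \<^bold>* t \<up> Suc 0"] eq_refl[of "s \<^bold>* t"]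
    by (simp add: inst_def tsub_lift_inst)
  moreover have "(rep s \<^bold>* t \<^bold>= rep s \<^bold>* rep t) \<in> H"
    using eq_subst[OF eq_rep[of t], of "rep s \<up> Suc 0 \<^bold>* t \<up> Suc 0 \<^bold>= rep s \<up> Suc 0 \<^bold>* NVar 0"] eq_refl[of "rep s \<^bold>* t"]
    by (simp add: inst_def tsub_lift_inst)
  ultimately show ?thesis using rep_eq_iff by metis
qed

lemma rep_Less: "(rep s \<^bold>< rep t) \<in> H \<longleftrightarrow> (s \<^bold>< t) \<in> H"
proof -
  have "(a \<^bold>< b) \<in> H \<Longrightarrow> (a' \<^bold>< b') \<in> H" if "(a \<^bold>= a') \<in> H" "(b \<^bold>= b') \<in> H" for a a' b b'
    using eq_subst[OF that(1), of "NVar 0 \<^bold>< b \<up> Suc 0"] eq_subst[OF that(2), of "a' \<up> Suc 0 \<^bold>< NVar 0"]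
    by (simp add: inst_def tsub_lift_inst)
  then show ?thesis using eq_rep eq_sym by blast
qed

lemma rep_Mem: "(rep t \<^bold>\<in> X) \<in> H \<longleftrightarrow> (t \<^bold>\<in> X) \<in> H"
proof -
  have "(a \<^bold>\<in> X) \<in> H \<Longrightarrow> (a' \<^bold>\<in> X) \<in> H" if "(a \<^bold>= a') \<in> H" for a a'
    using eq_subst[OF that(1), of "NVar 0 \<^bold>\<in> X"] by (simp add: inst_def ssub_SVar)
  then show ?thesis using eq_rep eq_sym by blast
qed

lemma tval_term_model: "tval term_model (\<lambda>i. rep (\<sigma> i)) t = rep (tsub \<sigma> t)"
  by (induction t) (auto simp: term_model_def rep_Add rep_Mul)

lemma sval_term_model: "sval term_model (\<lambda>i. set_of (\<tau> i)) X = set_of (ssub \<tau> X)"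
  by (cases X) (auto simp: term_model_def)

text \<open>The truth lemma. It is stated for arbitrary substitutions, because a quantifier extends
  the environment by the value of a term, that is, the substitution by a term.\<close>

lemma sat_term_model:
  "sat term_model \<phi> (\<lambda>i. rep (\<sigma> i)) (\<lambda>i. set_of (\<tau> i)) \<longleftrightarrow> fsub \<sigma> \<tau> \<phi> \<in> H"
proof (induction \<phi> arbitrary: \<sigma> \<tau>)
  case Fls
  then show ?case using con Hyp by (auto simp: con_def)
next
  case (Eq s t)
  then show ?case by (simp add: tval_term_model rep_eq_iff)
next
  case (Less s t)
  have "lss term_model = (\<lambda>s t. (s \<^bold>< t) \<in> H)" by (simp add: term_model_def)
  then show ?case by (simp add: tval_term_model rep_Less)
next
  case (Mem t X)
  have "set_of (ssub \<tau> X) = {t. (t \<^bold>\<in> ssub \<tau> X) \<in> H}" for X by (simp add: set_of_def)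
  then show ?case by (simp add: tval_term_model sval_term_model rep_Mem)
next
  case (Imp \<phi> \<psi>)
  then show ?case by (simp add: imp_iff)
next
  case (Forall \<phi>)
  have 1: "rep t ## (\<lambda>i. rep (\<sigma> i)) = (\<lambda>i. rep ((t ## \<sigma>) i))" for t by (auto split: nat.splits)
  have 2: "inst (fsub (case_nat (NVar 0) (\<lambda>i. \<sigma> i \<up> Suc 0)) \<tau> \<phi>) t = fsub (t ## \<sigma>) \<tau> \<phi>" for t
    unfolding inst_def fsub_fsub
    by (rule arg_cong2[where f = "\<lambda>x y. fsub x y \<phi>"])
       (auto simp: tlift_def tsub_tsub tsub_NVar ssub_SVar split: nat.splits)
  have "Num term_model = range rep" by (simp add: term_model_def)
  then have "sat term_model (Forall \<phi>) (\<lambda>i. rep (\<sigma> i)) (\<lambda>i. set_of (\<tau> i)) \<longleftrightarrow> (\<forall>t. fsub (t ## \<sigma>) \<tau> \<phi> \<in> H)"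
    by (simp add: 1 Forall)
  then show ?case by (simp only: fsub.simps One_nat_def Forall_iff 2)
next
  case (ForallS \<phi>)
  have 1: "set_of X ## (\<lambda>i. set_of (\<tau> i)) = (\<lambda>i. set_of ((case_nat X \<tau>) i))" for X by (auto split: nat.splits)
  have 2: "instS (fsub \<sigma> (case_nat (SVar 0) (\<lambda>i. ssub (\<lambda>j. SVar (Suc j)) (\<tau> i))) \<phi>) X
     = fsub \<sigma> (case_nat X \<tau>) \<phi>" for X
    unfolding instS_def fsub_fsub
    by (rule arg_cong2[where f = "\<lambda>x y. fsub x y \<phi>"])
       (auto simp: ssub_ssub tsub_NVar ssub_SVar split: nat.splits)
  have "Sets term_model = range set_of" by (simp add: term_model_def)
  then have "sat term_model (ForallS \<phi>) (\<lambda>i. rep (\<sigma> i)) (\<lambda>i. set_of (\<tau> i)) \<longleftrightarrow> (\<forall>X. fsub \<sigma> (case_nat X \<tau>) \<phi> \<in> H)"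
    by (simp add: 1 ForallS)
  then show ?case by (simp only: fsub.simps ForallS_iff 2)
qed

end

lemma con_chain:
  fixes G :: "nat \<Rightarrow> fm set"
  assumes "\<And>n. con (G n)" "\<And>n. G n \<subseteq> G (Suc n)"
  shows "con (\<Union>n. G n)"
  unfolding con_def
proof
  assume "(\<Union>n. G n) \<turnstile> Fls"
  then obtain D where D: "D \<subseteq> (\<Union>n. G n)" "finite D" "D \<turnstile> Fls" using proves_finite by blast
  from D(2,1) have "\<exists>n. D \<subseteq> G n"
  proof (induction rule: finite_induct)
    case (insert x F)
    then obtain n m where "F \<subseteq> G n" "x \<in> G m" by blast
    then have "insert x F \<subseteq> G (max n m)"
      using lift_Suc_mono_le[of G, OF assms(2)] by (meson insert_subset max.cobounded1 max.cobounded2 subset_eq)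
    then show ?case by blast
  qed auto
  then show False using D(3) assms(1) proves_mono unfolding con_def by blast
qed

text \<open>A Henkin construction interleaved with prescribed steps: besides a theory, every stage has a
  current variable \<open>k\<close>, and at stage \<open>n\<close> the formulas \<open>R n k k'\<close> are added for some new current variable \<open>k'\<close>.\<close>

theorem interleaved_model_existence:
  fixes Q :: "fm set \<Rightarrow> nat \<Rightarrow> bool" and R :: "nat \<Rightarrow> nat \<Rightarrow> nat \<Rightarrow> fm set"
  assumes start: "con \<Gamma>" "bounded \<Gamma>" "Q \<Gamma> k"
    and mono: "\<And>\<Gamma> \<Gamma>' k. Q \<Gamma> k \<Longrightarrow> \<Gamma> \<subseteq> \<Gamma>' \<Longrightarrow> Q \<Gamma>' k"
    and step: "\<And>n \<Gamma> k. con \<Gamma> \<Longrightarrow> bounded \<Gamma> \<Longrightarrow> Q \<Gamma> k \<Longrightarrow>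
       \<exists>\<Gamma>' k'. \<Gamma> \<subseteq> \<Gamma>' \<and> con \<Gamma>' \<and> bounded \<Gamma>' \<and> Q \<Gamma>' k' \<and> R n k k' \<subseteq> \<Gamma>'"
  obtains M :: "tm model" and e s and kk :: "nat \<Rightarrow> nat"
    where "wf_model M" "envs M e s" "Num M = range (tval M e)" "\<And>\<gamma>. \<gamma> \<in> \<Gamma> \<Longrightarrow> sat M \<gamma> e s"
      "kk 0 = k" "\<And>n \<gamma>. \<gamma> \<in> R n (kk n) (kk (Suc n)) \<Longrightarrow> sat M \<gamma> e s"
proof -
  let ?P = "\<lambda>n (D, j). con D \<and> bounded D \<and> Q D j \<and> \<Gamma> \<subseteq> D \<and> (n = 0 \<longrightarrow> j = k)"
  \<comment> \<open>\<open>from_nat n\<close> runs through all formulas, so every formula is decided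
    at some stage.\<close>
  let ?Q = "\<lambda>n (D, j) (D', j'). D \<subseteq> D' \<and> R n j j' \<subseteq> D' \<and> decides (from_nat n) D'"
  have "\<exists>f. \<forall>n. ?P n (f n) \<and> ?Q n (f n) (f (Suc n))"
  proof (rule dependent_nat_choice)
    show "\<exists>x. ?P 0 x" using start by auto
  next
    fix x and n :: nat assume "?P n x"
    then obtain D j where x: "x = (D, j)" "con D" "bounded D" "Q D j" "\<Gamma> \<subseteq> D" by (cases x) auto
    from step[OF x(2-4), of n] obtain D1 j1 where 1: "D \<subseteq> D1" "con D1" "bounded D1" "Q D1 j1" "R n j j1 \<subseteq> D1" by blast
    from decide_extension[OF 1(2,3)] obtain D2 where "D1 \<subseteq> D2" "con D2" "bounded D2" "decides (from_nat n) D2" by blast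
    then show "\<exists>y. ?P (Suc n) y \<and> ?Q n x y"
      using x 1 mono[OF 1(4)] by (intro exI[of _ "(D2, j1)"]) auto
  qed
  then obtain f where f': "\<forall>n. ?P n (f n) \<and> ?Q n (f n) (f (Suc n))" by (rule exE)
  note f = f'[THEN spec, THEN conjunct1] f'[THEN spec, THEN conjunct2]
  define G where "G n = fst (f n)" for n
  define kk where "kk n = snd (f n)" for n
  have fG: "f n = (G n, kk n)" for n by (simp add: G_def kk_def)
  let ?H = "\<Union>n. G n"
  have "con ?H" by (rule con_chain) (use f in \<open>auto simp: fG\<close>)
  moreover have "decides \<phi> ?H" for \<phi>
  proof -
    have "decides \<phi> (G (Suc (to_nat \<phi>)))" using f(2)[of "to_nat \<phi>"] by (auto simp: fG)
    then show ?thesis unfolding decides_def by blast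
  qed
  ultimately interpret henkin ?H by unfold_locales
  let ?e = "\<lambda>i. rep (NVar i)" and ?s = "\<lambda>i. set_of (SVar i)"
  have sat: "sat term_model \<gamma> ?e ?s" if "\<gamma> \<in> ?H" for \<gamma>
    using sat_term_model[of \<gamma> NVar SVar] that by (simp add: fsub_id)
  show thesis
  proof (rule that[OF wf_term_model, of ?e ?s kk])
    show "envs term_model ?e ?s" by (auto simp: envs_def term_model_def)
    \<comment> \<open>Every element is named by a term. This is what lets an enumeration of terms
      treat every colouring of the model.\<close>
    show "Num term_model = range (tval term_model ?e)"
      using tval_term_model[of NVar] by (simp add: tsub_NVar term_model_def)
    show "kk 0 = k" using f(1)[of 0] by (simp add: fG)
    fix \<gamma> show "\<gamma> \<in> \<Gamma> \<Longrightarrow> sat term_model \<gamma> ?e ?s"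
      by (rule sat) (use f(1)[of 0] in \<open>auto simp: fG\<close>)
    fix n show "\<gamma> \<in> R n (kk n) (kk (Suc n)) \<Longrightarrow> sat term_model \<gamma> ?e ?s"
      by (rule sat, rule UN_I[of "Suc n"]) (use f(2)[of n] in \<open>auto simp: fG\<close>)
  qed
qed

corollary model_existence:
  assumes "con \<Gamma>" "bounded \<Gamma>"
  obtains M :: "tm model" and e s where "wf_model M" "envs M e s" "\<forall>\<gamma>\<in>\<Gamma>. sat M \<gamma> e s"
  by (rule interleaved_model_existence[of \<Gamma> "\<lambda>_ _. True" 0 "\<lambda>_ _ _. {}"]) (use assms in auto)

section \<open>Definable relations in models of \<open>I\<Sigma>\<^sub>1\<close>\<close>

class arith = zero + one + plus + times + minus + ord +
  fixes acst :: 'a and Aset :: "'a set" and Asets :: "'a set set"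
begin

definition smodel :: "'a model" where
  "smodel = \<lparr>Num = UNIV, Sets = Asets, ncst = acst, scst = Aset, zro = 0, uno = 1,
     pls = (+), tms = (*), lss = (<)\<rparr>"

end

text \<open>The order and truncated subtraction are definitional extensions, included so that the
  class becomes an instance of \<open>linordered_semidom\<close>. In the induction axiom every set
  variable denotes \<open>Aset\<close>, the only set that the predicates in \<open>D0\<close>
  mention.\<close>

class peano = arith +
  assumes add1_neq_0: "n + 1 \<noteq> 0"
    and add1_inj: "m + 1 = n + 1 \<Longrightarrow> m = n"
    and add_0: "m + 0 = m"
    and add_add1: "m + (n + 1) = (m + n) + 1"
    and mul_0: "m * 0 = 0"
    and mul_add1: "m * (n + 1) = m * n + m"
    and nless_0: "\<not> m < 0"
    and less_add1: "m < n + 1 \<longleftrightarrow> m < n \<or> m = n"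
    and le_def: "m \<le> n \<longleftrightarrow> m < n \<or> m = n"
    and diff_def: "m - n = (if \<exists>k. m = n + k then THE k. m = n + k else 0)"
    and Sigma01_induction: "Sigma01 \<phi> \<Longrightarrow> sat smodel \<phi> (0 ## e) (\<lambda>_. Aset) \<Longrightarrow>
      (\<And>x. sat smodel \<phi> (x ## e) (\<lambda>_. Aset) \<Longrightarrow> sat smodel \<phi> ((x + 1) ## e) (\<lambda>_. Aset)) \<Longrightarrow>
      sat smodel \<phi> (x ## e) (\<lambda>_. Aset)"

inductive Tm :: "((nat \<Rightarrow> 'a::arith) \<Rightarrow> 'a) \<Rightarrow> bool" where
  Tm_var: "Tm (\<lambda>e. e i)"
| Tm_const: "Tm (\<lambda>e. c)"
| Tm_add: "Tm f \<Longrightarrow> Tm g \<Longrightarrow> Tm (\<lambda>e. f e + g e)"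
| Tm_mul: "Tm f \<Longrightarrow> Tm g \<Longrightarrow> Tm (\<lambda>e. f e * g e)"

text \<open>Parameters from the model are admitted as constants.\<close>

inductive D0 :: "((nat \<Rightarrow> 'a::arith) \<Rightarrow> bool) \<Rightarrow> bool" where
  D0_False: "D0 (\<lambda>e. False)"
| D0_eq: "Tm f \<Longrightarrow> Tm g \<Longrightarrow> D0 (\<lambda>e. f e = g e)"
| D0_less: "Tm f \<Longrightarrow> Tm g \<Longrightarrow> D0 (\<lambda>e. f e < g e)"
| D0_Aset: "Tm f \<Longrightarrow> D0 (\<lambda>e. f e \<in> Aset)"
| D0_imp: "D0 P \<Longrightarrow> D0 Q \<Longrightarrow> D0 (\<lambda>e. P e \<longrightarrow> Q e)"
| D0_ball: "Tm f \<Longrightarrow> D0 P \<Longrightarrow> D0 (\<lambda>e. \<forall>x<f e. P (x ## e))"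

text \<open>Links formulas with predicates on environments: \<open>v\<close> says for each variable
  of a formula whether it reads a variable of the predicate (\<open>Inl\<close>) or denotes a
  parameter of the model (\<open>Inr\<close>).\<close>

definition ev :: "(nat \<Rightarrow> nat + 'a) \<Rightarrow> (nat \<Rightarrow> 'a) \<Rightarrow> nat \<Rightarrow> 'a" where
  "ev v e i = case_sum e id (v i)"

lemma tsub_lift_Suc: "tsub (case_nat (NVar 0) (\<lambda>i. \<sigma> i \<up> Suc 0)) (t \<up> Suc 0) = tsub \<sigma> t \<up> Suc 0"
  by (simp add: tlift_def tsub_tsub)

lemma Sigma00_fsub: "Sigma00 \<phi> \<Longrightarrow> Sigma00 (fsub \<sigma> \<tau> \<phi>)"
proof (induction arbitrary: \<sigma> \<tau> rule: Sigma00.induct)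
  case (6 \<phi> t)
  then show ?case
    using Sigma00.intros(6)[of "fsub (case_nat (NVar 0) (\<lambda>i. \<sigma> i \<up> 1)) \<tau> \<phi>" "tsub \<sigma> t"]
    by (simp add: tsub_lift_Suc)
next
  case (7 \<phi> t)
  then show ?case
    using Sigma00.intros(7)[of "fsub (case_nat (NVar 0) (\<lambda>i. \<sigma> i \<up> 1)) \<tau> \<phi>" "tsub \<sigma> t"]
    by (simp add: tsub_lift_Suc)
qed (auto intro: Sigma00.intros)

text \<open>Even and odd indices keep the variables of two formulas apart, so that their parameters
  can be combined without clashes.\<close>

definition join :: "(nat \<Rightarrow> 'b) \<Rightarrow> (nat \<Rightarrow> 'b) \<Rightarrow> nat \<Rightarrow> 'b" where
  "join v w i = (if even i then v (i div 2) else w (i div 2))"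

lemma ev_join [simp]: "ev (join v w) e (2 * i) = ev v e i" "ev (join v w) e (Suc (2 * i)) = ev w e i"
  by (simp_all add: ev_def join_def)

lemma Tm_tm: "Tm f \<Longrightarrow> \<exists>t v. \<forall>e. f e = tval smodel (ev v e) t"
proof (induction rule: Tm.induct)
  case (Tm_var i)
  show ?case by (rule exI[of _ "NVar 0"], rule exI[of _ "\<lambda>_. Inl i"]) (simp add: ev_def)
next
  case (Tm_const c)
  show ?case by (rule exI[of _ "NVar 0"], rule exI[of _ "\<lambda>_. Inr c"]) (simp add: ev_def)
next
  case (Tm_add f g)
  then obtain t v u w where "\<forall>e. f e = tval smodel (ev v e) t" "\<forall>e. g e = tval smodel (ev w e) u" by blast
  then show ?case
    by (intro exI[of _ "tsub (\<lambda>i. NVar (2 * i)) t \<^bold>+ tsub (\<lambda>i. NVar (Suc (2 * i))) u"] exI[of _ "join v w"])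
       (simp add: tval_tsub, simp add: smodel_def)
next
  case (Tm_mul f g)
  then obtain t v u w where "\<forall>e. f e = tval smodel (ev v e) t" "\<forall>e. g e = tval smodel (ev w e) u" by blast
  then show ?case
    by (intro exI[of _ "tsub (\<lambda>i. NVar (2 * i)) t \<^bold>* tsub (\<lambda>i. NVar (Suc (2 * i))) u"] exI[of _ "join v w"])
       (simp add: tval_tsub, simp add: smodel_def)
qed

text \<open>The bridge from the rule-based class to the induction axiom, which speaks of formulas:
  membership in \<open>D0\<close> is checked by rules, and a formula is produced only here.\<close>

lemma D0_fm: "D0 P \<Longrightarrow> \<exists>\<phi> v. Sigma00 \<phi> \<and> (\<forall>e. P e = sat smodel \<phi> (ev v e) (\<lambda>_. Aset))"
proof (induction rule: D0.induct)
  case D0_False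
  show ?case by (rule exI[of _ Fls]) (simp add: Sigma00.intros)
next
  case (D0_eq f g)
  then obtain t v u w where "\<forall>e. f e = tval smodel (ev v e) t" "\<forall>e. g e = tval smodel (ev w e) u"
    using Tm_tm by metis
  then show ?case
    by (intro exI[of _ "tsub (\<lambda>i. NVar (2 * i)) t \<^bold>= tsub (\<lambda>i. NVar (Suc (2 * i))) u"] exI[of _ "join v w"])
       (simp add: tval_tsub Sigma00.intros)
next
  case (D0_less f g)
  then obtain t v u w where "\<forall>e. f e = tval smodel (ev v e) t" "\<forall>e. g e = tval smodel (ev w e) u"
    using Tm_tm by metis
  then show ?case
    by (intro exI[of _ "tsub (\<lambda>i. NVar (2 * i)) t \<^bold>< tsub (\<lambda>i. NVar (Suc (2 * i))) u"] exI[of _ "join v w"])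
       (simp add: tval_tsub Sigma00.intros, simp add: smodel_def)
next
  case (D0_Aset f)
  then obtain t v where "\<forall>e. f e = tval smodel (ev v e) t"
    using Tm_tm by metis
  then show ?case
    by (intro exI[of _ "t \<^bold>\<in> SConst"] exI[of _ v]) (simp add: Sigma00.intros, simp add: smodel_def)
next
  case (D0_imp P Q)
  then obtain \<phi> v \<psi> w where "Sigma00 \<phi>" "\<forall>e. P e = sat smodel \<phi> (ev v e) (\<lambda>_. Aset)"
    "Sigma00 \<psi>" "\<forall>e. Q e = sat smodel \<psi> (ev w e) (\<lambda>_. Aset)" by blast
  then show ?case
    by (intro exI[of _ "fsub (\<lambda>i. NVar (2 * i)) SVar \<phi> \<^bold>\<longrightarrow> fsub (\<lambda>i. NVar (Suc (2 * i))) SVar \<psi>"] exI[of _ "join v w"])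
       (simp add: sat_fsub Sigma00.intros Sigma00_fsub)
next
  case (D0_ball f P)
  then obtain \<phi> v t w where *: "Sigma00 \<phi>" "\<forall>e. P e = sat smodel \<phi> (ev v e) (\<lambda>_. Aset)"
    "\<forall>e. f e = tval smodel (ev w e) t" using Tm_tm by metis
  \<comment> \<open>Indices that \<open>v\<close> sends to the bound variable become
    \<open>NVar 0\<close> through \<open>?\<sigma>\<close>; the remaining variables move down by one
    when the quantifier is placed in front. The value of \<open>?v\<close> at the former indices is
    a dummy.\<close>
  let ?v = "\<lambda>i. case v i of Inl 0 \<Rightarrow> Inl 0 | Inl (Suc j) \<Rightarrow> Inl j | Inr c \<Rightarrow> Inr c"
  let ?\<sigma> = "\<lambda>i. if v i = Inl 0 then NVar 0 else NVar (Suc (2 * i))"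
  let ?t = "tsub (\<lambda>i. NVar (Suc (2 * i))) t"
  have "tval smodel (x ## ev (join ?v w) e) (?\<sigma> i) = ev v (x ## e) i" for x e i
    by (auto simp: ev_def join_def split: sum.splits nat.splits)
  then have "sat smodel (fsub ?\<sigma> SVar \<phi>) (x ## ev (join ?v w) e) (\<lambda>_. Aset) = P (x ## e)" for x e
    using * by (simp add: sat_fsub)
  moreover have "tval smodel (ev (join ?v w) e) ?t = f e" for e
    using * by (simp add: tval_tsub)
  ultimately have "\<forall>e. (\<forall>x<f e. P (x ## e)) = sat smodel (BForall ?t (fsub ?\<sigma> SVar \<phi>)) (ev (join ?v w) e) (\<lambda>_. Aset)"
    by (simp add: smodel_def)
  moreover have "Sigma00 (BForall ?t (fsub ?\<sigma> SVar \<phi>))" by (intro Sigma00.intros(6) Sigma00_fsub *)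
  ultimately show ?case by (intro exI conjI)
qed

definition S1 :: "((nat \<Rightarrow> 'a::arith) \<Rightarrow> bool) \<Rightarrow> bool" where
  "S1 P \<longleftrightarrow> (\<exists>Q. D0 Q \<and> (\<forall>e. P e \<longleftrightarrow> (\<exists>y. Q (y ## e))))"

lemma S1_induct:
  fixes x :: "'a::peano"
  assumes S: "S1 (\<lambda>e. P (e 0))" and "P 0" and step: "\<And>x. P x \<Longrightarrow> P (x + 1)"
  shows "P x"
proof -
  obtain Q where Q: "D0 Q" "\<And>e. P (e 0) \<longleftrightarrow> (\<exists>y. Q (y ## e))" using S unfolding S1_def by blast
  obtain \<phi> v where \<phi>: "Sigma00 \<phi>" "\<And>e. Q e = sat smodel \<phi> (ev v e) (\<lambda>_. Aset)" using D0_fm[OF Q(1)] by blast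
  \<comment> \<open>Variable 0 is the witness \<open>y\<close> and variable 1 the induction
    variable. Further variables may be set to zero because \<open>P\<close> looks only at
    \<open>e 0\<close>; the parameter belonging to index \<open>i\<close> is stored at position
    \<open>i + 2\<close>.\<close>
  let ?\<sigma> = "\<lambda>i. case v i of Inl j \<Rightarrow> if j = 0 then NVar 0 else if j = 1 then NVar 1 else Zero | Inr c \<Rightarrow> NVar (i + 2)"
  let ?p = "\<lambda>i. case v i of Inl j \<Rightarrow> 0 | Inr c \<Rightarrow> c"
  have "tval smodel (y ## x ## ?p) (?\<sigma> i) = ev v (y ## x ## (\<lambda>_. 0)) i" for x y i
    by (auto simp: ev_def smodel_def split: sum.splits nat.splits)
  then have "P x \<longleftrightarrow> (\<exists>y. sat smodel (fsub ?\<sigma> SVar \<phi>) (y ## x ## ?p) (\<lambda>_. Aset))" for x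
    using Q(2)[of "x ## (\<lambda>_. 0)"] by (simp add: \<phi>(2) sat_fsub)
  then have P: "P x \<longleftrightarrow> sat smodel (Exists (fsub ?\<sigma> SVar \<phi>)) (x ## ?p) (\<lambda>_. Aset)" for x
    by (simp add: smodel_def)
  have "Sigma01 (Exists (fsub ?\<sigma> SVar \<phi>))" using \<phi>(1) Sigma00_fsub unfolding Sigma01_def by blast
  then show ?thesis unfolding P by (rule Sigma01_induction) (use assms(2,3) P in blast)+
qed

lemma Tm_subst: "Tm f \<Longrightarrow> (\<And>i. Tm (\<lambda>e. \<sigma> e i)) \<Longrightarrow> Tm (\<lambda>e. f (\<sigma> e))"
proof (induction rule: Tm.induct)
  case (Tm_add f g)
  from Tm_add.IH(1)[OF Tm_add.prems] Tm_add.IH(2)[OF Tm_add.prems] show ?case by (rule Tm.Tm_add)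
next
  case (Tm_mul f g)
  from Tm_mul.IH(1)[OF Tm_mul.prems] Tm_mul.IH(2)[OF Tm_mul.prems] show ?case by (rule Tm.Tm_mul)
qed (auto intro: Tm.Tm_const)

lemma Tm_Suc: "Tm f \<Longrightarrow> Tm (\<lambda>e. f (\<lambda>i. e (Suc i)))"
  by (erule Tm_subst) (rule Tm_var)

lemma D0_subst: "D0 P \<Longrightarrow> (\<And>i. Tm (\<lambda>e. \<sigma> e i)) \<Longrightarrow> D0 (\<lambda>e. P (\<sigma> e))"
proof (induction arbitrary: \<sigma> rule: D0.induct)
  case (D0_ball f P)
  have "Tm (\<lambda>e. (e 0 ## \<sigma> (\<lambda>i. e (Suc i))) i)" for i
    using Tm_Suc[OF D0_ball.prems] by (cases i) (auto intro: Tm.Tm_var)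
  from D0_ball.IH[OF this] have "D0 (\<lambda>e. P (e 0 ## \<sigma> (\<lambda>i. e (Suc i))))" .
  from D0.D0_ball[OF Tm_subst[OF D0_ball.hyps(1) D0_ball.prems] this] show ?case by simp
next
  case (D0_eq f g)
  from Tm_subst[OF D0_eq.hyps(1) D0_eq.prems] Tm_subst[OF D0_eq.hyps(2) D0_eq.prems]
  show ?case by (rule D0.D0_eq)
next
  case (D0_less f g)
  from Tm_subst[OF D0_less.hyps(1) D0_less.prems] Tm_subst[OF D0_less.hyps(2) D0_less.prems]
  show ?case by (rule D0.D0_less)
next
  case (D0_Aset f)
  from Tm_subst[OF D0_Aset.hyps D0_Aset.prems] show ?case by (rule D0.D0_Aset)
next
  case (D0_imp P Q)
  from D0_imp.IH(1)[OF D0_imp.prems] D0_imp.IH(2)[OF D0_imp.prems] show ?case by (rule D0.D0_imp)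
qed (rule D0.D0_False)

lemma D0_rename: "D0 P \<Longrightarrow> D0 (\<lambda>e. P (\<lambda>i. e (r i)))"
  by (erule D0_subst) (rule Tm_var)

lemma D0_S1: "D0 P \<Longrightarrow> S1 P"
  unfolding S1_def by (intro exI[of _ "\<lambda>e. P (\<lambda>i. e (Suc i))"]) (auto intro: D0_rename)

lemma D0_not: "D0 P \<Longrightarrow> D0 (\<lambda>e. \<not> P e)"
  using D0_imp[OF _ D0_False] by auto

lemma D0_conj: "D0 P \<Longrightarrow> D0 Q \<Longrightarrow> D0 (\<lambda>e. P e \<and> Q e)"
  using D0_not[OF D0_imp[OF _ D0_not]] by fastforce

lemma D0_disj: "D0 P \<Longrightarrow> D0 Q \<Longrightarrow> D0 (\<lambda>e. P e \<or> Q e)"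
  using D0_imp[OF D0_not, of P Q] by (simp add: disj_imp)

lemma D0_all: "Tm f \<Longrightarrow> D0 (\<lambda>e. P (e 0) (\<lambda>i. e (Suc i))) \<Longrightarrow> D0 (\<lambda>e. \<forall>x<f e. P x e)"
  using D0_ball[of f "\<lambda>e. P (e 0) (\<lambda>i. e (Suc i))"] by simp

lemma D0_bex: "Tm f \<Longrightarrow> D0 (\<lambda>e. P (e 0) (\<lambda>i. e (Suc i))) \<Longrightarrow> D0 (\<lambda>e. \<exists>x<f e. P x e)"
  using D0_not[OF D0_all[of f "\<lambda>x e. \<not> P x e", OF _ D0_not]] by simp

lemma D0_less_eq: "Tm f \<Longrightarrow> Tm g \<Longrightarrow> D0 (\<lambda>e. f e \<le> (g e :: 'a::peano))"
  unfolding le_def by (intro D0_disj D0_eq D0_less)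

lemmas D0_rules = D0_False D0_conj D0_disj D0_all D0_bex D0_not D0_eq D0_less D0_less_eq D0_Aset D0_imp
  Tm_var Tm_const Tm_add Tm_mul

section \<open>Ordered semiring laws\<close>

lemma peano_zero_add: "0 + (n::'a::peano) = n"
  by (rule S1_induct[of "\<lambda>n. 0 + n = n"]) (rule D0_S1, (rule D0_rules)+, auto simp: add_0 add_add1)

lemma peano_add1_add: "(m + 1) + (n::'a::peano) = (m + n) + 1"
  by (rule S1_induct[of "\<lambda>n. (m + 1) + n = (m + n) + 1"]) (rule D0_S1, (rule D0_rules)+, auto simp: add_0 add_add1)

lemma peano_add_commute: "m + n = n + (m::'a::peano)"
  by (rule S1_induct[of "\<lambda>n. m + n = n + m"])
     (rule D0_S1, (rule D0_rules)+, auto simp: add_0 add_add1 peano_zero_add peano_add1_add)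

lemma peano_add_assoc: "(a + b) + c = a + (b + (c::'a::peano))"
  by (rule S1_induct[of "\<lambda>c. (a + b) + c = a + (b + c)"]) (rule D0_S1, (rule D0_rules)+, auto simp: add_0 add_add1)

lemma peano_zero_mul: "0 * (n::'a::peano) = 0"
  by (rule S1_induct[of "\<lambda>n. 0 * n = 0"]) (rule D0_S1, (rule D0_rules)+, auto simp: mul_0 mul_add1 add_0)

lemma peano_add_left_commute: "a + (b + c) = b + (a + (c::'a::peano))"
  by (metis peano_add_assoc peano_add_commute)

lemmas peano_add_ac = peano_add_assoc peano_add_commute peano_add_left_commute

lemma peano_add1_mul: "(m + 1) * (n::'a::peano) = m * n + n"
  by (rule S1_induct[of "\<lambda>n. (m + 1) * n = m * n + n"])
     (rule D0_S1, (rule D0_rules)+, auto simp: mul_0 add_0 mul_add1 peano_add_ac)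

lemma peano_mul_commute: "m * n = n * (m::'a::peano)"
  by (rule S1_induct[of "\<lambda>n. m * n = n * m"])
     (rule D0_S1, (rule D0_rules)+, auto simp: mul_0 mul_add1 peano_zero_mul peano_add1_mul)

lemma peano_distrib: "a * (b + c) = a * b + a * (c::'a::peano)"
  by (rule S1_induct[of "\<lambda>c. a * (b + c) = a * b + a * c"])
     (rule D0_S1, (rule D0_rules)+, auto simp: mul_0 mul_add1 add_0 peano_add_assoc[symmetric])

lemma peano_mul_one: "n * 1 = (n::'a::peano)"
  by (metis mul_0 mul_add1 peano_zero_add)

lemma peano_mul_assoc: "(a * b) * c = a * (b * (c::'a::peano))"
  by (rule S1_induct[of "\<lambda>c. (a * b) * c = a * (b * c)"])
     (rule D0_S1, (rule D0_rules)+, auto simp: mul_0 peano_mul_one peano_distrib)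

lemma peano_one_mul: "1 * (n::'a::peano) = n"
  by (metis mul_0 mul_add1 peano_mul_commute peano_zero_add)

lemma peano_add_cancel: "a + b = a + c \<Longrightarrow> b = (c::'a::peano)"
proof -
  have "a + b = a + c \<longrightarrow> b = c"
    by (rule S1_induct[of "\<lambda>a. a + b = a + c \<longrightarrow> b = c"])
       (rule D0_S1, (rule D0_rules)+, auto simp: peano_zero_add peano_add1_add dest: add1_inj)
  then show "a + b = a + c \<Longrightarrow> b = c" by blast
qed

lemma peano_zero_or_add1: "n = 0 \<or> (\<exists>m. n = m + (1::'a::peano))"
proof -
  \<comment> \<open>The bound \<open>m<n\<close> makes the induction formula \<open>D0\<close>;
    closure of \<open>S1\<close> under quantifiers is established only after the order laws.\<close>
  have "n = 0 \<or> (\<exists>m<n. n = m + 1)"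
    by (rule S1_induct[of "\<lambda>n. n = 0 \<or> (\<exists>m<n. n = m + 1)"])
       (rule D0_S1, (rule D0_rules)+, auto simp: less_add1)
  then show ?thesis by blast
qed

lemma peano_less_iff: "x < y \<longleftrightarrow> (\<exists>z. y = x + z + (1::'a::peano))"
proof
  have mono: "z < w \<longrightarrow> z + 1 < w + 1" for z w :: 'a
    by (rule S1_induct[of "\<lambda>w. z < w \<longrightarrow> z + 1 < w + 1"])
       (rule D0_S1, (rule D0_rules)+, auto simp: nless_0 less_add1)
  have "x < y \<longrightarrow> (\<exists>z<y + 1. y = x + z + 1)"
  proof (rule S1_induct[of "\<lambda>y. x < y \<longrightarrow> (\<exists>z<y + 1. y = x + z + 1)"])
    show "S1 (\<lambda>e. x < e 0 \<longrightarrow> (\<exists>z<e 0 + 1. e 0 = x + z + 1))" by (rule D0_S1, (rule D0_rules)+)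
    show "x < 0 \<longrightarrow> (\<exists>z<0 + 1. 0 = x + z + 1)" by (simp add: nless_0)
    fix y assume IH: "x < y \<longrightarrow> (\<exists>z<y + 1. y = x + z + 1)"
    show "x < y + 1 \<longrightarrow> (\<exists>z<y + 1 + 1. y + 1 = x + z + 1)"
    proof
      assume "x < y + 1"
      then consider "x < y" | "x = y" using less_add1 by blast
      then show "\<exists>z<y + 1 + 1. y + 1 = x + z + 1"
      proof cases
        case 1
        then obtain z where "z < y + 1" "y = x + z + 1" using IH by blast
        then show ?thesis using mono by (intro exI[of _ "z + 1"]) (simp add: add_add1)
      next
        case 2
        have "0 < w + 1" for w :: 'a
          by (rule S1_induct[of "\<lambda>w. 0 < w + 1"]) (rule D0_S1, (rule D0_rules)+, auto simp: less_add1)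
        with 2 show ?thesis by (intro exI[of _ 0]) (simp add: add_0)
      qed
    qed
  qed
  then show "x < y \<Longrightarrow> \<exists>z. y = x + z + 1" by blast
  have "x < x + z + 1" for z
    by (rule S1_induct[of "\<lambda>z. x < x + z + 1"]) (rule D0_S1, (rule D0_rules)+, auto simp: less_add1 add_0 add_add1)
  then show "\<exists>z. y = x + z + 1 \<Longrightarrow> x < y" by blast
qed

lemma peano_le_iff: "x \<le> y \<longleftrightarrow> (\<exists>z. y = x + (z::'a::peano))"
proof
  assume "x \<le> y" then show "\<exists>z. y = x + z"
    unfolding le_def peano_less_iff by (metis add_0 peano_add_assoc)
next
  assume "\<exists>z. y = x + z"
  then obtain z where "y = x + z" by blast
  then show "x \<le> y"
    using peano_zero_or_add1[of z] unfolding le_def peano_less_iff by (auto simp: add_0 peano_add_assoc)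
qed

lemma peano_irrefl: "\<not> x < (x::'a::peano)"
  by (metis add1_neq_0 add_0 peano_add_assoc peano_add_cancel peano_less_iff)

lemma peano_linear: "x \<le> y \<or> y \<le> (x::'a::peano)"
proof -
  have "x \<le> y \<or> y \<le> x"
  proof (rule S1_induct[of "\<lambda>y. x \<le> y \<or> y \<le> x"])
    show "S1 (\<lambda>e. x \<le> e 0 \<or> e 0 \<le> x)" by (rule D0_S1, (rule D0_rules)+)
    show "x \<le> 0 \<or> 0 \<le> x" unfolding peano_le_iff using peano_zero_add by metis
    fix y assume "x \<le> y \<or> y \<le> x"
    then show "x \<le> y + 1 \<or> y + 1 \<le> x"
    proof
      assume "x \<le> y" then show ?thesis by (auto simp: le_def less_add1)
    next
      assume "y \<le> x"
      then consider "y < x" | "y = x" by (auto simp: le_def)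
      then show ?thesis
      proof cases
        case 1
        then obtain z where "x = y + z + 1" unfolding peano_less_iff by blast
        then have "x = (y + 1) + z" by (simp add: peano_add_ac)
        then have "y + 1 = x \<or> y + 1 < x"
          using peano_zero_or_add1[of z] unfolding peano_less_iff by (metis add_0 peano_add_assoc)
        then show ?thesis by (auto simp: le_def)
      next
        case 2 then show ?thesis by (auto simp: le_def less_add1)
      qed
    qed
  qed
  then show ?thesis .
qed

lemma peano_add_eq_0: "x + y = 0 \<Longrightarrow> y = (0::'a::peano)"
  by (metis add1_neq_0 add_add1 peano_zero_or_add1)

lemma peano_diff_add: "x + y - x = (y::'a::peano)"
proof -
  have "(THE k. x + y = x + k) = y" by (rule the_equality) (auto dest: peano_add_cancel)
  then show ?thesis unfolding diff_def by auto
qed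

lemma peano_diff_0: "\<not> n \<le> m \<Longrightarrow> m - n = (0::'a::peano)"
  unfolding diff_def peano_le_iff by auto

lemma peano_le_antisym: "x \<le> y \<Longrightarrow> y \<le> x \<Longrightarrow> x = (y::'a::peano)"
  unfolding peano_le_iff by (metis add_0 peano_add_assoc peano_add_cancel peano_add_eq_0)

lemma peano_less_le: "x < y \<longleftrightarrow> x \<le> y \<and> \<not> y \<le> (x::'a::peano)"
  by (metis le_def peano_irrefl peano_le_antisym)

lemma peano_le_trans: "x \<le> y \<Longrightarrow> y \<le> z \<Longrightarrow> x \<le> (z::'a::peano)"
  unfolding peano_le_iff using peano_add_assoc by metis

lemma peano_diff_diff: "a - b - c = a - (b + (c::'a::peano))"
proof (cases "b \<le> a")
  case True
  then obtain d where a: "a = b + d" unfolding peano_le_iff by blast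
  show ?thesis
  proof (cases "c \<le> d")
    case True
    then obtain k where "d = c + k" unfolding peano_le_iff by blast
    then show ?thesis using a peano_diff_add peano_add_assoc by metis
  next
    case False
    then have "\<not> b + c \<le> b + d" unfolding peano_le_iff by (metis peano_add_assoc peano_add_cancel)
    then show ?thesis using a False peano_diff_add peano_diff_0 by metis
  qed
next
  case False
  then have "\<not> b + c \<le> a" unfolding peano_le_iff by (metis peano_add_assoc)
  moreover have "0 - c = 0"
  proof (cases "c = 0")
    case True then show ?thesis using peano_diff_add[of 0 0] by (simp add: add_0)
  next
    case False then show ?thesis by (metis peano_add_eq_0 peano_add_commute peano_diff_0 peano_le_iff)
  qed
  ultimately show ?thesis using False peano_diff_0 by metis
qed

lemma peano_mul_strict: "a < b \<Longrightarrow> 0 < c \<Longrightarrow> c * a < c * (b::'a::peano)"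
proof -
  assume "a < b" "0 < c"
  then obtain z d where "b = a + z + 1" "c = d + 1" unfolding peano_less_iff using peano_zero_add by metis
  then have "c * b = c * a + (c * z + d) + 1"
    by (simp add: peano_distrib peano_mul_one peano_add_ac)
  then show ?thesis unfolding peano_less_iff by blast
qed

lemma peano_mul_diff: "a * (b - c) = a * b - a * (c::'a::peano)"
proof (cases "c \<le> b")
  case True
  then obtain d where "b = c + d" unfolding peano_le_iff by blast
  then show ?thesis by (simp add: peano_distrib peano_diff_add)
next
  case False
  then have "b < c" using peano_linear peano_less_le by blast
  have "a * b - a * c = 0"
  proof (cases "a = 0")
    case True then show ?thesis using peano_diff_add[of 0 0] by (simp add: add_0 peano_zero_mul)
  next
    case False
    then have "0 < a" using peano_zero_or_add1[of a] unfolding peano_less_iff by (metis peano_zero_add)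
    then have "a * b < a * c" using \<open>b < c\<close> peano_mul_strict by blast
    then show ?thesis using peano_diff_0 peano_less_le by blast
  qed
  then show ?thesis using peano_diff_0[OF False] by (simp add: mul_0)
qed

instance peano \<subseteq> linordered_semidom
proof
  fix a b c :: 'a
  show "a + b + c = a + (b + c)" by (rule peano_add_assoc)
  show "a + b = b + a" by (rule peano_add_commute)
  show "0 + a = a" by (rule peano_zero_add)
  show "a * b * c = a * (b * c)" by (rule peano_mul_assoc)
  show "a * b = b * a" by (rule peano_mul_commute)
  show "1 * a = a" by (rule peano_one_mul)
  show "a * (b + c) = a * b + a * c" by (rule peano_distrib)
  show "(a + b) * c = a * c + b * c" by (metis peano_distrib peano_mul_commute)
  show "0 * a = 0" by (rule peano_zero_mul)
  show "a * 0 = 0" by (rule mul_0)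
  show "(0::'a) \<noteq> 1" using add1_neq_0[of "0::'a"] peano_zero_add by metis
  show "a + b - a = b" by (rule peano_diff_add)
  show "a - b - c = a - (b + c)" by (rule peano_diff_diff)
  show "a * (b - c) = a * b - a * c" by (rule peano_mul_diff)
  show "(a < b) = (a \<le> b \<and> \<not> b \<le> a)" by (rule peano_less_le)
  show "a \<le> a" by (simp add: le_def)
  show "a \<le> b \<Longrightarrow> b \<le> c \<Longrightarrow> a \<le> c" by (rule peano_le_trans)
  show "a \<le> b \<Longrightarrow> b \<le> a \<Longrightarrow> a = b" by (rule peano_le_antisym)
  show "a \<le> b \<or> b \<le> a" by (rule peano_linear)
  show "a \<le> b \<Longrightarrow> c + a \<le> c + b" unfolding peano_le_iff using peano_add_assoc by metis
  show "a < b \<Longrightarrow> 0 < c \<Longrightarrow> c * a < c * b" by (rule peano_mul_strict)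
  show "(0::'a) < 1" unfolding peano_less_iff using peano_zero_add by metis
  show "b \<le> a \<Longrightarrow> a - b + b = a"
    unfolding peano_le_iff using peano_diff_add peano_add_commute by metis
  show "a \<noteq> 0 \<Longrightarrow> b \<noteq> 0 \<Longrightarrow> a * b \<noteq> 0"
    by (metis add1_neq_0 add_add1 mul_add1 peano_zero_or_add1)
qed

lemma less_add1_iff [simp]: "x < y + 1 \<longleftrightarrow> x \<le> (y::'a::peano)"
  by (simp add: less_add1 le_def)

lemma add1_le_iff [simp]: "x + 1 \<le> y \<longleftrightarrow> x < (y::'a::peano)"
  by (simp only: not_less[of y "x + 1", symmetric] less_add1_iff not_le)

declare nless_0 [simp]

lemma peano_cases: obtains "n = 0" | m where "n = m + (1::'a::peano)"
  using peano_zero_or_add1 by blast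

lemma peano_ge_0 [simp]: "0 \<le> (n::'a::peano)"
  using nless_0 not_less by blast

lemma peano_le_0 [simp]: "n \<le> 0 \<longleftrightarrow> n = (0::'a::peano)"
  by (auto intro: antisym)

lemma peano_neq_0 [simp]: "0 < n \<longleftrightarrow> n \<noteq> (0::'a::peano)"
  by (subst not_le[symmetric]) simp

lemma peano_lessE: assumes "x < (y::'a::peano)" obtains z where "y = x + z + 1"
  using assms peano_less_iff by blast

lemma peano_leE: assumes "x \<le> (y::'a::peano)" obtains z where "y = x + z"
  using assms peano_le_iff by blast

section \<open>Closure properties of \<open>\<Sigma>\<^sub>1\<close> relations\<close>

lemma econs_rename: "(\<lambda>i. e (case_nat k r i)) = e k ## (\<lambda>i. e (r i))"
  by (auto split: nat.splits)

lemma S1_rename: "S1 P \<Longrightarrow> S1 (\<lambda>e. P (\<lambda>i. e (r i)))"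
proof -
  assume "S1 P"
  then obtain Q where Q: "D0 Q" "\<And>e. P e \<longleftrightarrow> (\<exists>y. Q (y ## e))" unfolding S1_def by blast
  have "(\<lambda>i. (y ## e) (case_nat 0 (\<lambda>i. Suc (r i)) i)) = y ## (\<lambda>i. e (r i))" for y and e :: "nat \<Rightarrow> 'a"
    by (auto split: nat.splits)
  then show ?thesis
    unfolding S1_def using D0_rename[OF Q(1), of "case_nat 0 (\<lambda>i. Suc (r i))"] Q(2)
    by (intro exI[of _ "\<lambda>e. Q (\<lambda>i. e (case_nat 0 (\<lambda>i. Suc (r i)) i))"]) simp
qed

lemma S1_disj: "S1 P \<Longrightarrow> S1 Q \<Longrightarrow> S1 (\<lambda>e. P e \<or> Q e)"
  unfolding S1_def
proof (elim exE conjE)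
  fix A B assume "D0 A" "\<forall>e. P e = (\<exists>y. A (y ## e))" "D0 B" "\<forall>e. Q e = (\<exists>y. B (y ## e))"
  then show "\<exists>C. D0 C \<and> (\<forall>e. (P e \<or> Q e) = (\<exists>y. C (y ## e)))"
    by (intro exI[of _ "\<lambda>e. A e \<or> B e"]) (auto intro: D0_disj)
qed

text \<open>Two unbounded quantifiers are contracted into one by taking a common bound for both
  witnesses.\<close>

lemma S1_ex:
  fixes P :: "'a::peano \<Rightarrow> (nat \<Rightarrow> 'a) \<Rightarrow> bool"
  assumes "S1 (\<lambda>e. P (e 0) (\<lambda>i. e (Suc i)))"
  shows "S1 (\<lambda>e. \<exists>x. P x e)"
proof -
  obtain Q where Q: "D0 Q" "\<And>e. P (e 0) (\<lambda>i. e (Suc i)) \<longleftrightarrow> (\<exists>y. Q (y ## e))"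
    using assms unfolding S1_def by blast
  have P: "P x e \<longleftrightarrow> (\<exists>y. Q (y ## x ## e))" for x e using Q(2)[of "x ## e"] by simp
  let ?C = "\<lambda>e. \<exists>x<e 0 + 1. \<exists>y<e 0 + 1. Q (y ## x ## (\<lambda>i. e (Suc i)))"
  have "D0 ?C"
  proof (intro D0_bex Tm_add Tm_var Tm_const)
    show "D0 (\<lambda>e. Q (e 0 ## e (Suc 0) ## (\<lambda>i. e (Suc (Suc (Suc i))))))"
      using D0_rename[OF Q(1), of "case_nat 0 (case_nat (Suc 0) (\<lambda>i. Suc (Suc (Suc i))))"]
      unfolding econs_rename .
  qed
  moreover have "(\<exists>x. P x e) \<longleftrightarrow> (\<exists>w. ?C (w ## e))" for e
  proof
    assume "\<exists>x. P x e"
    then obtain x y where "Q (y ## x ## e)" using P by blast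
    then have "?C (max x y ## e)" using max.cobounded1[of x y] max.cobounded2[of y x]
      unfolding nat.case less_add1_iff by metis
    then show "\<exists>w. ?C (w ## e)" by (rule exI)
  qed (use P in auto)
  ultimately show ?thesis unfolding S1_def by blast
qed

lemma S1_conj:
  fixes P :: "(nat \<Rightarrow> 'a::peano) \<Rightarrow> bool"
  assumes "S1 P" "S1 Q"
  shows "S1 (\<lambda>e. P e \<and> Q e)"
proof -
  obtain A B where AB: "D0 A" "\<And>e. P e = (\<exists>y. A (y ## e))" "D0 B" "\<And>e. Q e = (\<exists>y. B (y ## e))"
    using assms unfolding S1_def by blast
  have 1: "(P e \<and> Q e) \<longleftrightarrow> (\<exists>x y. A (x ## e) \<and> B (y ## e))" for e using AB by blast
  have "D0 (\<lambda>e. A (e (Suc 0) ## (\<lambda>i. e (Suc (Suc i)))) \<and> B (e 0 ## (\<lambda>i. e (Suc (Suc i)))))"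
    using D0_rename[OF AB(1), of "case_nat (Suc 0) (\<lambda>i. Suc (Suc i))"] D0_rename[OF AB(3), of "case_nat 0 (\<lambda>i. Suc (Suc i))"]
    by (intro D0_conj) (simp_all add: econs_rename)
  then show ?thesis unfolding 1 by (intro S1_ex D0_S1)
qed

text \<open>Sigma_1 collection in disguise: a common bound \<open>w\<close> for the witnesses is
  found by induction on the part of the range treated so far, and then the unbounded quantifier
  moves to the front.\<close>

lemma S1_ball_Tm:
  fixes P :: "'a::peano \<Rightarrow> (nat \<Rightarrow> 'a) \<Rightarrow> bool"
  assumes f: "Tm f" and "S1 (\<lambda>e. P (e 0) (\<lambda>i. e (Suc i)))"
  shows "S1 (\<lambda>e. \<forall>x<f e. P x e)"
proof -
  obtain Q where Q: "D0 Q" "\<And>e. P (e 0) (\<lambda>i. e (Suc i)) \<longleftrightarrow> (\<exists>y. Q (y ## e))"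
    using assms unfolding S1_def by blast
  have P: "P x e \<longleftrightarrow> (\<exists>y. Q (y ## x ## e))" for x e using Q(2)[of "x ## e"] by simp
  have coll: "\<exists>w. \<forall>x<u. \<exists>y<w. Q (y ## x ## e)" if "\<forall>x<u. P x e" for u e
  proof -
    have "\<exists>w. \<forall>x<u'. x < u \<longrightarrow> (\<exists>y<w. Q (y ## x ## e))" for u'
    proof (rule S1_induct[of "\<lambda>u'. \<exists>w. \<forall>x<u'. x < u \<longrightarrow> (\<exists>y<w. Q (y ## x ## e))"])
      have "D0 (\<lambda>e'. Q (e' 0 ## e' (Suc 0) ## e))"
      proof (rule D0_subst[OF Q(1)])
        fix i show "Tm (\<lambda>e'. (e' 0 ## e' (Suc 0) ## e) i)"
          by (cases i; cases "i - 1") (auto intro: Tm_var Tm_const)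
      qed
      then show "S1 (\<lambda>e'. \<exists>w. \<forall>x<e' 0. x < u \<longrightarrow> (\<exists>y<w. Q (y ## x ## e)))"
        by (intro S1_ex D0_S1 D0_all D0_imp D0_bex D0_less Tm_var Tm_const) (drule D0_rename[of _ "\<lambda>i. i"], simp)
      show "\<exists>w. \<forall>x<0. x < u \<longrightarrow> (\<exists>y<w. Q (y ## x ## e))" by simp
      fix u' assume "\<exists>w. \<forall>x<u'. x < u \<longrightarrow> (\<exists>y<w. Q (y ## x ## e))"
      then obtain w where w: "\<And>x. x < u' \<Longrightarrow> x < u \<Longrightarrow> \<exists>y<w. Q (y ## x ## e)" by blast
      show "\<exists>w. \<forall>x<u' + 1. x < u \<longrightarrow> (\<exists>y<w. Q (y ## x ## e))"
      proof (cases "u' < u")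
        case True
        then have "P u' e" using that by blast
        then obtain y where y: "Q (y ## u' ## e)" unfolding P by blast
        have "\<exists>z<max w (y + 1). Q (z ## x ## e)" if x: "x < u' + 1" "x < u" for x
        proof (cases "x = u'")
          case True then show ?thesis using y by (intro exI[of _ y]) (simp add: less_max_iff_disj)
        next
          case False
          then have "x < u'" using x(1) by simp
          then obtain y where "y < w" "Q (y ## x ## e)" using w x(2) by blast
          then show ?thesis by (intro exI[of _ y]) (simp add: less_max_iff_disj)
        qed
        then show ?thesis by blast
      next
        case False
        then show ?thesis using w by (intro exI[of _ w]) (auto simp: not_less)
      qed
    qed
    from this[of u] show ?thesis by blast
  qed
  have "(\<forall>x<f e. P x e) \<longleftrightarrow> (\<exists>w. \<forall>x<f e. \<exists>y<w. Q (y ## x ## e))" for e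
    using coll[of "f e" e] P by blast
  moreover have "D0 (\<lambda>e'. \<forall>x<f (\<lambda>i. e' (Suc i)). \<exists>y<e' 0. Q (y ## x ## (\<lambda>i. e' (Suc i))))"
  proof (intro D0_all D0_bex Tm_Suc[OF f] Tm_var)
    show "D0 (\<lambda>e. Q (e 0 ## e (Suc 0) ## (\<lambda>i. e (Suc (Suc (Suc i))))))"
      using D0_rename[OF Q(1), of "case_nat 0 (case_nat (Suc 0) (\<lambda>i. Suc (Suc (Suc i))))"]
      unfolding econs_rename .
  qed
  ultimately show ?thesis by (simp add: S1_ex D0_S1)
qed

section \<open>Delta_1 predicates, Sigma_1 functions and composition\<close>

definition D1 :: "((nat \<Rightarrow> 'a::arith) \<Rightarrow> bool) \<Rightarrow> bool" where
  "D1 P \<longleftrightarrow> S1 P \<and> S1 (\<lambda>e. \<not> P e)"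

text \<open>Since the functions are total, a Sigma_1 graph is enough for both polarities:
  \<open>R (f e)\<close> holds iff some \<open>a = f e\<close> satisfies \<open>R\<close>, and its
  negation is treated in the same way.\<close>

definition F1 :: "((nat \<Rightarrow> 'a::arith) \<Rightarrow> 'a) \<Rightarrow> bool" where
  "F1 f \<longleftrightarrow> S1 (\<lambda>e. e 0 = f (\<lambda>i. e (Suc i)))"

named_theorems S1_rules
named_theorems D1_rules
named_theorems F1_rules

declare S1_conj [S1_rules] S1_disj [S1_rules] S1_ex [S1_rules]

lemma S1_D1: "D1 P \<Longrightarrow> S1 P"
  by (simp add: D1_def)

lemma F1_graph: "S1 (\<lambda>e. G (e 0) (\<lambda>i. e (Suc i))) \<Longrightarrow> (\<And>y e. y = f e \<longleftrightarrow> G y e) \<Longrightarrow> F1 f"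
  by (simp add: F1_def)

lemma F1_var [F1_rules]: "F1 (\<lambda>e. e i)"
  unfolding F1_def by (intro D0_S1 D0_eq Tm_var)

lemma F1_const [F1_rules]: "F1 (\<lambda>e. c)"
  unfolding F1_def by (intro D0_S1 D0_eq Tm_var Tm_const)

lemma F1_Suc: "F1 f \<Longrightarrow> F1 (\<lambda>e. f (\<lambda>i. e (Suc i)))"
  unfolding F1_def by (drule S1_rename[of _ "case_nat 0 (\<lambda>i. Suc (Suc i))"]) (simp add: econs_rename)

lemma S1_comp:
  fixes f :: "(nat \<Rightarrow> 'a::peano) \<Rightarrow> 'a"
  assumes "S1 (\<lambda>e. R (e 0) (\<lambda>i. e (Suc i)))" "F1 f"
  shows "S1 (\<lambda>e. R (f e) e)"
proof -
  have "R (f e) e \<longleftrightarrow> (\<exists>a. a = f e \<and> R a e)" for e by blast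
  then show ?thesis using assms by (simp only:) (intro S1_ex S1_conj, simp_all add: F1_def)
qed

lemma S1_comp4:
  fixes f g h k :: "(nat \<Rightarrow> 'a::peano) \<Rightarrow> 'a"
  assumes R: "S1 (\<lambda>e. R (e 0) (e 1) (e 2) (e 3))" and "F1 f" "F1 g" "F1 h" "F1 k"
  shows "S1 (\<lambda>e. R (f e) (g e) (h e) (k e))"
proof -
  \<comment> \<open>The arguments are put in reverse order so that the one to be replaced next is
    always variable 0, as \<open>S1_comp\<close> requires.\<close>
  have "S1 (\<lambda>e. R (e (Suc (Suc (Suc 0)))) (e (Suc (Suc 0))) (e (Suc 0)) (e 0))"
    using S1_rename[OF R, of "\<lambda>i. 3 - i"] by (simp add: numeral_eq_Suc)
  then have "S1 (\<lambda>e. R (e (Suc (Suc 0))) (e (Suc 0)) (e 0) (k (\<lambda>i. e (Suc (Suc (Suc i))))))"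
    by (rule S1_comp[of "\<lambda>d e. R (e (Suc (Suc 0))) (e (Suc 0)) (e 0) d"]) (intro F1_Suc assms)
  then have "S1 (\<lambda>e. R (e (Suc 0)) (e 0) (h (\<lambda>i. e (Suc (Suc i)))) (k (\<lambda>i. e (Suc (Suc i)))))"
    by (rule S1_comp[of "\<lambda>c e. R (e (Suc 0)) (e 0) c (k (\<lambda>i. e (Suc (Suc i))))"]) (intro F1_Suc assms)
  then have "S1 (\<lambda>e. R (e 0) (g (\<lambda>i. e (Suc i))) (h (\<lambda>i. e (Suc i))) (k (\<lambda>i. e (Suc i))))"
    by (rule S1_comp[of "\<lambda>b e. R (e 0) b (h (\<lambda>i. e (Suc i))) (k (\<lambda>i. e (Suc i)))"]) (intro F1_Suc assms)
  then show ?thesis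
    by (rule S1_comp[of "\<lambda>a e. R a (g e) (h e) (k e)"]) (rule assms)
qed

lemma S1_comp3:
  fixes f g h :: "(nat \<Rightarrow> 'a::peano) \<Rightarrow> 'a"
  assumes "S1 (\<lambda>e. R (e 0) (e 1) (e 2))" and "F1 f" "F1 g" "F1 h"
  shows "S1 (\<lambda>e. R (f e) (g e) (h e))"
  using S1_comp4[of "\<lambda>a b c d. R a b c", OF assms F1_const] .

lemma S1_comp2:
  fixes f g :: "(nat \<Rightarrow> 'a::peano) \<Rightarrow> 'a"
  assumes "S1 (\<lambda>e. R (e 0) (e 1))" and "F1 f" "F1 g"
  shows "S1 (\<lambda>e. R (f e) (g e))"
  using S1_comp3[of "\<lambda>a b c. R a b", OF assms F1_const] .

lemma S1_comp1:
  fixes f :: "(nat \<Rightarrow> 'a::peano) \<Rightarrow> 'a"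
  assumes "S1 (\<lambda>e. R (e 0))" and "F1 f"
  shows "S1 (\<lambda>e. R (f e))"
  using S1_comp2[of "\<lambda>a b. R a", OF assms F1_const] .

lemma D1_comp4:
  fixes f g h k :: "(nat \<Rightarrow> 'a::peano) \<Rightarrow> 'a"
  shows "D1 (\<lambda>e. R (e 0) (e 1) (e 2) (e 3)) \<Longrightarrow> F1 f \<Longrightarrow> F1 g \<Longrightarrow> F1 h \<Longrightarrow> F1 k \<Longrightarrow>
    D1 (\<lambda>e. R (f e) (g e) (h e) (k e))"
  unfolding D1_def using S1_comp4[of R f g h k] S1_comp4[of "\<lambda>a b c d. \<not> R a b c d" f g h k] by blast

lemma D1_comp3:
  fixes f g h :: "(nat \<Rightarrow> 'a::peano) \<Rightarrow> 'a"
  shows "D1 (\<lambda>e. R (e 0) (e 1) (e 2)) \<Longrightarrow> F1 f \<Longrightarrow> F1 g \<Longrightarrow> F1 h \<Longrightarrow> D1 (\<lambda>e. R (f e) (g e) (h e))"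
  unfolding D1_def using S1_comp3[of R f g h] S1_comp3[of "\<lambda>a b c. \<not> R a b c" f g h] by blast

lemma D1_comp2:
  fixes f g :: "(nat \<Rightarrow> 'a::peano) \<Rightarrow> 'a"
  shows "D1 (\<lambda>e. R (e 0) (e 1)) \<Longrightarrow> F1 f \<Longrightarrow> F1 g \<Longrightarrow> D1 (\<lambda>e. R (f e) (g e))"
  unfolding D1_def using S1_comp2[of R f g] S1_comp2[of "\<lambda>a b. \<not> R a b" f g] by blast

lemma D1_comp1:
  fixes f :: "(nat \<Rightarrow> 'a::peano) \<Rightarrow> 'a"
  shows "D1 (\<lambda>e. R (e 0)) \<Longrightarrow> F1 f \<Longrightarrow> D1 (\<lambda>e. R (f e))"
  unfolding D1_def using S1_comp1[of R f] S1_comp1[of "\<lambda>a. \<not> R a" f] by blast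

lemma F1_comp3:
  fixes f g h :: "(nat \<Rightarrow> 'a::peano) \<Rightarrow> 'a"
  assumes "F1 (\<lambda>e. H (e 0) (e 1) (e 2))" "F1 f" "F1 g" "F1 h"
  shows "F1 (\<lambda>e. H (f e) (g e) (h e))"
  unfolding F1_def
proof (rule S1_comp4[of "\<lambda>y a b c. y = H a b c" "\<lambda>e. e 0" "\<lambda>e. f (\<lambda>i. e (Suc i))" "\<lambda>e. g (\<lambda>i. e (Suc i))" "\<lambda>e. h (\<lambda>i. e (Suc i))"])
  show "S1 (\<lambda>e. e 0 = H (e 1) (e 2) (e 3))"
    using assms(1) by (simp add: F1_def numeral_eq_Suc)
qed (intro F1_Suc F1_var assms)+

lemma F1_comp2:
  fixes f g :: "(nat \<Rightarrow> 'a::peano) \<Rightarrow> 'a"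
  assumes "F1 (\<lambda>e. H (e 0) (e 1))" "F1 f" "F1 g"
  shows "F1 (\<lambda>e. H (f e) (g e))"
  using F1_comp3[of "\<lambda>a b c. H a b", OF assms F1_const] .

lemma F1_comp1:
  fixes f :: "(nat \<Rightarrow> 'a::peano) \<Rightarrow> 'a"
  assumes "F1 (\<lambda>e. H (e 0))" "F1 f"
  shows "F1 (\<lambda>e. H (f e))"
  using F1_comp2[of "\<lambda>a b. H a", OF assms F1_const] .

lemma D0_D1: "D0 P \<Longrightarrow> D1 P"
  unfolding D1_def by (intro conjI D0_S1 D0_not)

lemma D1_not [D1_rules]: "D1 P \<Longrightarrow> D1 (\<lambda>e. \<not> P e)"
  by (simp add: D1_def)

lemma D1_const [D1_rules]: "D1 (\<lambda>e. (c::bool))"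
  by (cases c) (auto intro!: D0_D1 D0_False D0_not[OF D0_False, simplified])

lemma D1_conj [D1_rules]: "D1 P \<Longrightarrow> D1 Q \<Longrightarrow> D1 (\<lambda>e. P e \<and> (Q (e::nat \<Rightarrow> 'a::peano)))"
  unfolding D1_def de_Morgan_conj de_Morgan_disj by (elim conjE, intro conjI S1_conj S1_disj; assumption)

lemma D1_disj [D1_rules]: "D1 P \<Longrightarrow> D1 Q \<Longrightarrow> D1 (\<lambda>e. P e \<or> (Q (e::nat \<Rightarrow> 'a::peano)))"
  unfolding D1_def de_Morgan_conj de_Morgan_disj by (elim conjE, intro conjI S1_conj S1_disj; assumption)

lemma S1_imp [S1_rules]: "D1 P \<Longrightarrow> S1 Q \<Longrightarrow> S1 (\<lambda>e. P e \<longrightarrow> (Q (e::nat \<Rightarrow> 'a::peano)))"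
  unfolding imp_conv_disj by (intro S1_disj) (simp_all add: D1_def)

lemma S1_ball:
  fixes f :: "(nat \<Rightarrow> 'a::peano) \<Rightarrow> 'a"
  assumes "F1 f" "S1 (\<lambda>e. P (e 0) (\<lambda>i. e (Suc i)))"
  shows "S1 (\<lambda>e. \<forall>x<f e. P x e)"
proof (rule S1_comp[of "\<lambda>a e. \<forall>x<a. P x e"])
  show "S1 (\<lambda>e. \<forall>x<e 0. P x (\<lambda>i. e (Suc i)))"
    using S1_rename[OF assms(2), of "case_nat 0 (\<lambda>i. Suc (Suc i))"]
    by (intro S1_ball_Tm Tm_var) (simp add: econs_rename)
qed (rule assms)

lemma D1_imp [D1_rules]: "D1 P \<Longrightarrow> D1 Q \<Longrightarrow> D1 (\<lambda>e. P e \<longrightarrow> (Q (e::nat \<Rightarrow> 'a::peano)))"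
  unfolding imp_conv_disj by (intro D1_disj D1_not)

lemma D1_iff [D1_rules]: "D1 P \<Longrightarrow> D1 Q \<Longrightarrow> D1 (\<lambda>e. P e \<longleftrightarrow> (Q (e::nat \<Rightarrow> 'a::peano)))"
  unfolding iff_conv_conj_imp by (intro D1_conj D1_imp)

lemma D1_eq [D1_rules]: "F1 f \<Longrightarrow> F1 g \<Longrightarrow> D1 (\<lambda>e. f e = (g e :: 'a::peano))"
  by (rule D1_comp2[of "(=)"]) (rule D0_D1, (rule D0_rules)+)

lemma D1_less [D1_rules]: "F1 f \<Longrightarrow> F1 g \<Longrightarrow> D1 (\<lambda>e. f e < (g e :: 'a::peano))"
  by (rule D1_comp2[of "(<)"]) (rule D0_D1, (rule D0_rules)+)

lemma D1_less_eq [D1_rules]: "F1 f \<Longrightarrow> F1 g \<Longrightarrow> D1 (\<lambda>e. f e \<le> (g e :: 'a::peano))"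
  by (rule D1_comp2[of "(\<le>)"]) (rule D0_D1, (rule D0_rules)+)

lemma D1_Aset [D1_rules]: "F1 f \<Longrightarrow> D1 (\<lambda>e. (f e :: 'a::peano) \<in> Aset)"
  by (rule D1_comp1[of "\<lambda>x. x \<in> Aset"]) (rule D0_D1, (rule D0_rules)+)

lemma F1_add [F1_rules]: "F1 f \<Longrightarrow> F1 g \<Longrightarrow> F1 (\<lambda>e. f e + (g e :: 'a::peano))"
  by (rule F1_comp2[of "(+)"]) (unfold F1_def, rule D0_S1, (rule D0_rules)+)

lemma F1_mul [F1_rules]: "F1 f \<Longrightarrow> F1 g \<Longrightarrow> F1 (\<lambda>e. f e * (g e :: 'a::peano))"
  by (rule F1_comp2[of "(*)"]) (unfold F1_def, rule D0_S1, (rule D0_rules)+)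

lemma D1_ball [D1_rules]:
  fixes f :: "(nat \<Rightarrow> 'a::peano) \<Rightarrow> 'a"
  assumes "F1 f" "D1 (\<lambda>e. P (e 0) (\<lambda>i. e (Suc i)))"
  shows "D1 (\<lambda>e. \<forall>x<f e. P x e)"
proof -
  have "S1 (\<lambda>e. \<forall>x<f e. P x e)"
    using assms by (intro S1_ball) (simp_all add: D1_def)
  moreover have "S1 (\<lambda>e. \<exists>x. x < f e \<and> \<not> P x e)"
    using assms(2) by (intro S1_ex S1_conj S1_D1[OF D1_less[OF F1_var F1_Suc[OF assms(1)]]]) (simp add: D1_def)
  ultimately show ?thesis by (simp add: D1_def)
qed

lemma D1_bex [D1_rules]:
  fixes f :: "(nat \<Rightarrow> 'a::peano) \<Rightarrow> 'a"
  assumes "F1 f" "D1 (\<lambda>e. P (e 0) (\<lambda>i. e (Suc i)))"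
  shows "D1 (\<lambda>e. \<exists>x<f e. P x e)"
  using D1_not[OF D1_ball[OF assms(1) D1_not[OF assms(2)]]] by simp

lemma D1_ball_le [D1_rules]:
  fixes f :: "(nat \<Rightarrow> 'a::peano) \<Rightarrow> 'a"
  assumes "F1 f" "D1 (\<lambda>e. P (e 0) (\<lambda>i. e (Suc i)))"
  shows "D1 (\<lambda>e. \<forall>x\<le>f e. P x e)"
  using D1_ball[OF F1_add[OF assms(1) F1_const, of 1] assms(2)] by simp

lemma D1_bex_le [D1_rules]:
  fixes f :: "(nat \<Rightarrow> 'a::peano) \<Rightarrow> 'a"
  assumes "F1 f" "D1 (\<lambda>e. P (e 0) (\<lambda>i. e (Suc i)))"
  shows "D1 (\<lambda>e. \<exists>x\<le>f e. P x e)"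
  using D1_bex[OF F1_add[OF assms(1) F1_const, of 1] assms(2)] by simp

lemma S1_ball_le:
  fixes f :: "(nat \<Rightarrow> 'a::peano) \<Rightarrow> 'a"
  assumes "F1 f" "S1 (\<lambda>e. P (e 0) (\<lambda>i. e (Suc i)))"
  shows "S1 (\<lambda>e. \<forall>x\<le>f e. P x e)"
  using S1_ball[OF F1_add[OF assms(1) F1_const, of 1] assms(2)] by simp

declare S1_ball [S1_rules] S1_ball_le [S1_rules]

lemma F1_if [F1_rules]:
  assumes "D1 P" "F1 f" "F1 g" shows "F1 (\<lambda>e. if P e then f e else (g e :: 'a::peano))"
proof (rule F1_graph[of "\<lambda>y e. (P e \<and> y = f e) \<or> (\<not> P e \<and> y = g e)"])
  show "S1 (\<lambda>e. (P (\<lambda>i. e (Suc i)) \<and> e 0 = f (\<lambda>i. e (Suc i))) \<or> (\<not> P (\<lambda>i. e (Suc i)) \<and> e 0 = g (\<lambda>i. e (Suc i))))"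
    using assms S1_rename[of P Suc] S1_rename[of "\<lambda>e. \<not> P e" Suc]
    by (intro S1_disj S1_conj) (simp_all add: F1_def D1_def)
qed auto

lemma S1_less_induct:
  fixes x :: "'a::peano"
  assumes S: "S1 (\<lambda>e. P (e 0))" and step: "\<And>x. (\<And>y. y < x \<Longrightarrow> P y) \<Longrightarrow> P x"
  shows "P x"
proof -
  have "\<forall>y<z. P y" for z
  proof (rule S1_induct[of "\<lambda>z. \<forall>y<z. P y"])
    show "S1 (\<lambda>e. \<forall>y<e 0. P y)" by (intro S1_ball F1_var) (rule S)
    show "\<forall>y<x + 1. P y" if "\<forall>y<x. P y" for x
      using that step[of x] by (auto simp: le_less)
  qed simp
  then show ?thesis using step by blast
qed

lemma least_element:
  fixes x :: "'a::peano"
  assumes "D1 (\<lambda>e. P (e 0))" "P x"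
  obtains y where "P y" "\<And>z. z < y \<Longrightarrow> \<not> P z" "y \<le> x"
proof -
  have "\<exists>y. P y \<and> (\<forall>z<y. \<not> P z)"
  proof (rule ccontr)
    assume *: "\<not> ?thesis"
    have "\<not> P x" by (rule S1_less_induct[of "\<lambda>x. \<not> P x"]) (use assms * in \<open>auto simp: D1_def\<close>)
    then show False using assms(2) by blast
  qed
  then show thesis using assms(2) that not_less by blast
qed

text \<open>The least upper bound \<open>y\<close> belongs to \<open>P\<close>: otherwise its
  predecessor, or the element \<open>x\<close> if \<open>y = 0\<close>, would give a
  contradiction.\<close>

lemma greatest_element:
  fixes u :: "'a::peano"
  assumes "D1 (\<lambda>e. P (e 0))" "P x" "\<And>y. P y \<Longrightarrow> y \<le> u"
  obtains y where "P y" "\<And>z. P z \<Longrightarrow> z \<le> y"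
proof -
  have D: "D1 (\<lambda>e. \<forall>z\<le>u. P z \<longrightarrow> z \<le> e 0)"
    by (rule D1_comp1[OF assms(1)] D1_rules F1_rules)+
  obtain y where y: "\<forall>z\<le>u. P z \<longrightarrow> z \<le> y" "\<And>w. w < y \<Longrightarrow> \<not> (\<forall>z\<le>u. P z \<longrightarrow> z \<le> w)"
    by (rule least_element[of "\<lambda>y. \<forall>z\<le>u. P z \<longrightarrow> z \<le> y" u, OF D]) blast+
  have "P y"
  proof (rule ccontr)
    assume n: "\<not> P y"
    show False
    proof (cases y rule: peano_cases)
      case 1
      then show False using y(1) n assms(2) assms(3)[OF assms(2)] by auto
    next
      case (2 m)
      then have "\<not> (\<forall>z\<le>u. P z \<longrightarrow> z \<le> m)" using y(2)[of m] by simp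
      then obtain z where "z \<le> u" "P z" "m < z" by (auto simp: not_le)
      moreover then have "z \<le> m + 1" using y(1) 2 by blast
      ultimately show False using n 2 by (metis add1_le_iff antisym)
    qed
  qed
  then show thesis using that y(1) assms(3) by blast
qed

lemma S1_collection:
  fixes u :: "'a::peano"
  assumes "S1 (\<lambda>e. P (e 0) (e 1))" "\<And>x. x < u \<Longrightarrow> \<exists>y. P x y"
  shows "\<exists>w. \<forall>x<u. \<exists>y<w. P x y"
proof -
  have "\<exists>w. \<forall>x<v. x < u \<longrightarrow> (\<exists>y. y < w \<and> P x y)" for v
  proof (rule S1_induct[of "\<lambda>v. \<exists>w. \<forall>x<v. x < u \<longrightarrow> (\<exists>y. y < w \<and> P x y)"])
    show "S1 (\<lambda>e. \<exists>w. \<forall>x<e 0. x < u \<longrightarrow> (\<exists>y. y < w \<and> P x y))"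
      by (rule S1_rules D1_rules F1_rules S1_comp2[OF assms(1)] S1_D1)+
    fix v assume "\<exists>w. \<forall>x<v. x < u \<longrightarrow> (\<exists>y. y < w \<and> P x y)"
    then obtain w where w: "\<And>x. x < v \<Longrightarrow> x < u \<Longrightarrow> \<exists>y<w. P x y" by blast
    show "\<exists>w. \<forall>x<v + 1. x < u \<longrightarrow> (\<exists>y. y < w \<and> P x y)"
    proof (cases "v < u")
      case True
      then obtain y where "P v y" using assms(2) by blast
      moreover have "w \<le> max w (y + 1)" "y < max w (y + 1)" by (auto simp: less_max_iff_disj)
      ultimately show ?thesis
        by (intro exI[of _ "max w (y + 1)"]) (metis le_less less_add1_iff less_le_trans w)
    next
      case False
      then show ?thesis using w by (intro exI[of _ w]) (meson less_le_trans not_less)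
    qed
  qed simp
  from this[of u] show ?thesis by blast
qed

section \<open>The beta function\<close>

declare add1_neq_0 [simp]

lemma division_exists:
  assumes "m \<noteq> (0::'a::peano)" shows "\<exists>r. r < m \<and> (\<exists>q. b = q * m + r)"
proof -
  have "\<exists>q r. r < m \<and> b = q * m + r"
  proof (rule S1_induct[of "\<lambda>b. \<exists>q r. r < m \<and> b = q * m + r"])
    show "S1 (\<lambda>e. \<exists>q r. r < m \<and> e 0 = q * m + r)" by (rule S1_rules D1_rules F1_rules S1_D1)+
    show "\<exists>q r. r < m \<and> 0 = q * m + r" using assms by (intro exI[of _ 0]) simp
    fix b assume "\<exists>q r. r < m \<and> b = q * m + r"
    then obtain q r where qr: "r < m" "b = q * m + r" by blast
    show "\<exists>q r. r < m \<and> b + 1 = q * m + r"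
    proof (cases "r + 1 < m")
      case True
      then show ?thesis using qr by (intro exI[of _ q] exI[of _ "r + 1"]) (simp add: add.assoc)
    next
      case False
      then have "m = r + 1" using qr(1) by (meson add1_le_iff antisym not_less)
      then show ?thesis using qr assms by (intro exI[of _ "q + 1"] exI[of _ 0]) (simp add: algebra_simps)
    qed
  qed
  then show ?thesis by blast
qed

lemma division_unique:
  fixes m :: "'a::peano"
  assumes "r < m" "r' < m" "q * m + r = q' * m + r'"
  shows "r = r'"
proof -
  have less: "a * m + s < b * m + t" if "a < b" "s < m" for a b s t :: 'a
  proof -
    obtain z where "b = a + z + 1" using \<open>a < b\<close> by (rule peano_lessE)
    then have "b * m + t = a * m + m + (z * m + t)" by (simp add: algebra_simps)
    moreover have "a * m + s < a * m + m" using \<open>s < m\<close> by simp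
    moreover have "a * m + m \<le> a * m + m + (z * m + t)" by simp
    ultimately show ?thesis by (metis less_le_trans)
  qed
  have "q = q'" using less[of q q' r r'] less[of q' q r' r] assms by (metis less_irrefl linorder_neqE)
  then show ?thesis using assms(3) by simp
qed

definition rmd :: "'a::peano \<Rightarrow> 'a \<Rightarrow> 'a" where
  "rmd b m = (THE r. r < m \<and> (\<exists>q. b = q * m + r))"

lemma rmd_eq_iff:
  assumes "m \<noteq> (0::'a::peano)"
  shows "r = rmd b m \<longleftrightarrow> r < m \<and> (\<exists>q. b = q * m + r)"
proof -
  have "\<exists>!r. r < m \<and> (\<exists>q. b = q * m + r)"
    using division_exists[OF assms, of b] division_unique by blast
  from theI'[OF this] this show ?thesis unfolding rmd_def by blast
qed

lemma rmd_less: "m \<noteq> (0::'a::peano) \<Longrightarrow> rmd b m < m"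
  using rmd_eq_iff by blast

lemma rmd_mult_add: "m \<noteq> (0::'a::peano) \<Longrightarrow> rmd (k * m + b) m = rmd b m"
proof -
  assume m: "m \<noteq> 0"
  obtain q where "b = q * m + rmd b m" using rmd_eq_iff[OF m] by blast
  then have "k * m + b = (k + q) * m + rmd b m" by (metis add.assoc distrib_right)
  then show ?thesis using rmd_eq_iff[OF m, of "rmd b m" "k * m + b"] rmd_less[OF m] by metis
qed

lemma rmd_small: "r < (m::'a::peano) \<Longrightarrow> rmd r m = r"
  using rmd_eq_iff[of m r r] by (cases "m = 0") (auto intro!: exI[of _ 0])

definition bt :: "'a::peano \<Rightarrow> 'a \<Rightarrow> 'a \<Rightarrow> 'a" where
  "bt b c i = rmd b (1 + (i + 1) * c)"

lemma modulus_neq_0 [simp]: "1 + x \<noteq> (0::'a::peano)"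
  by (metis add.commute add1_neq_0)

lemma bt_eq_iff: "r = bt b c i \<longleftrightarrow> r < 1 + (i + 1) * c \<and> (\<exists>q. b = q * (1 + (i + 1) * c) + r)"
  unfolding bt_def by (rule rmd_eq_iff) simp

lemma F1_bt [F1_rules]: "F1 f \<Longrightarrow> F1 g \<Longrightarrow> F1 h \<Longrightarrow> F1 (\<lambda>e. bt (f e) (g e) (h e))"
proof (rule F1_comp3[of bt], rule F1_graph[of "\<lambda>y e. y < 1 + (e 2 + 1) * e 1 \<and> (\<exists>q. e 0 = q * (1 + (e 2 + 1) * e 1) + y)"])
  show "S1 (\<lambda>e::nat \<Rightarrow> 'a. e 0 < 1 + (e (Suc 2) + 1) * e (Suc 1) \<and>
     (\<exists>q. e (Suc 0) = q * (1 + (e (Suc 2) + 1) * e (Suc 1)) + e 0))"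
    by (rule S1_rules D1_rules F1_rules S1_D1)+
qed (rule bt_eq_iff)

text \<open>\<open>a\<close> is invertible modulo \<open>m\<close>; this is the form of coprimality needed for the Chinese remainder theorem.\<close>

definition unit_mod :: "'a::peano \<Rightarrow> 'a \<Rightarrow> bool" where
  "unit_mod a m \<longleftrightarrow> (\<exists>u v. a * u = 1 + m * v)"

lemma unit_mod_mult: "unit_mod a m \<Longrightarrow> unit_mod b m \<Longrightarrow> unit_mod (a * b) m"
proof -
  assume "unit_mod a m" "unit_mod b m"
  then obtain u v u' v' where "a * u = 1 + m * v" "b * u' = 1 + m * v'" unfolding unit_mod_def by blast
  then have "(a * b) * (u * u') = (1 + m * v) * (1 + m * v')" by (metis mult.assoc mult.left_commute)
  also have "\<dots> = 1 + m * (v + v' + v * (m * v'))" by (simp add: algebra_simps)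
  finally show ?thesis unfolding unit_mod_def by blast
qed

text \<open>With \<open>N = (j + 1) c\<close> and \<open>M = 1 + N\<close>, the relation \<open>d k = c\<close> gives
  \<open>d c \<cdot> k c (j + 1)\<^sup>3 = N\<^sup>3 \<equiv> - 1\<close> modulo \<open>M\<close>, so that \<open>k c (j + 1)\<^sup>3\<close> is an inverse of \<open>M - d c\<close>;
  the summand \<open>M (M\<^sup>2 + 3)\<close> only keeps the cofactor nonnegative.\<close>

lemma moduli_unit:
  fixes c :: "'a::peano"
  assumes ij: "i < j" and c: "\<And>d. d \<noteq> 0 \<Longrightarrow> d \<le> j \<Longrightarrow> d dvd c"
  shows "unit_mod (1 + (i + 1) * c) (1 + (j + 1) * c)"
proof -
  obtain z where z: "j = i + z + 1" using ij by (rule peano_lessE)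
  \<comment> \<open>\<open>d\<close> is the difference \<open>j - i\<close>, and therefore a nonzero
    number up to \<open>j\<close> that divides \<open>c\<close>.\<close>
  define d where "d = z + 1"
  have "d \<le> j" "d \<noteq> 0" using z by (simp_all add: d_def add.assoc)
  then obtain k where k: "c = d * k" using c by (meson dvdE)
  define N where "N = (j + 1) * c"
  define I where "I = (i + 1) * c"
  define w where "w = k * c * ((j + 1) * (j + 1) * (j + 1))"
  define T where "T = (1 + N) * (1 + N) + 3"
  have MI: "1 + N = (1 + I) + d * c" unfolding N_def I_def z d_def by (simp add: algebra_simps)
  have "d * c * w = (d * k) * c * c * ((j + 1) * (j + 1) * (j + 1))" unfolding w_def by (simp only: mult_ac)
  also have "\<dots> = N * N * N" unfolding k[symmetric] N_def by (simp only: mult_ac)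
  finally have N3: "d * c * w = N * N * N" .
  have "(3::'a) = 1 + 1 + 1" by simp
  then have three: "x * 3 = x + (x + x)" for x :: 'a by (simp only: distrib_left mult_1_right add.assoc)
  have "(1 + I) * (w + (1 + N) * T) + N * N * N = (1 + N) * w + (1 + I) * ((1 + N) * T)"
    unfolding MI N3[symmetric] by (simp add: algebra_simps)
  also have "\<dots> = 1 + (1 + N) * (w + 3 * (1 + N) + I * T) + N * N * N"
    unfolding T_def by (simp add: algebra_simps three)
  finally have "(1 + I) * (w + (1 + N) * T) = 1 + (1 + N) * (w + 3 * (1 + N) + I * T)" by simp
  then show ?thesis unfolding unit_mod_def N_def I_def by blast
qed

lemma chinese_step:
  fixes M :: "'a::peano"
  assumes "unit_mod P M" "r < M"
  shows "\<exists>t. rmd (b + P * t) M = r"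
proof -
  obtain u v where uv: "P * u = 1 + M * v" using assms(1) unfolding unit_mod_def by blast
  obtain N where M: "M = N + 1" using assms(2) by (cases M rule: peano_cases) auto
  \<comment> \<open>As \<open>N = M - 1\<close>, the product \<open>b * N\<close> acts as the
    negative of \<open>b\<close> modulo \<open>M\<close>; with \<open>u\<close> inverse to
    \<open>P\<close>, the shift takes \<open>b\<close> to the residue \<open>r\<close>.\<close>
  have "b + P * (u * (r + b * N)) = b + (P * u) * (r + b * N)" by (simp add: mult.assoc)
  also have "\<dots> = (b + v * (r + b * N)) * M + r" unfolding uv M by (simp add: algebra_simps)
  finally have "rmd (b + P * (u * (r + b * N))) M = r"
    using rmd_mult_add[of M "b + v * (r + b * N)" r] rmd_small[OF assms(2)] by (simp add: M)
  then show ?thesis by blast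
qed

text \<open>A substitute for the factorial, whose definition would need the coded sequences that are
  still to be constructed.\<close>

lemma common_multiple: "\<exists>m. m \<noteq> (0::'a::peano) \<and> (\<forall>d\<le>n. d \<noteq> 0 \<longrightarrow> d dvd m)"
proof -
  have "\<exists>m. m \<noteq> 0 \<and> (\<forall>d\<le>n. d \<noteq> 0 \<longrightarrow> (\<exists>q. m = d * q))"
  proof (rule S1_induct[of "\<lambda>n. \<exists>m. m \<noteq> 0 \<and> (\<forall>d\<le>n. d \<noteq> 0 \<longrightarrow> (\<exists>q. m = d * q))"])
    show "S1 (\<lambda>e. \<exists>m::'a. m \<noteq> 0 \<and> (\<forall>d\<le>e 0. d \<noteq> 0 \<longrightarrow> (\<exists>q. m = d * q)))"
      by (rule S1_rules D1_rules F1_rules S1_D1)+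
    show "\<exists>m::'a. m \<noteq> 0 \<and> (\<forall>d\<le>0. d \<noteq> 0 \<longrightarrow> (\<exists>q. m = d * q))" by (intro exI[of _ 1]) simp
    fix n :: 'a assume "\<exists>m. m \<noteq> 0 \<and> (\<forall>d\<le>n. d \<noteq> 0 \<longrightarrow> (\<exists>q. m = d * q))"
    then obtain m where m: "m \<noteq> 0" "\<And>d. d \<le> n \<Longrightarrow> d \<noteq> 0 \<Longrightarrow> \<exists>q. m = d * q" by blast
    have "\<exists>q. m * (n + 1) = d * q" if d: "d \<le> n + 1" "d \<noteq> 0" for d
    proof (cases "d = n + 1")
      case True then show ?thesis by (metis mult.commute)
    next
      case False
      then have "d \<le> n" using d(1) by (metis le_less less_add1_iff)
      then show ?thesis using m(2) d(2) by (metis mult.assoc)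
    qed
    then show "\<exists>m. m \<noteq> 0 \<and> (\<forall>d\<le>n + 1. d \<noteq> 0 \<longrightarrow> (\<exists>q. m = d * q))"
      using m(1) by (intro exI[of _ "m * (n + 1)"]) (auto simp: add1_neq_0)
  qed
  then show ?thesis unfolding dvd_def by blast
qed

text \<open>\<open>c\<close> is a common multiple of the numbers up to \<open>n\<close>, which makes
  the moduli invertible modulo one another, times a bound \<open>B\<close> on the values, which
  makes every modulus exceed the value it has to represent. The bound comes from collection.\<close>

theorem beta_function:
  fixes n :: "'a::peano"
  assumes g: "F1 (\<lambda>e. g (e 0))"
  shows "\<exists>b c. \<forall>i<n. bt b c i = g i"
proof -
  obtain B where "\<forall>i<n. \<exists>y<B. y = g i"
    using S1_collection[of "\<lambda>i y. y = g i" n] S1_D1[OF D1_eq[OF F1_var F1_comp1[OF g F1_var]]] by auto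
  then have B: "g i < B" if "i < n" for i using that by blast
  obtain m where m: "m \<noteq> 0" "\<And>d. d \<le> n \<Longrightarrow> d \<noteq> 0 \<Longrightarrow> d dvd m" using common_multiple[of n] by blast
  define c where "c = m * B"
  define M where "M i = 1 + (i + 1) * c" for i
  have small: "g i < M i" if "i < n" for i
  proof -
    have "1 \<le> m" "1 \<le> i + 1" using m(1) add1_le_iff[of 0 m] by simp_all
    then have "B \<le> c" "c \<le> (i + 1) * c" unfolding c_def
      using mult_right_mono[of 1 m B] mult_right_mono[of 1 "i + 1" "m * B"] by simp_all
    then show ?thesis using B[OF that] unfolding M_def by (metis add.commute less_add1_iff less_le_trans less_imp_le)
  qed
  have unit: "unit_mod (M i) (M j)" if "i < j" "j < n" for i j
    unfolding M_def c_def
    by (rule moduli_unit[OF that(1)]) (use m(2) that(2) in \<open>auto intro: dvd_mult2 order_trans\<close>)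
  have F_M: "F1 f \<Longrightarrow> F1 (\<lambda>e. M (f e))" for f unfolding M_def by (rule F1_rules | assumption)+
  \<comment> \<open>\<open>P\<close> is a common multiple of the moduli already treated and a unit
    modulo the remaining ones. Adding multiples of \<open>P\<close> to \<open>b\<close> thus keeps
    the solved congruences and can be used to solve the next one. Existence of inverses is spelled
    out to make the invariant Sigma_1.\<close>
  let ?C = "\<lambda>k. \<exists>b P. (\<forall>i<k. i < n \<longrightarrow> (\<exists>q. b = q * M i + g i) \<and> (\<exists>q. P = q * M i)) \<and>
     (\<forall>j<n. k \<le> j \<longrightarrow> (\<exists>u v. P * u = 1 + M j * v))"
  have "?C k" for k
  proof (rule S1_induct[of ?C])
    show "S1 (\<lambda>e. ?C (e 0))" by (rule S1_rules D1_rules F1_rules F_M F1_comp1[OF g] S1_D1)+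
    have "\<exists>u v. 1 * u = 1 + M j * v" for j by (rule exI[of _ 1], rule exI[of _ 0]) simp
    then show "?C 0" by (intro exI[of _ 1]) simp
    fix k assume "?C k"
    then obtain b P where b: "\<And>i. i < k \<Longrightarrow> i < n \<Longrightarrow> \<exists>q. b = q * M i + g i"
      and P: "\<And>i. i < k \<Longrightarrow> i < n \<Longrightarrow> \<exists>q. P = q * M i" and u: "\<And>j. j < n \<Longrightarrow> k \<le> j \<Longrightarrow> unit_mod P (M j)"
      unfolding unit_mod_def by blast
    show "?C (k + 1)"
    proof (cases "k < n")
      case True
      have Mk: "M k \<noteq> 0" by (simp add: M_def)
      obtain t where t: "rmd (b + P * t) (M k) = g k" using chinese_step[OF u[OF True order_refl] small[OF True]] by blast
      have 1: "(\<exists>q. b + P * t = q * M i + g i) \<and> (\<exists>q. P * M k = q * M i)" if i: "i < k + 1" for i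
      proof (cases "i = k")
        case True then show ?thesis using t rmd_eq_iff[OF Mk, of "g k" "b + P * t"] by auto
      next
        case False
        then have "i < k" "i < n" using i \<open>k < n\<close> by (auto simp: le_less)
        then obtain q q' where q: "b = q * M i + g i" "P = q' * M i" using b P by blast
        have "b + P * t = (q + q' * t) * M i + g i" unfolding q by (simp add: algebra_simps)
        moreover have "P * M k = (q' * M k) * M i" unfolding q(2) by (simp only: mult_ac)
        ultimately show ?thesis by blast
      qed
      have 2: "\<exists>u v. P * M k * u = 1 + M j * v" if "j < n" "k + 1 \<le> j" for j
        using unit_mod_mult[OF u[of j] unit[of k j]] that unfolding unit_mod_def by auto
      from 1 2 show ?thesis by blast
    next
      case False
      then have "i < n \<Longrightarrow> i < k" for i by (simp add: not_less)
      then show ?thesis using b P False by (intro exI[of _ b] exI[of _ P]) (auto simp: not_less)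
    qed
  qed
  from this[of n] obtain b where b: "\<And>i. i < n \<Longrightarrow> \<exists>q. b = q * M i + g i" by blast
  have "bt b c i = g i" if "i < n" for i
    using b[OF that] small[OF that] bt_eq_iff[of "g i" b c i] unfolding M_def by simp
  then show ?thesis by blast
qed

lemma beta_extend:
  fixes n :: "'a::peano"
  obtains b' c' where "\<And>i. i < n \<Longrightarrow> bt b' c' i = bt b c i" "bt b' c' n = y"
proof -
  have "F1 (\<lambda>e. if e 0 < n then bt b c (e 0) else y)" by (rule D1_rules F1_rules)+
  from beta_function[OF this, of "n + 1"] obtain b' c'
    where *: "\<And>i. i < n + 1 \<Longrightarrow> bt b' c' i = (if i < n then bt b c i else y)" by blast
  show thesis
  proof (rule that[of b' c'])
    show "bt b' c' i = bt b c i" if "i < n" for i using *[of i] that by (simp add: less_imp_le)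
    show "bt b' c' n = y" using *[of n] by simp
  qed
qed

text \<open>The coded sequence is lengthened entry by entry, so an arbitrary witness will do and
  \<open>S\<close> need not be decidable.\<close>

theorem S1_choice:
  fixes n :: "'a::peano"
  assumes S: "S1 (\<lambda>e. S (e 0) (e 1))" and ex: "\<And>i. i < n \<Longrightarrow> \<exists>y. S i y"
  obtains b c where "\<And>i. i < n \<Longrightarrow> S i (bt b c i)"
proof -
  let ?C = "\<lambda>k. \<exists>b c. \<forall>i<k. i < n \<longrightarrow> S i (bt b c i)"
  have "?C k" for k
  proof (rule S1_induct[of ?C])
    show "S1 (\<lambda>e. ?C (e 0))" by (rule S1_rules D1_rules F1_rules S1_comp2[OF S] S1_D1)+
    fix k assume "?C k"
    then obtain b c where bc: "\<And>i. i < k \<Longrightarrow> i < n \<Longrightarrow> S i (bt b c i)" by blast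
    show "?C (k + 1)"
    proof (cases "k < n")
      case True
      then obtain y where y: "S k y" using ex by blast
      obtain b' c' where *: "\<And>i. i < k \<Longrightarrow> bt b' c' i = bt b c i" "bt b' c' k = y"
        using beta_extend[of k b c y] by blast
      then have "S i (bt b' c' i)" if "i < k + 1" "i < n" for i
        using bc y that by (cases "i = k") (auto simp: le_less)
      then show ?thesis by blast
    next
      case False
      then have "i < n \<Longrightarrow> i < k" for i by (simp add: not_less)
      then show ?thesis using bc by blast
    qed
  qed simp
  from this[of n] that show thesis by blast
qed

section \<open>Exponentiation and Ackermann codes\<close>

text \<open>The computation described by the formula \<open>power_eq\<close>. It is kept apart from
  the value \<open>pw\<close>, because in a cut it matters whether the codes \<open>b, c\<close> of
  the computation belong to the cut.\<close>

definition pow_seq :: "'a::peano \<Rightarrow> 'a \<Rightarrow> 'a \<Rightarrow> 'a \<Rightarrow> bool" where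
  "pow_seq s t b c \<longleftrightarrow> bt b c 0 = 1 \<and> (\<forall>i<t. bt b c (i + 1) = s * bt b c i)"

lemma pow_seq_exists: "\<exists>b c. pow_seq s t b (c::'a::peano)"
  unfolding pow_seq_def
proof (rule S1_induct[of "\<lambda>t. \<exists>b c. bt b c 0 = 1 \<and> (\<forall>i<t. bt b c (i + 1) = s * bt b c i)"])
  show "S1 (\<lambda>e. \<exists>b c. bt b c 0 = 1 \<and> (\<forall>i<e 0. bt b c (i + 1) = s * bt b c i))"
    by (rule S1_rules D1_rules F1_rules S1_D1)+
  show "\<exists>b c. bt b c 0 = 1 \<and> (\<forall>i<0. bt b c (i + 1) = s * bt b c i)"
    using beta_extend[of 0 0 0 1] by (metis nless_0)
  fix t assume "\<exists>b c. bt b c 0 = 1 \<and> (\<forall>i<t. bt b c (i + 1) = s * bt b c i)"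
  then obtain b c where bc: "bt b c 0 = 1" "\<And>i. i < t \<Longrightarrow> bt b c (i + 1) = s * bt b c i" by blast
  obtain b' c' where *: "\<And>i. i < t + 1 \<Longrightarrow> bt b' c' i = bt b c i" "bt b' c' (t + 1) = s * bt b c t"
    using beta_extend[of "t + 1" b c "s * bt b c t"] by blast
  have "bt b' c' (i + 1) = s * bt b' c' i" if "i < t + 1" for i
  proof (cases "i = t")
    case False
    then have "i < t" using that by (auto simp: le_less)
    then show ?thesis using *(1)[of i] *(1)[of "i + 1"] bc(2)[of i] by (simp add: less_imp_le)
  qed (use * in auto)
  then show "\<exists>b c. bt b c 0 = 1 \<and> (\<forall>i<t + 1. bt b c (i + 1) = s * bt b c i)"
    using *(1)[of 0] bc(1) by (intro exI[of _ b'] exI[of _ c']) simp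
qed

lemma pow_seq_unique:
  assumes "pow_seq s t b c" "pow_seq s t' b' c'" "i \<le> t" "i \<le> (t'::'a::peano)"
  shows "bt b c i = bt b' c' i"
proof -
  have "i \<le> t \<longrightarrow> i \<le> t' \<longrightarrow> bt b c i = bt b' c' i"
  proof (rule S1_induct[of "\<lambda>i. i \<le> t \<longrightarrow> i \<le> t' \<longrightarrow> bt b c i = bt b' c' i"])
    show "S1 (\<lambda>e. e 0 \<le> t \<longrightarrow> e 0 \<le> t' \<longrightarrow> bt b c (e 0) = bt b' c' (e 0))"
      by (rule S1_rules D1_rules F1_rules S1_D1)+
  qed (use assms in \<open>auto simp: pow_seq_def less_imp_le\<close>)
  then show ?thesis using assms by blast
qed

definition pw :: "'a::peano \<Rightarrow> 'a \<Rightarrow> 'a" where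
  "pw s t = (THE u. \<exists>b c. pow_seq s t b c \<and> bt b c t = u)"

lemma pw_eq_iff: "u = pw s t \<longleftrightarrow> (\<exists>b c. pow_seq s t b c \<and> u = bt b c (t::'a::peano))"
proof -
  obtain b0 c0 where bc: "pow_seq s t b0 c0" using pow_seq_exists by blast
  note unique = pow_seq_unique[OF _ bc order_refl order_refl]
  have "pw s t = bt b0 c0 t"
    unfolding pw_def by (rule the_equality) (use bc unique in blast)+
  then show ?thesis using bc unique by metis
qed

lemma pw_seq: "pow_seq s t b c \<Longrightarrow> i \<le> t \<Longrightarrow> pw s i = bt b c (i::'a::peano)"
proof -
  assume "pow_seq s t b c" "i \<le> t"
  then have "pow_seq s i b c" by (auto simp: pow_seq_def)
  then show ?thesis using pw_eq_iff by metis
qed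

lemma pw_0 [simp]: "pw s 0 = (1::'a::peano)"
  using pow_seq_exists[of s 0] pw_seq[of s 0 _ _ 0] by (auto simp: pow_seq_def)

lemma pw_add1: "pw s (t + 1) = s * pw s (t::'a::peano)"
proof -
  obtain b c where bc: "pow_seq s (t + 1) b c" using pow_seq_exists by blast
  then show ?thesis using pw_seq[OF bc, of t] pw_seq[OF bc, of "t + 1"] by (auto simp: pow_seq_def less_imp_le)
qed

lemma F1_pw [F1_rules]: "F1 f \<Longrightarrow> F1 g \<Longrightarrow> F1 (\<lambda>e. pw (f e) (g e :: 'a::peano))"
proof (rule F1_comp2[of pw], rule F1_graph[of "\<lambda>u e. \<exists>b c. (bt b c 0 = 1 \<and> (\<forall>i<e 1. bt b c (i + 1) = e 0 * bt b c i)) \<and> u = bt b c (e 1)"])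
  show "S1 (\<lambda>e::nat \<Rightarrow> 'a. \<exists>b c. (bt b c 0 = 1 \<and> (\<forall>i<e (Suc 1). bt b c (i + 1) = e (Suc 0) * bt b c i)) \<and> e 0 = bt b c (e (Suc 1)))"
    by (rule S1_rules D1_rules F1_rules S1_D1)+
qed (rule pw_eq_iff[unfolded pow_seq_def])

lemma pw_add: "pw s (t + u) = pw s t * pw s (u::'a::peano)"
  by (rule S1_induct[of "\<lambda>u. pw s (t + u) = pw s t * pw s u"])
     ((rule S1_rules D1_rules F1_rules S1_D1)+, simp_all add: pw_add1 mult_ac flip: add.assoc)

lemma pw_mono: "1 \<le> s \<Longrightarrow> t \<le> u \<Longrightarrow> pw s t \<le> pw s (u::'a::peano)"
proof -
  assume s: "1 \<le> s" and "t \<le> u"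
  then obtain z where u: "u = t + z" by (meson peano_leE)
  have "1 \<le> pw s z"
    by (rule S1_induct[of "\<lambda>z. 1 \<le> pw s z"])
       ((rule S1_rules D1_rules F1_rules S1_D1)+, use s in \<open>auto simp: pw_add1 intro: order_trans mult_mono[of 1 s 1, simplified]\<close>)
  then show ?thesis unfolding u pw_add using mult_left_mono[of 1 "pw s z" "pw s t"] by simp
qed

lemma peano_mult_cancel: "c \<noteq> 0 \<Longrightarrow> a * c = b * c \<Longrightarrow> a = (b::'a::peano)"
  using mult_strict_right_mono[of a b c] mult_strict_right_mono[of b a c]
  by (metis less_irrefl linorder_neqE peano_neq_0)

abbreviation p2 :: "'a::peano \<Rightarrow> 'a" where "p2 \<equiv> pw 2"

lemma pw_1 [simp]: "pw s 1 = (s::'a::peano)"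
  using pw_add1[of s 0] by simp

lemma p2_neq_0 [simp]: "p2 x \<noteq> (0::'a::peano)"
  using pw_mono[of 2 0 x] by auto

lemma less_p2: "x < p2 (x::'a::peano)"
proof (rule S1_induct[of "\<lambda>x. x < p2 x"])
  show "S1 (\<lambda>e::nat \<Rightarrow> 'a. e 0 < p2 (e 0))" by (rule S1_rules D1_rules F1_rules S1_D1)+
  fix x :: 'a assume *: "x < p2 x"
  then have "x + 1 \<le> p2 x" by simp
  also have "\<dots> < p2 x + p2 x" by simp
  finally show "x + 1 < p2 (x + 1)" by (simp add: pw_add1 mult_2)
qed simp

lemma p2_mono: "x \<le> y \<Longrightarrow> p2 x \<le> p2 (y::'a::peano)"
  by (rule pw_mono) simp_all

lemma pw4: "pw 4 x = p2 x * p2 (x::'a::peano)"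
  by (rule S1_induct[of "\<lambda>x. pw 4 x = p2 x * p2 x"])
     ((rule S1_rules D1_rules F1_rules S1_D1)+, simp_all add: pw_add1 mult_ac)

lemma p2_le_pw4: "p2 x \<le> pw 4 (x::'a::peano)"
  unfolding pw4 using mult_left_mono[of 1 "p2 x" "p2 x"] p2_mono[of 0 x] by simp

section \<open>Binary digits and Ackermann membership\<close>

lemma not_even_odd: "2 * q \<noteq> 2 * q' + (1::'a::peano)"
proof
  assume "2 * q = 2 * q' + 1"
  then have "q * 2 + 0 = q' * 2 + 1" by (simp add: mult.commute)
  from division_unique[OF _ _ this] show False by simp
qed

definition odd' :: "'a::peano \<Rightarrow> bool" where
  "odd' n \<longleftrightarrow> (\<exists>q. n = 2 * q + 1)"

lemma even'_iff: "\<not> odd' n \<longleftrightarrow> (\<exists>q. n = 2 * (q::'a::peano))"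
proof
  obtain r q where "r < 2" "n = q * 2 + r" using division_exists[of 2 n] by auto
  moreover have "r = 0 \<or> r = 1"
  proof (cases r rule: peano_cases)
    case (2 m)
    then have "m < 1" using \<open>r < 2\<close> by (metis add_less_cancel_right one_add_one)
    then show ?thesis using 2 less_add1_iff[of m 0] by simp
  qed simp
  ultimately show "\<not> odd' n \<Longrightarrow> \<exists>q. n = 2 * q" unfolding odd'_def by (metis add.right_neutral mult.commute)
qed (auto simp: odd'_def not_even_odd)

lemma odd'_add: "odd' (2 * a + b) \<longleftrightarrow> odd' (b::'a::peano)"
proof -
  have "odd' b \<Longrightarrow> odd' (2 * a + b)" unfolding odd'_def by (metis add.assoc distrib_left)
  moreover have "\<not> odd' b \<Longrightarrow> \<not> odd' (2 * a + b)" unfolding even'_iff by (metis distrib_left)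
  ultimately show ?thesis by blast
qed

definition memc :: "'a::peano \<Rightarrow> 'a \<Rightarrow> bool" where
  "memc x F \<longleftrightarrow> (\<exists>q r. r < p2 x \<and> F = (2 * q + 1) * p2 x + r)"

lemma memc_quotient:
  fixes x :: "'a::peano"
  assumes "F = Q * p2 x + r" "r < p2 x"
  shows "memc x F \<longleftrightarrow> odd' Q"
proof
  assume "memc x F"
  then obtain q r' where r': "r' < p2 x" "F = (2 * q + 1) * p2 x + r'" unfolding memc_def by blast
  then have "r = r'" using division_unique assms by blast
  then have "Q * p2 x = (2 * q + 1) * p2 x" using assms(1) r'(2) by simp
  then have "Q = 2 * q + 1" by (rule peano_mult_cancel[OF p2_neq_0])
  then show "odd' Q" unfolding odd'_def by blast
next
  assume "odd' Q"
  then show "memc x F" using assms unfolding memc_def odd'_def by blast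
qed

lemma p2_division: "\<exists>Q r. r < p2 x \<and> (F::'a::peano) = Q * p2 x + r"
  using division_exists[of "p2 x" F] by auto

text \<open>Non-membership is existential too, by an even quotient instead of an odd one; hence
  membership is Delta_1.\<close>

lemma not_memc_iff: "\<not> memc x F \<longleftrightarrow> (\<exists>q r. r < p2 x \<and> (F::'a::peano) = (2 * q) * p2 x + r)"
proof
  assume "\<not> memc x F"
  then show "\<exists>q r. r < p2 x \<and> F = (2 * q) * p2 x + r"
    using p2_division[of x F] memc_quotient even'_iff by metis
qed (use memc_quotient even'_iff in blast)

lemma D1_memc [D1_rules]: "F1 f \<Longrightarrow> F1 g \<Longrightarrow> D1 (\<lambda>e. memc (f e) (g e :: 'a::peano))"
proof (rule D1_comp2[of memc])
  show "D1 (\<lambda>e::nat \<Rightarrow> 'a. memc (e 0) (e 1))"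
    unfolding D1_def not_memc_iff unfolding memc_def
    by (intro conjI; (rule S1_rules D1_rules F1_rules S1_D1)+)
qed

lemma memc_p2_le: "memc x F \<Longrightarrow> p2 x \<le> (F::'a::peano)"
proof -
  assume "memc x F"
  then obtain q r where "F = (2 * q + 1) * p2 x + r" unfolding memc_def by blast
  then have "F = p2 x + (2 * q * p2 x + r)" by (simp add: algebra_simps)
  then show ?thesis by simp
qed

lemma memc_less: "memc x F \<Longrightarrow> x < (F::'a::peano)"
  using memc_p2_le less_p2 less_le_trans by blast

lemma memc_bound: "F < p2 n \<Longrightarrow> memc x F \<Longrightarrow> x < (n::'a::peano)"
  using memc_p2_le[of x F] p2_mono[of n x] by (meson leD leI order_trans)

lemma not_memc_0 [simp]: "\<not> memc x (0::'a::peano)"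
  using memc_less by fastforce

text \<open>Adding the power sets the clear digit \<open>w\<close>. For \<open>x < w\<close> the
  quotient by \<open>p2 x\<close> changes by an even number; for \<open>w < x\<close> it does not
  change, since the clear digit absorbs the summand without a carry.\<close>

lemma memc_insert:
  fixes w :: "'a::peano"
  assumes w: "\<not> memc w F"
  shows "memc x (F + p2 w) \<longleftrightarrow> memc x F \<or> x = w"
proof -
  obtain q r where F: "F = (2 * q) * p2 w + r" "r < p2 w" using w not_memc_iff by blast
  have Fw: "F + p2 w = (2 * q + 1) * p2 w + r" unfolding F by (simp add: algebra_simps)
  consider "x < w" | "x = w" | "w < x" by fastforce
  then show ?thesis
  proof cases
    case 1
    then obtain z where z: "w = x + z + 1" by (rule peano_lessE)
    have pw: "p2 w = (2 * p2 z) * p2 x" by (simp add: z pw_add pw_add1 mult_ac)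
    obtain Q s where s: "r = Q * p2 x + s" "s < p2 x" using p2_division[of x r] by blast
    have "memc x F \<longleftrightarrow> odd' (2 * (2 * q * p2 z) + Q)"
      by (rule memc_quotient[OF _ s(2)]) (simp add: F(1) pw s(1) algebra_simps)
    moreover have "memc x (F + p2 w) \<longleftrightarrow> odd' (2 * ((2 * q + 1) * p2 z) + Q)"
      by (rule memc_quotient[OF _ s(2)], unfold Fw) (simp add: pw s(1) algebra_simps)
    ultimately have "memc x (F + p2 w) \<longleftrightarrow> memc x F" unfolding odd'_add by simp
    then show ?thesis using 1 by auto
  next
    case 2
    then show ?thesis using memc_quotient[OF Fw F(2)] by (auto simp: odd'_def)
  next
    case 3
    then obtain z where z: "x = w + z + 1" by (rule peano_lessE)
    have pw: "p2 x = (2 * p2 z) * p2 w" by (simp add: z pw_add pw_add1 mult_ac)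
    obtain Q s where s: "q = Q * p2 z + s" "s < p2 z" using p2_division[of z q] by blast
    have small: "(2 * s + 1) * p2 w + r < p2 x"
    proof -
      have "(2 * s + 1) * p2 w + r < (2 * s + 1) * p2 w + p2 w" using F(2) by simp
      also have "\<dots> = 2 * (s + 1) * p2 w" by (simp add: algebra_simps mult_2)
      also have "\<dots> \<le> 2 * p2 z * p2 w" using s(2) by (intro mult_right_mono mult_left_mono) auto
      finally show ?thesis unfolding pw .
    qed
    have "2 * s * p2 w + r \<le> (2 * s + 1) * p2 w + r" by (intro add_right_mono mult_right_mono) simp_all
    then have small': "2 * s * p2 w + r < p2 x" using small by (rule le_less_trans)
    have "memc x F \<longleftrightarrow> odd' Q"
      by (rule memc_quotient[OF _ small']) (simp add: F(1) pw s(1) algebra_simps)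
    moreover have "memc x (F + p2 w) \<longleftrightarrow> odd' Q"
      by (rule memc_quotient[OF _ small], unfold Fw) (simp add: pw s(1) algebra_simps)
    ultimately show ?thesis using 3 by auto
  qed
qed

text \<open>The bound on the code belongs to the induction hypothesis: it shows that digit
  \<open>n\<close> is still clear when \<open>n\<close> is to be added.\<close>

theorem bounded_comprehension:
  fixes n :: "'a::peano"
  assumes P: "D1 (\<lambda>e. P (e 0))"
  obtains F where "F < p2 n" "\<And>x. memc x F \<longleftrightarrow> x < n \<and> P x"
proof -
  have "\<exists>F. F < p2 n \<and> (\<forall>x<n. memc x F \<longleftrightarrow> P x)"
  proof (rule S1_induct[of "\<lambda>n. \<exists>F. F < p2 n \<and> (\<forall>x<n. memc x F \<longleftrightarrow> P x)"])
    show "S1 (\<lambda>e. \<exists>F. F < p2 (e 0) \<and> (\<forall>x<e 0. memc x F \<longleftrightarrow> P x))"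
      by (rule S1_rules D1_comp1[OF P] D1_rules F1_rules S1_D1)+
    fix n assume "\<exists>F. F < p2 n \<and> (\<forall>x<n. memc x F \<longleftrightarrow> P x)"
    then obtain F where F: "F < p2 n" "\<And>x. x < n \<Longrightarrow> memc x F \<longleftrightarrow> P x" by blast
    have n: "\<not> memc n F" using memc_bound[OF F(1)] by blast
    show "\<exists>F. F < p2 (n + 1) \<and> (\<forall>x<n + 1. memc x F \<longleftrightarrow> P x)"
    proof (cases "P n")
      case True
      have "F + p2 n < p2 (n + 1)" using F(1) by (simp add: pw_add1 mult_2)
      moreover have "memc x (F + p2 n) \<longleftrightarrow> P x" if "x < n + 1" for x
        using memc_insert[OF n] F(2) True that by (cases "x = n") (auto simp: le_less)
      ultimately show ?thesis by blast
    next
      case False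
      have "F < p2 (n + 1)" using F(1) p2_mono[of n "n + 1"] by (meson less_add1_iff less_le_trans less_imp_le order_refl)
      moreover have "memc x F \<longleftrightarrow> P x" if "x < n + 1" for x
        using n F(2) False that by (cases "x = n") (auto simp: le_less)
      ultimately show ?thesis by blast
    qed
  qed (auto intro: exI[of _ 0])
  then show thesis using that memc_bound by blast
qed

text \<open>The greatest \<open>k\<close> with \<open>p2 k \<le> F\<close> is the leading digit of
  \<open>F\<close> and hence an element. The lemma closes the counting arguments, in which a code
  grows with every step while its elements remain bounded.\<close>

lemma code_less_p2:
  fixes n :: "'a::peano"
  assumes "\<And>x. memc x F \<Longrightarrow> x < n"
  shows "F < p2 n"
proof (rule ccontr)
  assume "\<not> F < p2 n"
  then have n: "p2 n \<le> F" by simp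
  obtain k where k: "p2 k \<le> F" "\<And>z. p2 z \<le> F \<Longrightarrow> z \<le> k"
  proof (rule greatest_element[of "\<lambda>k. p2 k \<le> F" n F])
    show "D1 (\<lambda>e. p2 (e 0) \<le> F)" by (rule D1_rules F1_rules)+
    show "p2 y \<le> F \<Longrightarrow> y \<le> F" for y using less_p2[of y] by simp
  qed (use n in auto)
  obtain r where r: "F = p2 k + r" using k(1) by (rule peano_leE)
  have "\<not> p2 (k + 1) \<le> F" using k(2)[of "k + 1"] by auto
  then have "r < p2 k" by (simp add: r pw_add1 mult_2)
  moreover have "p2 k + r = (2 * 0 + 1) * p2 k + r" by simp
  ultimately have "memc k F" unfolding memc_def r by blast
  then show False using assms k(2)[OF n] by fastforce
qed

section \<open>Extrema, inclusion and sparseness of coded sets\<close>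

definition isMin :: "'a::peano \<Rightarrow> 'a \<Rightarrow> bool" where
  "isMin m F \<longleftrightarrow> memc m F \<and> (\<forall>x. memc x F \<longrightarrow> m \<le> x)"

definition isMax :: "'a::peano \<Rightarrow> 'a \<Rightarrow> bool" where
  "isMax m F \<longleftrightarrow> memc m F \<and> (\<forall>x. memc x F \<longrightarrow> x \<le> m)"

definition sub :: "'a::peano \<Rightarrow> 'a \<Rightarrow> bool" where
  "sub F G \<longleftrightarrow> (\<forall>x. memc x F \<longrightarrow> memc x G)"

definition before :: "'a::peano \<Rightarrow> 'a \<Rightarrow> bool" where
  "before F G \<longleftrightarrow> (\<forall>x y. memc x F \<and> memc y G \<longrightarrow> x < y)"

definition expsp :: "'a::peano \<Rightarrow> bool" where
  "expsp F \<longleftrightarrow> (\<forall>x y. memc x F \<and> memc y F \<and> x < y \<longrightarrow> pw 4 x < y)"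

definition rest :: "'a::peano \<Rightarrow> 'a \<Rightarrow> 'a \<Rightarrow> bool" where
  "rest m X Y \<longleftrightarrow> (\<forall>x. memc x Y \<longleftrightarrow> memc x X \<and> x \<noteq> m)"

text \<open>Elements are smaller than the code, so a quantifier over the elements of a coded set is
  bounded and preserves \<open>D1\<close>.\<close>

lemma all_memc: "(\<forall>x. memc x F \<longrightarrow> P x) \<longleftrightarrow> (\<forall>x<(F::'a::peano). memc x F \<longrightarrow> P x)"
  using memc_less by blast

lemma D1_isMin [D1_rules]: "F1 f \<Longrightarrow> F1 g \<Longrightarrow> D1 (\<lambda>e. isMin (f e) (g e :: 'a::peano))"
proof (rule D1_comp2[of isMin])
  show "D1 (\<lambda>e::nat \<Rightarrow> 'a. isMin (e 0) (e 1))" unfolding isMin_def all_memc by (rule D1_rules F1_rules)+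
qed

lemma D1_isMax [D1_rules]: "F1 f \<Longrightarrow> F1 g \<Longrightarrow> D1 (\<lambda>e. isMax (f e) (g e :: 'a::peano))"
proof (rule D1_comp2[of isMax])
  show "D1 (\<lambda>e::nat \<Rightarrow> 'a. isMax (e 0) (e 1))" unfolding isMax_def all_memc by (rule D1_rules F1_rules)+
qed

lemma D1_sub [D1_rules]: "F1 f \<Longrightarrow> F1 g \<Longrightarrow> D1 (\<lambda>e. sub (f e) (g e :: 'a::peano))"
proof (rule D1_comp2[of sub])
  show "D1 (\<lambda>e::nat \<Rightarrow> 'a. sub (e 0) (e 1))" unfolding sub_def all_memc by (rule D1_rules F1_rules)+
qed

lemma D1_before [D1_rules]: "F1 f \<Longrightarrow> F1 g \<Longrightarrow> D1 (\<lambda>e. before (f e) (g e :: 'a::peano))"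
proof (rule D1_comp2[of before])
  have "before F G \<longleftrightarrow> (\<forall>x<F. memc x F \<longrightarrow> (\<forall>y<G. memc y G \<longrightarrow> x < y))" for F G :: 'a
    unfolding before_def using memc_less by blast
  then show "D1 (\<lambda>e::nat \<Rightarrow> 'a. before (e 0) (e 1))" by (simp only:) (rule D1_rules F1_rules)+
qed

lemma D1_rest [D1_rules]: "F1 f \<Longrightarrow> F1 g \<Longrightarrow> F1 h \<Longrightarrow> D1 (\<lambda>e. rest (f e) (g e) (h e :: 'a::peano))"
proof (rule D1_comp3[of rest])
  have "rest m X Y \<longleftrightarrow> (\<forall>x<Y. memc x Y \<longrightarrow> memc x X \<and> x \<noteq> m) \<and> (\<forall>x<X. memc x X \<longrightarrow> x \<noteq> m \<longrightarrow> memc x Y)"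
    for m X Y :: 'a
    unfolding rest_def using memc_less by blast
  then show "D1 (\<lambda>e::nat \<Rightarrow> 'a. rest (e 0) (e 1) (e 2))" by (simp only:) (rule D1_rules F1_rules)+
qed

lemma isMin_exists: "memc x F \<Longrightarrow> \<exists>m. isMin m (F::'a::peano)"
proof -
  assume x: "memc x F"
  have "D1 (\<lambda>e. memc (e 0) F)" by (rule D1_rules F1_rules)+
  from least_element[of "\<lambda>x. memc x F", OF this x] show ?thesis unfolding isMin_def by (metis not_less)
qed

lemma isMax_exists: "memc x F \<Longrightarrow> \<exists>m. isMax m (F::'a::peano)"
proof -
  assume x: "memc x F"
  have D: "D1 (\<lambda>e. memc (e 0) F)" by (rule D1_rules F1_rules)+
  have "memc y F \<Longrightarrow> y \<le> F" for y using memc_less[of y F] by simp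
  from greatest_element[of "\<lambda>x. memc x F", OF D x this] show ?thesis unfolding isMax_def by metis
qed

lemma isMin_unique: "isMin m F \<Longrightarrow> isMin m' F \<Longrightarrow> m = (m'::'a::peano)"
  unfolding isMin_def by (meson antisym)

lemma rest_exists: "\<exists>Y. rest m X (Y::'a::peano)"
proof -
  have "D1 (\<lambda>e. memc (e 0) X \<and> e 0 \<noteq> m)" by (rule D1_rules F1_rules)+
  from bounded_comprehension[of "\<lambda>x. memc x X \<and> x \<noteq> m" X, OF this]
  show ?thesis unfolding rest_def using memc_less by metis
qed

lemma sub_trans: "sub F G \<Longrightarrow> sub G H \<Longrightarrow> sub F (H::'a::peano)"
  by (simp add: sub_def)

lemma expsp_sub: "expsp G \<Longrightarrow> sub F G \<Longrightarrow> expsp (F::'a::peano)"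
  unfolding expsp_def sub_def by blast

section \<open>Largeness and the pigeonhole principle\<close>

definition apart :: "('a::peano \<Rightarrow> 'a \<Rightarrow> 'a \<Rightarrow> bool) \<Rightarrow> 'a \<Rightarrow> 'a \<Rightarrow> bool" where
  "apart T X Y \<longleftrightarrow> before X Y \<and> (\<exists>p q r. isMax p X \<and> isMin q Y \<and> isMax r Y \<and>
     (\<forall>x<p. \<exists>y<q. \<forall>z<r. T x y z))"

definition mlarge :: "('a::peano \<Rightarrow> 'a \<Rightarrow> 'a \<Rightarrow> bool) \<Rightarrow> ('a \<Rightarrow> bool) \<Rightarrow> 'a \<Rightarrow> 'a \<Rightarrow> bool" where
  "mlarge T L k X \<longleftrightarrow> (\<exists>b c. (\<forall>i<k. sub (bt b c i) X \<and> L (bt b c i)) \<and>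
     (\<forall>j<k. \<forall>i<j. apart T (bt b c i) (bt b c j)))"

primrec large :: "('a::peano \<Rightarrow> 'a \<Rightarrow> 'a \<Rightarrow> bool) \<Rightarrow> nat \<Rightarrow> 'a \<Rightarrow> bool" where
  "large T 0 = (\<lambda>X. \<exists>x. memc x X)"
| "large T (Suc n) = (\<lambda>X. \<exists>m Y. isMin m X \<and> rest m X Y \<and> mlarge T (large T n) m Y)"

text \<open>Passing to subsets shrinks the ranges of the two universal quantifiers and widens that
  of the existential one. The last two hypotheses provide the extrema of the subsets.\<close>

lemma apart_sub:
  assumes "apart T X Y" "sub X' X" "sub Y' Y" "memc x X'" "memc y Y'"
  shows "apart T X' Y'"
proof -
  obtain p q r where pqr: "before X Y" "isMax p X" "isMin q Y" "isMax r Y" "\<forall>x<p. \<exists>y<q. \<forall>z<r. T x y z"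
    using assms(1) unfolding apart_def by blast
  obtain p' q' r' where m: "isMax p' X'" "isMin q' Y'" "isMax r' Y'"
    using isMax_exists isMin_exists assms(4,5) by metis
  have "p' \<le> p" using m(1) pqr(2) assms(2) by (simp add: isMax_def sub_def)
  moreover have "q \<le> q'" using m(2) pqr(3) assms(3) by (simp add: isMin_def sub_def)
  moreover have "r' \<le> r" using m(3) pqr(4) assms(3) by (simp add: isMax_def sub_def)
  ultimately have "\<forall>x<p'. \<exists>y<q'. \<forall>z<r'. T x y z" using pqr(5) by (meson less_le_trans)
  moreover have "before X' Y'" using pqr(1) assms(2,3) unfolding before_def sub_def by blast
  ultimately show ?thesis using m unfolding apart_def by blast
qed

locale ternary =
  fixes T :: "'a::peano \<Rightarrow> 'a \<Rightarrow> 'a \<Rightarrow> bool"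
  assumes D1_T: "D1 (\<lambda>e. T (e 0) (e 1) (e 2))"
begin

lemma S1_apart: "F1 f \<Longrightarrow> F1 g \<Longrightarrow> S1 (\<lambda>e. apart T (f e) (g e))"
proof (rule S1_comp2[of "apart T"])
  show "S1 (\<lambda>e. apart T (e 0) (e 1))" unfolding apart_def
    by (rule S1_rules D1_rules F1_rules D1_comp3[OF D1_T] S1_D1)+
qed

text \<open>Each standard level adds existential quantifiers over coded sequences, so largeness is
  Sigma_1 for fixed \<open>n\<close>. This suffices because it occurs only positively in the
  inductions to come.\<close>

lemma S1_large: "F1 f \<Longrightarrow> S1 (\<lambda>e. large T n (f e))"
proof (rule S1_comp1[of "large T n"])
  show "S1 (\<lambda>e. large T n (e 0))"
  proof (induction n)
    case 0
    show ?case unfolding large.simps by (rule S1_rules D1_rules F1_rules S1_D1)+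
  next
    case (Suc n)
    show ?case unfolding large.simps mlarge_def
      by (rule S1_rules S1_comp1[OF Suc] S1_apart D1_rules F1_rules S1_D1)+
  qed
qed

lemma large_isMin: "large T n X \<Longrightarrow> \<exists>m. isMin m X"
  by (cases n) (auto intro: isMin_exists)

lemma large_SucD:
  assumes "large T (Suc n) X" "isMin m X"
  shows "\<exists>b c. \<forall>j<m. large T n (bt b c j) \<and> sub (bt b c j) X \<and> (\<forall>x. memc x (bt b c j) \<longrightarrow> m < x) \<and>
     (\<forall>i<j. apart T (bt b c i) (bt b c j))"
proof -
  obtain Y where Y: "rest m X Y" "mlarge T (large T n) m Y"
    using assms isMin_unique by (metis large.simps(2))
  then obtain b c where bc: "\<And>i. i < m \<Longrightarrow> sub (bt b c i) Y \<and> large T n (bt b c i)"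
    "\<And>i j. j < m \<Longrightarrow> i < j \<Longrightarrow> apart T (bt b c i) (bt b c j)" unfolding mlarge_def by blast
  have "m < x" if "memc x Y" for x
  proof -
    have "memc x X" "x \<noteq> m" using Y(1) that unfolding rest_def by blast+
    then show ?thesis using assms(2) unfolding isMin_def by (simp add: order.strict_iff_order)
  qed
  moreover have "sub Y X" using Y(1) unfolding rest_def sub_def by blast
  ultimately show ?thesis using bc unfolding sub_def by (intro exI[of _ b] exI[of _ c]) blast
qed

text \<open>A surplus of blocks (\<open>k\<close> instead of \<open>m\<close>) is allowed, so that
  blocks counted by the minimum of a subset can be reused.\<close>

lemma large_SucI:
  assumes m: "isMin m X" and k: "m \<le> k"
    and bc: "\<And>j. j < k \<Longrightarrow> large T n (bt b c j) \<and> sub (bt b c j) X \<and> (\<forall>x. memc x (bt b c j) \<longrightarrow> m < x) \<and>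
      (\<forall>i<j. apart T (bt b c i) (bt b c j))"
  shows "large T (Suc n) X"
proof -
  obtain Y where Y: "rest m X Y" using rest_exists by blast
  have "sub (bt b c i) Y" if "i < m" for i
    using bc[OF less_le_trans[OF that k]] Y unfolding sub_def rest_def by auto
  moreover have "i < k" if "i < m" for i using that k by (rule less_le_trans)
  ultimately have "mlarge T (large T n) m Y" using bc unfolding mlarge_def by blast
  then show ?thesis using m Y by auto
qed

text \<open>A superset has a smaller minimum and therefore requires fewer blocks; those of
  \<open>Y\<close> serve.\<close>

lemma large_mono: "large T n Y \<Longrightarrow> sub Y X \<Longrightarrow> large T n X"
proof (cases n)
  case (Suc k)
  assume Y: "large T n Y" "sub Y X"
  obtain m m' where m: "isMin m Y" "isMin m' X"
    using large_isMin[OF Y(1)] isMin_exists Y(2) unfolding isMin_def sub_def by metis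
  then have le: "m' \<le> m" using Y(2) unfolding isMin_def sub_def by blast
  obtain b c where "\<forall>j<m. large T k (bt b c j) \<and> sub (bt b c j) Y \<and> (\<forall>x. memc x (bt b c j) \<longrightarrow> m < x) \<and>
     (\<forall>i<j. apart T (bt b c i) (bt b c j))"
    using large_SucD[OF Y(1)[unfolded Suc] m(1)] by blast
  then show ?thesis unfolding Suc
    by (intro large_SucI[OF m(2) le]) (use sub_trans[OF _ Y(2)] le_less_trans[OF le] in auto)
qed (auto simp: sub_def)

lemma large_Suc_imp:
  assumes "large T (Suc n) X" "isMin m X" "m \<noteq> 0" shows "large T n X"
proof -
  have "0 < m" using assms(3) by simp
  then show ?thesis using large_SucD[OF assms(1,2)] large_mono by blast
qed

end

text \<open>From \<open>2\<^bsup>a p\<^esup>\<close> blocks with homogeneous subsets in \<open>a\<close> colours, some colour is met \<open>p\<close> times. Instead of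
  counting, one records in a code \<open>F\<close> the pairs \<open>u p + q\<close> such that colour \<open>u\<close> has been met \<open>q + 1\<close> times:
  every further block increases \<open>F\<close>, which remains below \<open>2\<^bsup>a p\<^esup>\<close>.\<close>

locale colouring = ternary T for T :: "'a::peano \<Rightarrow> 'a \<Rightarrow> 'a \<Rightarrow> bool" +
  fixes g :: "'a \<Rightarrow> 'a"
  assumes F1_g: "F1 (\<lambda>e. g (e 0))"
begin

definition hom :: "'a \<Rightarrow> 'a \<Rightarrow> bool" where
  "hom D u \<longleftrightarrow> (\<forall>x. memc x D \<longrightarrow> g x = u)"

lemma D1_hom: "F1 f \<Longrightarrow> F1 h \<Longrightarrow> D1 (\<lambda>e. hom (f e) (h e))"
proof (rule D1_comp2[of hom])
  show "D1 (\<lambda>e. hom (e 0) (e 1))" unfolding hom_def all_memc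
    by (rule D1_rules F1_rules F1_comp1[OF F1_g])+
qed

text \<open>\<open>b, c\<close> codes the given blocks and \<open>b', c'\<close> the homogeneous
  sets found inside the first \<open>i\<close> of them. Remembering a block around each set is what
  gives apartness from sets found in later blocks.\<close>

definition homs :: "nat \<Rightarrow> 'a \<Rightarrow> 'a \<Rightarrow> 'a \<Rightarrow> 'a \<Rightarrow> 'a \<Rightarrow> 'a \<Rightarrow> 'a \<Rightarrow> bool" where
  "homs n b c u k i b' c' \<longleftrightarrow>
     (\<forall>l<k. large T n (bt b' c' l) \<and> hom (bt b' c' l) u \<and> (\<exists>i'. i' < i \<and> sub (bt b' c' l) (bt b c i'))) \<and>
     (\<forall>j<k. \<forall>l<j. apart T (bt b' c' l) (bt b' c' j))"

lemma homs_mono: "homs n b c u k i b' c' \<Longrightarrow> i \<le> i2 \<Longrightarrow> homs n b c u k i2 b' c'"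
  unfolding homs_def by (meson less_le_trans)

text \<open>\<open>D\<close> is appended to the sequence. Its apartness from the earlier sets is
  inherited by \<open>apart_sub\<close> from the blocks around them.\<close>

lemma homs_extend:
  assumes h: "homs n b c u q i b' c'" and D: "large T n D" "hom D u" "sub D (bt b c i)"
    and ap: "\<And>l. l < i \<Longrightarrow> apart T (bt b c l) (bt b c i)"
  shows "\<exists>b' c'. homs n b c u (q + 1) (i + 1) b' c'"
proof -
  obtain b2 c2 where e: "\<And>l. l < q \<Longrightarrow> bt b2 c2 l = bt b' c' l" "bt b2 c2 q = D"
    using beta_extend[of q b' c' D] by blast
  have ap': "apart T (bt b' c' l) D" if l: "l < q" for l
  proof -
    obtain i' where i': "i' < i" "sub (bt b' c' l) (bt b c i')" "large T n (bt b' c' l)"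
      using h l unfolding homs_def by blast
    from apart_sub[OF ap[OF i'(1)] i'(2) D(3)] show ?thesis
      using large_isMin[OF i'(3)] large_isMin[OF D(1)] unfolding isMin_def by blast
  qed
  have "homs n b c u (q + 1) (i + 1) b2 c2"
    unfolding homs_def
  proof (intro conjI allI impI)
    fix l assume l: "l < q + 1"
    show "large T n (bt b2 c2 l)" "hom (bt b2 c2 l) u" "\<exists>i'. i' < i + 1 \<and> sub (bt b2 c2 l) (bt b c i')"
      using l h e D unfolding homs_def by (cases "l = q"; force simp: le_less)+
  next
    fix j l assume jl: "j < q + 1" "l < j"
    show "apart T (bt b2 c2 l) (bt b2 c2 j)"
    proof (cases "j = q")
      case True then show ?thesis using jl e ap' by simp
    next
      case False
      then have "j < q" "l < q" using jl by (auto simp: le_less)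
      then show ?thesis using h e jl(2) unfolding homs_def by simp
    qed
  qed
  then show ?thesis by blast
qed

lemma pair_less: "u < a \<Longrightarrow> q < p \<Longrightarrow> u * p + q < a * (p::'a)"
proof -
  assume "u < a" "q < p"
  then have "u * p + q < (u + 1) * p" by (simp add: distrib_right)
  also have "\<dots> \<le> a * p" using \<open>u < a\<close> by (intro mult_right_mono) auto
  finally show ?thesis .
qed

lemma pair_unique: "q < p \<Longrightarrow> q' < p \<Longrightarrow> u * p + q = u' * p + q' \<Longrightarrow> q = q' \<and> u = (u'::'a)"
proof -
  assume *: "q < p" "q' < p" "u * p + q = u' * p + q'"
  then have "q = q'" using division_unique by blast
  moreover have "p \<noteq> 0" using *(1) by auto
  ultimately show ?thesis using *(3) peano_mult_cancel[of p u u'] by simp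
qed

lemma repeated_colour:
  assumes blocks: "\<And>i. i < N \<Longrightarrow> \<exists>D u. sub D (bt b c i) \<and> large T n D \<and> hom D u \<and> u < a"
    and ap: "\<And>i j. i < j \<Longrightarrow> j < N \<Longrightarrow> apart T (bt b c i) (bt b c j)"
    and p: "p \<noteq> 0" and N: "p2 (a * p) \<le> N"
  shows "\<exists>u b' c'. u < a \<and> homs n b c u p N b' c'"
proof (rule ccontr)
  assume none: "\<not> ?thesis"
  \<comment> \<open>\<open>F\<close> records which multiplicities of which colours have been
    reached; \<open>i \<le> F\<close> replaces a count of its elements. Largeness occurs positively,
    so the invariant is Sigma_1.\<close>
  let ?C = "\<lambda>i. \<exists>F. i \<le> F \<and> (\<forall>w<F. memc w F \<longrightarrow> (\<exists>u q. u < a \<and> q < p \<and> w = u * p + q \<and> (\<exists>b' c'. homs n b c u (q + 1) i b' c')))"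
  have "i \<le> N \<longrightarrow> ?C i" for i
  proof (rule S1_induct[of "\<lambda>i. i \<le> N \<longrightarrow> ?C i"])
    show "S1 (\<lambda>e. e 0 \<le> N \<longrightarrow> ?C (e 0))" unfolding homs_def
      by (rule S1_rules S1_large S1_apart D1_hom D1_rules F1_rules S1_D1)+
    show "0 \<le> N \<longrightarrow> ?C 0" by (intro impI exI[of _ 0]) simp
    fix i assume IH: "i \<le> N \<longrightarrow> ?C i"
    show "i + 1 \<le> N \<longrightarrow> ?C (i + 1)"
    proof
      assume "i + 1 \<le> N"
      then have i: "i < N" by simp
      then obtain F where F: "i \<le> F" "\<And>w. memc w F \<Longrightarrow>
          \<exists>u q. u < a \<and> q < p \<and> w = u * p + q \<and> (\<exists>b' c'. homs n b c u (q + 1) i b' c')"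
        using IH memc_less less_imp_le by meson
      obtain D u where D: "sub D (bt b c i)" "large T n D" "hom D u" "u < a" using blocks[OF i] by blast
      have prev: "\<exists>b' c'. homs n b c u (q + 1) i b' c'" if q: "q < p" "memc (u * p + q) F" for q
        using F(2)[OF q(2)] pair_unique[OF q(1)] by metis
      have "D1 (\<lambda>e. e 0 = p \<or> \<not> memc (u * p + e 0) F)" by (rule D1_rules F1_rules)+
      \<comment> \<open>\<open>q\<close> is the recorded multiplicity of colour \<open>u\<close>,
        cut off at \<open>p\<close>. Reaching \<open>p\<close> would already give the desired
        \<open>p\<close> homogeneous sets.\<close>
      then obtain q where q: "q = p \<or> \<not> memc (u * p + q) F" "q \<le> p"
        "\<And>z. z < q \<Longrightarrow> \<not> (z = p \<or> \<not> memc (u * p + z) F)"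
        by (rule least_element[of "\<lambda>q. q = p \<or> \<not> memc (u * p + q) F" p]) auto
      have homs_q: "\<exists>b' c'. homs n b c u q i b' c'"
      proof (cases q rule: peano_cases)
        case 1 then show ?thesis by (simp add: homs_def)
      next
        case (2 z) then show ?thesis using q prev[of z] by simp
      qed
      have "q \<noteq> p"
      proof
        assume "q = p"
        then obtain b' c' where "homs n b c u p N b' c'" using homs_q homs_mono i less_imp_le by metis
        then show False using none D(4) by blast
      qed
      then have q': "q < p" "\<not> memc (u * p + q) F" using q by auto
      obtain b1 c1 where "homs n b c u q i b1 c1" using homs_q by blast
      from homs_extend[OF this D(2,3,1) ap[OF _ i]]
      have ex: "\<exists>b' c'. homs n b c u (q + 1) (i + 1) b' c'" by blast
      let ?F = "F + p2 (u * p + q)"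
      have "1 \<le> p2 (u * p + q)" using p2_mono[of 0] by simp
      then have "i + 1 \<le> ?F" using F(1) by (intro add_mono)
      moreover have "\<exists>u q. u < a \<and> q < p \<and> w = u * p + q \<and> (\<exists>b' c'. homs n b c u (q + 1) (i + 1) b' c')"
        if w: "memc w ?F" for w
      proof (cases "w = u * p + q")
        case True then show ?thesis using D(4) q'(1) ex by blast
      next
        case False
        then have "memc w F" using w memc_insert[OF q'(2)] by blast
        then show ?thesis using F(2) homs_mono[of n b c _ _ i _ _ "i + 1"] by (metis less_add1_iff less_imp_le order_refl)
      qed
      ultimately show "?C (i + 1)" by blast
    qed
  qed
  then obtain F where F: "N \<le> F" "\<And>w. memc w F \<Longrightarrow> \<exists>u q. u < a \<and> q < p \<and> w = u * p + q"
    using memc_less order_refl by meson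
  have "F < p2 (a * p)" by (rule code_less_p2) (use F(2) pair_less in blast)
  then show False using F(1) N by simp
qed

end

section \<open>Homogeneous large subsets\<close>

context colouring
begin

text \<open>All elements are also required to be at least the number \<open>a\<close> of colours;
  together with sparseness this provides room for the counting.\<close>

definition col_below :: "'a \<Rightarrow> 'a \<Rightarrow> bool" where
  "col_below a X \<longleftrightarrow> (\<forall>x. memc x X \<longrightarrow> a \<le> x \<and> g x < a)"

lemma col_below_sub: "col_below a X \<Longrightarrow> sub Y X \<Longrightarrow> col_below a Y"
  by (simp add: col_below_def sub_def)

text \<open>\<open>x\<close> becomes the minimum, and the first \<open>x\<close> of the
  \<open>p\<close> homogeneous sets become its blocks.\<close>

lemma large_insert:
  assumes x: "memc x X" and h: "\<And>l. l < p \<Longrightarrow> large T n (bt b c l) \<and> hom (bt b c l) u \<and> sub (bt b c l) X \<and>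
      (\<forall>z. memc z (bt b c l) \<longrightarrow> x < z) \<and> (\<forall>l'<l. apart T (bt b c l') (bt b c l))"
    and gx: "g x = u" and xp: "x \<le> p"
  shows "\<exists>Y. sub Y X \<and> large T (Suc n) Y \<and> hom Y u"
proof -
  have D: "D1 (\<lambda>e. memc (e 0) X \<and> (e 0 = x \<or> (\<exists>l<x. memc (e 0) (bt b c l))))" by (rule D1_rules F1_rules)+
  obtain Y where Y: "\<And>z. memc z Y \<longleftrightarrow> z < X \<and> memc z X \<and> (z = x \<or> (\<exists>l<x. memc z (bt b c l)))"
    by (rule bounded_comprehension[of "\<lambda>z. memc z X \<and> (z = x \<or> (\<exists>l<x. memc z (bt b c l)))" X, OF D]) blast
  have lx: "l < p" if "l < x" for l using that xp by (rule less_le_trans)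
  have above: "x < z" if "l < x" "memc z (bt b c l)" for l z using h[OF lx[OF that(1)]] that(2) by blast
  have xY: "memc x Y" using Y x memc_less by blast
  have "isMin x Y" unfolding isMin_def using xY Y above by (auto intro: less_imp_le)
  moreover have "sub Y X" unfolding sub_def Y by blast
  moreover have "hom Y u" unfolding hom_def
  proof (intro allI impI)
    fix z assume "memc z Y"
    then consider "z = x" | l where "l < x" "memc z (bt b c l)" unfolding Y by blast
    then show "g z = u" using gx h lx unfolding hom_def by cases blast+
  qed
  moreover have "large T (Suc n) Y"
  proof (rule large_SucI[OF \<open>isMin x Y\<close> order_refl])
    fix l assume l: "l < x"
    have "sub (bt b c l) Y" unfolding sub_def Y
      using h[OF lx[OF l]] memc_less l unfolding sub_def by blast
    then show "large T n (bt b c l) \<and> sub (bt b c l) Y \<and> (\<forall>z. memc z (bt b c l) \<longrightarrow> x < z) \<and>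
        (\<forall>i<l. apart T (bt b c i) (bt b c l))"
      using h[OF lx[OF l]] by blast
  qed
  ultimately show ?thesis by blast
qed

text \<open>Giving up one exponent buys an exponential jump: the minimum of the first block is a
  later element of a sparse set.\<close>

lemma first_block:
  assumes "large T (Suc n) X" "isMin m X" "m \<noteq> 0" "expsp X"
  obtains Y m' where "large T n Y" "sub Y X" "isMin m' Y" "pw 4 m < m'" "expsp Y"
proof -
  have "0 < m" using assms(3) by simp
  then have "\<exists>b c. large T n (bt b c 0) \<and> sub (bt b c 0) X \<and> (\<forall>x. memc x (bt b c 0) \<longrightarrow> m < x)"
    using large_SucD[OF assms(1,2)] by blast
  then obtain Y where Y: "large T n Y" "sub Y X" "\<forall>x. memc x Y \<longrightarrow> m < x" by blast
  obtain m' where m': "isMin m' Y" using large_isMin[OF Y(1)] by blast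
  have "memc m X" "memc m' X" "m < m'" using assms(2) m' Y unfolding isMin_def sub_def by blast+
  then have "pw 4 m < m'" using assms(4) unfolding expsp_def by blast
  then show thesis by (intro that[OF Y(1,2) m' _ expsp_sub[OF assms(4) Y(2)]])
qed

text \<open>Each of the first \<open>2\<^bsup>a\<^esup>\<close> blocks \<open>B\<close> of an \<open>\<omega>\<^sup>n\<^sup>+\<^sup>3\<close>-large block has a colour \<open>u\<close> met at least \<open>p\<close> times, where \<open>p\<close>
  is the last element before \<open>B\<close>. If \<open>u\<close> occurs in an earlier block, at \<open>x \<le> p\<close> say, then \<open>x\<close> and \<open>x\<close> of these
  homogeneous sets form an \<open>\<omega>\<^sup>n\<^sup>+\<^sup>1\<close>-large homogeneous set. Otherwise every block brings a new colour, which
  is impossible since the codes \<open>F\<close> of the sets of colours seen increase but stay below \<open>2\<^bsup>a\<^esup>\<close>.\<close>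

lemma homogeneous_step:
  assumes IH: "\<And>X. large T h X \<Longrightarrow> expsp X \<Longrightarrow> col_below a X \<Longrightarrow> \<exists>D u. sub D X \<and> large T n D \<and> hom D u \<and> u < a"
    and X: "large T (Suc (Suc (Suc (Suc h)))) X" "expsp X" "col_below a X"
  shows "\<exists>D u. sub D X \<and> large T (Suc n) D \<and> hom D u \<and> u < a"
proof (rule ccontr)
  assume none: "\<not> ?thesis"
  obtain m0 where m0: "isMin m0 X" using large_isMin[OF X(1)] by blast
  then have "g m0 < a" and am0: "a \<le> m0" using X(3) unfolding isMin_def col_below_def by blast+
  then have "a \<noteq> 0" by auto
  then have m0': "m0 \<noteq> 0" using am0 by auto
  \<comment> \<open>Exponents descend from \<open>h + 4\<close> for \<open>X\<close> to
    \<open>h + 3\<close> for \<open>C\<close>, \<open>h + 2\<close> for the blocks \<open>B\<close>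
    of \<open>C\<close>, \<open>h + 1\<close> for the first block \<open>E\<close> of
    \<open>B\<close>, and \<open>h\<close> for the blocks of \<open>E\<close>, to which
    \<open>IH\<close> applies. Hence the factor 4 in \<open>homogeneous\<close>. Passing to
    \<open>C\<close> makes the number \<open>m1\<close> of blocks \<open>B\<close> exceed
    \<open>p2 a\<close>.\<close>
  obtain C m1 where C: "large T (Suc (Suc (Suc h))) C" "sub C X" "isMin m1 C" "pw 4 m0 < m1" "expsp C"
    by (rule first_block[OF X(1) m0 m0' X(2)])
  obtain b c where bc: "\<And>j. j < m1 \<Longrightarrow> large T (Suc (Suc h)) (bt b c j) \<and> sub (bt b c j) C \<and>
      (\<forall>x. memc x (bt b c j) \<longrightarrow> m1 < x) \<and> (\<forall>i<j. apart T (bt b c i) (bt b c j))"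
    using large_SucD[OF C(1,3)] by blast
  have m0m1: "m0 < m1" using C(4) p2_le_pw4[of m0] less_p2[of m0] by (meson less_le_trans less_trans)
  let ?C = "\<lambda>j. \<exists>F. j \<le> F \<and> (\<forall>u<F. memc u F \<longrightarrow> u < a \<and> (\<exists>i x. i < j \<and> memc x (bt b c i) \<and> g x = u))"
  have "j \<le> m1 \<longrightarrow> ?C j" for j
  proof (rule S1_induct[of "\<lambda>j. j \<le> m1 \<longrightarrow> ?C j"])
    show "S1 (\<lambda>e. e 0 \<le> m1 \<longrightarrow> ?C (e 0))"
      by (rule S1_rules D1_rules F1_rules F1_comp1[OF F1_g] S1_D1)+
    show "0 \<le> m1 \<longrightarrow> ?C 0" by (intro impI exI[of _ 0]) simp
    fix j assume IHj: "j \<le> m1 \<longrightarrow> ?C j"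
    show "j + 1 \<le> m1 \<longrightarrow> ?C (j + 1)"
    proof
      assume "j + 1 \<le> m1"
      then have j: "j < m1" by simp
      then obtain F where F: "j \<le> F" "\<And>u. memc u F \<Longrightarrow> u < a \<and> (\<exists>i x. i < j \<and> memc x (bt b c i) \<and> g x = u)"
        using IHj memc_less less_imp_le by meson
      define B where "B = bt b c j"
      have B: "large T (Suc (Suc h)) B" "sub B C" "\<And>x. memc x B \<Longrightarrow> m1 < x"
        "\<And>i. i < j \<Longrightarrow> apart T (bt b c i) B" using bc[OF j] by (auto simp: B_def)
      have BX: "sub B X" "expsp B" using sub_trans[OF B(2) C(2)] expsp_sub[OF C(5) B(2)] by auto
      obtain m where m: "isMin m B" using large_isMin[OF B(1)] by blast
      then have mX: "memc m X" "m1 < m" using BX(1) B(3) unfolding isMin_def sub_def by blast+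
      have Dp: "D1 (\<lambda>e. memc (e 0) X \<and> e 0 < m)" by (rule D1_rules F1_rules)+
      \<comment> \<open>Such a \<open>p\<close> exists since \<open>m0\<close> lies before
        \<open>B\<close>. It bounds all elements of earlier blocks, so any of them can serve as
        minimum above \<open>p\<close> homogeneous sets, and it is at least \<open>a\<close> because
        it belongs to \<open>X\<close>.\<close>
      obtain p where p: "memc p X \<and> p < m" "\<And>x. memc x X \<and> x < m \<Longrightarrow> x \<le> p"
        by (rule greatest_element[of "\<lambda>x. memc x X \<and> x < m", OF Dp, of m0 m])
           (use m0 m0m1 mX(2) in \<open>auto simp: isMin_def\<close>)
      have ap: "a \<le> p" using p X(3) unfolding col_below_def by blast
      have "p \<noteq> 0" using ap \<open>a \<noteq> 0\<close> by auto
      have pm: "pw 4 p < m" using X(2) p(1) mX(1) unfolding expsp_def by blast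
      have "m \<noteq> 0" using mX(2) by auto
      \<comment> \<open>Two jumps make the number of blocks of \<open>E\<close> large enough for
        \<open>repeated_colour\<close>: \<open>a * p \<le> p * p \<le> pw 4 p < m\<close>, and then
        \<open>p2 m \<le> pw 4 m < m'\<close>.\<close>
      obtain E m' where E: "large T (Suc h) E" "sub E B" "isMin m' E" "pw 4 m < m'" "expsp E"
        by (rule first_block[OF B(1) m \<open>m \<noteq> 0\<close> BX(2)])
      obtain b1 c1 where b1: "\<And>l. l < m' \<Longrightarrow> large T h (bt b1 c1 l) \<and> sub (bt b1 c1 l) E \<and>
          (\<forall>x. memc x (bt b1 c1 l) \<longrightarrow> m' < x) \<and> (\<forall>i<l. apart T (bt b1 c1 i) (bt b1 c1 l))"
        using large_SucD[OF E(1,3)] by blast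
      have EX: "sub E X" using sub_trans[OF E(2) BX(1)] .
      have "a * p \<le> p * p" using ap by (rule mult_right_mono) simp
      also have "\<dots> \<le> pw 4 p" unfolding pw4 using less_p2[of p] by (intro mult_mono) auto
      also have "\<dots> \<le> m" using pm by simp
      finally have "p2 (a * p) \<le> p2 m" by (rule p2_mono)
      also have "\<dots> \<le> m'" using p2_le_pw4[of m] E(4) by (meson less_imp_le order_trans)
      finally have N: "p2 (a * p) \<le> m'" .
      have blocks: "\<exists>D u. sub D (bt b1 c1 l) \<and> large T n D \<and> hom D u \<and> u < a" if "l < m'" for l
      proof -
        have "sub (bt b1 c1 l) E" "large T h (bt b1 c1 l)" using b1[OF that] by auto
        then show ?thesis
          using IH[of "bt b1 c1 l"] expsp_sub[OF E(5)] col_below_sub[OF X(3) sub_trans[OF _ EX]] by blast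
      qed
      obtain u b2 c2 where u: "u < a" "homs n b1 c1 u p m' b2 c2"
        using repeated_colour[OF blocks _ \<open>p \<noteq> 0\<close> N] b1 by blast
      have b2: "large T n (bt b2 c2 l) \<and> hom (bt b2 c2 l) u \<and> sub (bt b2 c2 l) E \<and>
          (\<forall>l'<l. apart T (bt b2 c2 l') (bt b2 c2 l))" if "l < p" for l
      proof -
        obtain i' where "i' < m'" "sub (bt b2 c2 l) (bt b1 c1 i')" using u(2) \<open>l < p\<close> unfolding homs_def by blast
        then have "sub (bt b2 c2 l) E" using b1 sub_trans by blast
        then show ?thesis using u(2) \<open>l < p\<close> unfolding homs_def by blast
      qed
      have new: "\<not> memc u F"
      proof
        assume "memc u F"
        then obtain i x where x: "i < j" "memc x (bt b c i)" "g x = u" using F(2) by blast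
        have "i < m1" using x(1) j by (rule less_trans)
        then have "memc x X" using bc[of i] x(2) C(2) unfolding sub_def by blast
        moreover have "x < m" using B(4)[OF x(1)] x(2) m unfolding apart_def before_def isMin_def by blast
        ultimately have "x \<le> p" using p(2) by blast
        have xz: "x < z" if "memc z E" for z
          using that E(2) m \<open>x < m\<close> unfolding sub_def isMin_def by (meson less_le_trans)
        have "\<exists>Y. sub Y X \<and> large T (Suc n) Y \<and> hom Y u"
        proof (rule large_insert[of x X p n b2 c2 u])
          fix l assume "l < p"
          from b2[OF this] xz show "large T n (bt b2 c2 l) \<and> hom (bt b2 c2 l) u \<and> sub (bt b2 c2 l) X \<and>
             (\<forall>z. memc z (bt b2 c2 l) \<longrightarrow> x < z) \<and> (\<forall>l'<l. apart T (bt b2 c2 l') (bt b2 c2 l))"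
            using sub_trans[OF _ EX] unfolding sub_def by blast
        qed fact+
        then show False using none u(1) by blast
      qed
      obtain x where x: "memc x B" "g x = u"
      proof -
        have "0 < p" using \<open>p \<noteq> 0\<close> by simp
        from b2[OF this] large_isMin obtain y where "memc y (bt b2 c2 0)" unfolding isMin_def by blast
        then show thesis using that[of y] b2[OF \<open>0 < p\<close>] E(2) unfolding hom_def sub_def by blast
      qed
      have "1 \<le> p2 u" using p2_mono[of 0 u] by simp
      then have "j + 1 \<le> F + p2 u" using F(1) by (intro add_mono)
      moreover have "v < a \<and> (\<exists>i x. i < j + 1 \<and> memc x (bt b c i) \<and> g x = v)" if v: "memc v (F + p2 u)" for v
      proof (cases "v = u")
        case True
        then show ?thesis using u(1) x unfolding B_def by (metis less_add1_iff order_refl)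
      next
        case False
        then have "memc v F" using v memc_insert[OF new] by blast
        then show ?thesis using F(2) by (metis less_add1_iff less_imp_le)
      qed
      ultimately show "?C (j + 1)" by blast
    qed
  qed
  then obtain F where F: "m1 \<le> F" "\<And>u. memc u F \<Longrightarrow> u < a"
    using memc_less order_refl by meson
  have "F < p2 a" by (rule code_less_p2) (use F(2) in blast)
  also have "\<dots> \<le> p2 m0" using am0 by (rule p2_mono)
  also have "\<dots> \<le> pw 4 m0" by (rule p2_le_pw4)
  also have "\<dots> < m1" by (rule C(4))
  finally show False using F(1) by simp
qed

lemma homogeneous:
  "large T (4 * n) X \<Longrightarrow> expsp X \<Longrightarrow> col_below a X \<Longrightarrow> \<exists>D u. sub D X \<and> large T n D \<and> hom D u \<and> u < a"
proof (induction n arbitrary: X)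
  case 0
  then obtain x where x: "memc x X" by auto
  obtain Y where Y: "\<And>z. memc z Y \<longleftrightarrow> z < x + 1 \<and> z = x"
    by (rule bounded_comprehension[of "\<lambda>z. z = x" "x + 1"]) ((rule D1_rules F1_rules)+, blast)
  have "sub Y X" "memc x Y" "hom Y (g x)" unfolding sub_def hom_def Y using x by auto
  then show ?case using x 0(3) unfolding col_below_def by auto
next
  case (Suc n)
  show ?case
    by (rule homogeneous_step[of "4 * n"]) (use Suc in \<open>auto simp: numeral_eq_Suc\<close>)
qed

text \<open>One exponent is spent on two blocks \<open>A\<close>, \<open>B\<close>, available since
  \<open>3 \<le> m\<close>. Their apartness gives the clause about \<open>T\<close>, because
  \<open>m\<close> is below the maximum of \<open>A\<close> and the new set is a subset of
  \<open>B\<close>. If some element of \<open>X\<close> has a colour not below \<open>m\<close>,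
  then \<open>B\<close> itself is taken; otherwise \<open>B\<close> contains a homogeneous
  set.\<close>

lemma shrink:
  assumes X: "large T (Suc (4 * n)) X" "expsp X" and m: "isMin m X" "3 \<le> m"
  shows "\<exists>Y m' M'. sub Y X \<and> large T n Y \<and> isMin m' Y \<and> isMax M' Y \<and> m < m' \<and>
    (\<forall>x<m. \<exists>y<m'. \<forall>z<M'. T x y z) \<and> ((\<exists>x. memc x X \<and> m \<le> g x) \<or> (\<exists>u. hom Y u))"
proof -
  obtain b c where bc: "\<And>j. j < m \<Longrightarrow> large T (4 * n) (bt b c j) \<and> sub (bt b c j) X \<and>
      (\<forall>x. memc x (bt b c j) \<longrightarrow> m < x) \<and> (\<forall>i<j. apart T (bt b c i) (bt b c j))"
    using large_SucD[OF X(1) m(1)] by blast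
  have "(1::'a) < 3" by simp
  then have 1: "1 < m" using m(2) by (rule less_le_trans)
  define A where "A = bt b c 0"
  define B where "B = bt b c 1"
  have "apart T A B" and B: "large T (4 * n) B" "sub B X" "\<And>x. memc x B \<Longrightarrow> m < x"
    using bc[OF 1] by (auto simp: A_def B_def)
  then obtain p q r where pqr: "isMax p A" "isMin q B" "isMax r B" "\<forall>x<p. \<exists>y<q. \<forall>z<r. T x y z"
    unfolding apart_def by blast
  have "m < p" using bc[of 0] 1 pqr(1) unfolding A_def isMax_def by (metis less_trans zero_less_one)
  have main: ?thesis if Y: "sub Y B" "large T n Y" and H: "(\<exists>x. memc x X \<and> m \<le> g x) \<or> (\<exists>u. hom Y u)" for Y
  proof -
    obtain m' where m': "isMin m' Y" using large_isMin[OF Y(2)] by blast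
    then obtain M' where M': "isMax M' Y" using isMax_exists unfolding isMin_def by blast
    have "q \<le> m'" "M' \<le> r" "m < m'"
      using m' M' pqr(2,3) Y(1) B(3) unfolding isMin_def isMax_def sub_def by auto
    then have "\<forall>x<m. \<exists>y<m'. \<forall>z<M'. T x y z" using pqr(4) \<open>m < p\<close> by (meson less_le_trans less_trans)
    then show ?thesis using sub_trans[OF Y(1) B(2)] Y(2) m' M' \<open>m < m'\<close> H by blast
  qed
  show ?thesis
  proof (cases "\<exists>x. memc x X \<and> m \<le> g x")
    case True
    have "large T k B \<Longrightarrow> l \<le> k \<Longrightarrow> large T l B" for k l
    proof (induction k)
      case (Suc k)
      have "q \<noteq> 0" using B(3) pqr(2) unfolding isMin_def by fastforce
      then show ?case using Suc large_Suc_imp[OF _ pqr(2)] le_Suc_eq by metis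
    qed simp
    then have "large T n B" using B(1) by simp
    then show ?thesis using True by (intro main[of B]) (auto simp: sub_def)
  next
    case False
    then have "col_below m B" using B(2,3) unfolding col_below_def sub_def by (auto simp: not_le less_imp_le)
    then obtain D u where "sub D B" "large T n D" "hom D u"
      using homogeneous[OF B(1) expsp_sub[OF X(2) B(2)]] by blast
    then show ?thesis by (intro main[of D]) auto
  qed
qed

end

section \<open>Cuts and absoluteness\<close>

text \<open>The operations are those of the surrounding arithmetic. With \<open>I = UNIV\<close>
  this is \<open>smodel\<close>, so that one set of lemmas evaluates formulas both in a cut and in
  the whole model.\<close>

definition cmodel :: "'a set \<Rightarrow> 'a set set \<Rightarrow> 'a set \<Rightarrow> 'a::arith model" where
  "cmodel I S A = \<lparr>Num = I, Sets = S, ncst = acst, scst = A, zro = 0, uno = 1,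
     pls = (+), tms = (*), lss = (<)\<rparr>"

lemma cmodel_simps [simp]:
  "Num (cmodel I S A) = I" "Sets (cmodel I S A) = S" "ncst (cmodel I S A) = acst" "scst (cmodel I S A) = A"
  "zro (cmodel I S A) = 0" "uno (cmodel I S A) = 1" "pls (cmodel I S A) = (+)" "tms (cmodel I S A) = (*)"
  "lss (cmodel I S A) = (<)"
  by (simp_all add: cmodel_def)

lemma smodel_cmodel: "smodel = cmodel UNIV Asets Aset"
  by (simp add: smodel_def cmodel_def)

lemma tval_cmodel: "tval (cmodel I S A) e t = tval smodel e t"
  by (induction t) (simp_all add: smodel_cmodel)

definition inI :: "'a set \<Rightarrow> (nat \<Rightarrow> 'a) \<Rightarrow> bool" where
  "inI I e \<longleftrightarrow> (\<forall>i. e i \<in> I)"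

lemma inI_cons [simp]: "inI I (x ## e) \<longleftrightarrow> x \<in> I \<and> inI I e"
  unfolding inI_def by (metis old.nat.exhaust old.nat.simps(4) old.nat.simps(5))

lemma inI_UNIV [simp]: "inI UNIV e"
  by (simp add: inI_def)

lemma inI_D [simp]: "inI I e \<Longrightarrow> e i \<in> I"
  by (simp add: inI_def)

locale closed_cut =
  fixes I :: "'a::peano set"
  assumes zero_I [simp]: "0 \<in> I" and one_I [simp]: "1 \<in> I" and acst_I [simp]: "acst \<in> I"
    and add_I: "x \<in> I \<Longrightarrow> y \<in> I \<Longrightarrow> x + y \<in> I" and mul_I: "x \<in> I \<Longrightarrow> y \<in> I \<Longrightarrow> x * y \<in> I"
    and down_I: "y \<in> I \<Longrightarrow> x \<le> y \<Longrightarrow> x \<in> I"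
begin

lemma less_I: "y \<in> I \<Longrightarrow> x < y \<Longrightarrow> x \<in> I"
  using down_I less_imp_le by blast

lemma tval_I [simp]: "inI I e \<Longrightarrow> tval (cmodel I S A) e t \<in> I"
  by (induction t) (auto intro: add_I mul_I)

lemma bt_le: "bt b c i \<le> (b::'a)"
proof -
  obtain q where "b = q * (1 + (i + 1) * c) + bt b c i" using bt_eq_iff by blast
  then show ?thesis by (metis add.commute peano_le_iff)
qed

text \<open>The quotient in the definition of the remainder is at most \<open>b\<close>, so it
  cannot be missing from the cut.\<close>

lemma sat_beta [simp]:
  assumes e: "inI I e"
  shows "sat (cmodel I S A) (beta b c i r) e s \<longleftrightarrow>
     tval (cmodel I S A) e r = bt (tval (cmodel I S A) e b) (tval (cmodel I S A) e c) (tval (cmodel I S A) e i)"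
proof -
  let ?v = "tval (cmodel I S A) e"
  have "sat (cmodel I S A) (beta b c i r) e s \<longleftrightarrow>
     ?v r < 1 + (?v i + 1) * ?v c \<and> (\<exists>q\<in>I. ?v b = q * (1 + (?v i + 1) * ?v c) + ?v r)"
    by (simp add: beta_def)
  moreover have "q \<in> I" if "?v b = q * (1 + k) + ?v r" for q k
  proof (rule down_I[of "?v b"])
    have "?v b = q + (q * k + ?v r)" using that by (simp add: algebra_simps)
    then show "q \<le> ?v b" by simp
  qed (use e in simp)
  ultimately show ?thesis using bt_eq_iff[of "?v r" "?v b" "?v c" "?v i"] by blast
qed

lemma sat_power_eq_seq:
  assumes e: "inI I e"
  shows "sat (cmodel I S A) (power_eq s t u) e \<sigma> \<longleftrightarrow>
     (\<exists>b\<in>I. \<exists>c\<in>I. pow_seq (tval (cmodel I S A) e s) (tval (cmodel I S A) e t) b c \<and>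
        tval (cmodel I S A) e u = bt b c (tval (cmodel I S A) e t))"
proof -
  let ?v = "tval (cmodel I S A) e"
  have bt_I: "bt b c i \<in> I" if "b \<in> I" for b c i using down_I[OF that bt_le] .
  have "sat (cmodel I S A) (power_eq s t u) e \<sigma> \<longleftrightarrow>
    (\<exists>b\<in>I. \<exists>c\<in>I. 1 = bt b c 0 \<and> ?v u = bt b c (?v t) \<and>
       (\<forall>i\<in>I. i < ?v t \<longrightarrow> (\<exists>v\<in>I. v = bt b c i \<and> ?v s * v = bt b c (i + 1))))"
    unfolding power_eq_def using e by (simp cong: ball_cong bex_cong)
  also have "\<dots> \<longleftrightarrow> (\<exists>b\<in>I. \<exists>c\<in>I. pow_seq (?v s) (?v t) b c \<and> ?v u = bt b c (?v t))"
  proof (intro bex_cong refl)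
    fix b c assume b: "b \<in> I"
    have "i \<in> I" if "i < ?v t" for i using less_I[OF tval_I[OF e] that] .
    then show "(1 = bt b c 0 \<and> ?v u = bt b c (?v t) \<and>
       (\<forall>i\<in>I. i < ?v t \<longrightarrow> (\<exists>v\<in>I. v = bt b c i \<and> ?v s * v = bt b c (i + 1)))) \<longleftrightarrow>
       (pow_seq (?v s) (?v t) b c \<and> ?v u = bt b c (?v t))"
      unfolding pow_seq_def using bt_I[OF b] by (metis (no_types))
  qed
  finally show ?thesis .
qed

end

text \<open>Closure under powers would not make \<open>power_eq\<close> absolute, as its existential
  quantifiers range over codes of computations. These are required to lie in the cut.\<close>

locale exp_cut = closed_cut +
  assumes pow_witness: "s \<in> I \<Longrightarrow> t \<in> I \<Longrightarrow> \<exists>b\<in>I. \<exists>c\<in>I. pow_seq s t b c"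
begin

lemma sat_power_eq [simp]:
  assumes e: "inI I e"
  shows "sat (cmodel I S A) (power_eq s t u) e \<sigma> \<longleftrightarrow>
     tval (cmodel I S A) e u = pw (tval (cmodel I S A) e s) (tval (cmodel I S A) e t)"
  unfolding sat_power_eq_seq[OF e] using pow_witness[OF tval_I[OF e] tval_I[OF e]] pw_seq
  by (metis (no_types) order_refl)

text \<open>The power, the quotient and the remainder in an expansion of \<open>F\<close> are all at
  most \<open>F\<close>, hence in the cut.\<close>

lemma sat_in_code [simp]:
  assumes e: "inI I e"
  shows "sat (cmodel I S A) (x \<^bold>\<in>\<^sub>c F) e \<sigma> \<longleftrightarrow> memc (tval (cmodel I S A) e x) (tval (cmodel I S A) e F)"
proof -
  let ?v = "tval (cmodel I S A) e"
  have "sat (cmodel I S A) (x \<^bold>\<in>\<^sub>c F) e \<sigma> \<longleftrightarrow>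
     (\<exists>p\<in>I. \<exists>q\<in>I. \<exists>r\<in>I. p = p2 (?v x) \<and> r < p \<and> ?v F = (2 * q + 1) * p + r)"
    unfolding in_code_def using e by (simp cong: ball_cong bex_cong) blast
  also have "\<dots> \<longleftrightarrow> memc (?v x) (?v F)"
  proof
    assume "memc (?v x) (?v F)"
    then obtain q r where qr: "r < p2 (?v x)" "?v F = (2 * q + 1) * p2 (?v x) + r" unfolding memc_def by blast
    have F: "?v F = p2 (?v x) + (2 * q * p2 (?v x) + r)" using qr(2) by (simp add: algebra_simps)
    have "p2 (?v x) \<le> ?v F" unfolding F by simp
    moreover have "r \<le> ?v F" unfolding qr(2) by simp
    moreover have "q \<le> ?v F"
    proof -
      have "q \<le> 2 * q" by (simp add: mult_2)
      also have "\<dots> \<le> 2 * q * p2 (?v x)" using mult_left_mono[of 1 "p2 (?v x)" "2 * q"] p2_mono[of 0 "?v x"] by simp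
      also have "\<dots> \<le> ?v F" unfolding F
        by (rule order_trans[OF _ le_add_same_cancel2[THEN iffD2, OF peano_ge_0]]) simp
      finally show ?thesis .
    qed
    ultimately have "p2 (?v x) \<in> I" "q \<in> I" "r \<in> I" using down_I[OF tval_I[OF e]] by blast+
    then show "\<exists>p\<in>I. \<exists>q\<in>I. \<exists>r\<in>I. p = p2 (?v x) \<and> r < p \<and> ?v F = (2 * q + 1) * p + r"
      using qr by blast
  qed (auto simp: memc_def)
  finally show ?thesis .
qed

lemma memc_I: "F \<in> I \<Longrightarrow> memc x F \<Longrightarrow> x \<in> I"
  using less_I memc_less by blast

lemma sat_is_min [simp]:
  assumes e: "inI I e"
  shows "sat (cmodel I S A) (is_min m F) e \<sigma> \<longleftrightarrow> isMin (tval (cmodel I S A) e m) (tval (cmodel I S A) e F)"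
  unfolding is_min_def isMin_def using e memc_I[OF tval_I[OF e]]
  by (auto cong: ball_cong simp: le_def)

lemma sat_is_max [simp]:
  assumes e: "inI I e"
  shows "sat (cmodel I S A) (is_max m F) e \<sigma> \<longleftrightarrow> isMax (tval (cmodel I S A) e m) (tval (cmodel I S A) e F)"
  unfolding is_max_def isMax_def using e memc_I[OF tval_I[OF e]]
  by (auto cong: ball_cong simp: le_def)

lemma sat_subset_code [simp]:
  assumes e: "inI I e"
  shows "sat (cmodel I S A) (F \<^bold>\<subseteq>\<^sub>c G) e \<sigma> \<longleftrightarrow> sub (tval (cmodel I S A) e F) (tval (cmodel I S A) e G)"
  unfolding subset_code_def sub_def using e memc_I[OF tval_I[OF e]] by (auto cong: ball_cong)

lemma sat_fin_subset [simp]: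
  assumes e: "inI I e"
  shows "sat (cmodel I S A) (F \<^bold>\<subseteq>\<^sub>f\<^sub>i\<^sub>n X) e \<sigma> \<longleftrightarrow>
    (\<forall>x. memc x (tval (cmodel I S A) e F) \<longrightarrow> x \<in> sval (cmodel I S A) \<sigma> X)"
  unfolding fin_subset_def using e memc_I[OF tval_I[OF e]] by (auto cong: ball_cong)

lemma sat_set_before [simp]:
  assumes e: "inI I e"
  shows "sat (cmodel I S A) (set_before F G) e \<sigma> \<longleftrightarrow> before (tval (cmodel I S A) e F) (tval (cmodel I S A) e G)"
  unfolding set_before_def before_def using e memc_I[OF tval_I[OF e]] by (auto cong: ball_cong simp: numeral_eq_Suc)

lemma sat_exp_sparse [simp]:
  assumes e: "inI I e"
  shows "sat (cmodel I S A) (exp_sparse F) e \<sigma> \<longleftrightarrow> expsp (tval (cmodel I S A) e F)"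
proof -
  let ?v = "tval (cmodel I S A) e"
  have "sat (cmodel I S A) (exp_sparse F) e \<sigma> \<longleftrightarrow>
    (\<forall>x\<in>I. \<forall>y\<in>I. memc x (?v F) \<and> memc y (?v F) \<and> x < y \<longrightarrow> (\<exists>z\<in>I. z = pw 4 x \<and> z < y))"
    unfolding exp_sparse_def using e by (simp add: numeral_eq_Suc cong: ball_cong bex_cong)
  moreover have "x \<in> I" if "memc x (?v F)" for x using memc_I[OF tval_I[OF e] that] .
  moreover have "pw 4 x \<in> I" if "memc y (?v F)" "pw 4 x < y" for x y
    using less_I[OF memc_I[OF tval_I[OF e] that(1)] that(2)] .
  ultimately show ?thesis unfolding expsp_def by metis
qed

end

lemma sat_inst3 [simp]:
  "sat M (inst3 \<phi> t u v) e s \<longleftrightarrow>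
     sat M \<phi> (\<lambda>i. if i = 0 then tval M e t else if i = 1 then tval M e u else tval M e v) s"
  unfolding inst3_def sat_fsub by (rule arg_cong2[where f = "sat M \<phi>"]) auto

text \<open>The way back from formulas to predicates. The environment is an arbitrary family of
  \<open>F1\<close> functions, which makes the statement stable under extension by a bound
  variable.\<close>

lemma sat_Sigma00_D1:
  fixes s :: "nat \<Rightarrow> 'a::peano set" and \<sigma> :: "(nat \<Rightarrow> 'a) \<Rightarrow> nat \<Rightarrow> 'a"
  assumes "Sigma00 \<phi>" and s: "\<And>i. D1 (\<lambda>e. e 0 \<in> s i)" and "\<And>i. F1 (\<lambda>e. \<sigma> e i)"
  shows "D1 (\<lambda>e. sat smodel \<phi> (\<sigma> e) s)"
proof -
  have t: "F1 (\<lambda>e. tval smodel (\<sigma> e) t)" if "\<And>i. F1 (\<lambda>e. \<sigma> e i)" for t and \<sigma> :: "(nat \<Rightarrow> 'a) \<Rightarrow> nat \<Rightarrow> 'a"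
    by (induction t) (simp_all add: smodel_cmodel F1_rules that)
  have cons: "F1 (\<lambda>e. (e 0 ## \<sigma> (\<lambda>i. e (Suc i))) i)" if "\<And>i. F1 (\<lambda>e. \<sigma> e i)"
    for i and \<sigma> :: "(nat \<Rightarrow> 'a) \<Rightarrow> nat \<Rightarrow> 'a"
    using F1_Suc[OF that] by (cases i) (simp_all add: F1_var)
  from assms(1,3) show ?thesis
  proof (induction arbitrary: \<sigma> rule: Sigma00.induct)
    case (2 t u)
    then show ?case using D1_eq[OF t t] by simp
  next
    case (3 t u)
    then show ?case using D1_less[OF t t] by (simp add: smodel_def)
  next
    case (4 t X)
    have "D1 (\<lambda>e::nat \<Rightarrow> 'a. e 0 \<in> sval smodel s X)"
      using s D1_Aset[OF F1_var] by (cases X) (simp_all add: smodel_def)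
    then show ?case using D1_comp1[of "\<lambda>x. x \<in> sval smodel s X", OF _ t[OF 4]] by simp
  next
    case (5 \<phi> \<psi>)
    then show ?case by (simp add: D1_imp)
  next
    case (6 \<phi> t)
    have "D1 (\<lambda>e. \<forall>x<tval smodel (\<sigma> e) t. sat smodel \<phi> (x ## \<sigma> e) s)"
      by (rule D1_ball[OF t[OF 6(3)]]) (rule 6(2), rule cons[OF 6(3)])
    then show ?case by (simp add: smodel_cmodel)
  next
    case (7 \<phi> t)
    have "D1 (\<lambda>e. \<exists>x<tval smodel (\<sigma> e) t. sat smodel \<phi> (x ## \<sigma> e) s)"
      by (rule D1_bex[OF t[OF 7(3)]]) (rule 7(2), rule cons[OF 7(3)])
    then show ?case by (simp add: smodel_cmodel)
  qed (simp add: D1_rules)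
qed

context closed_cut
begin

lemma Sigma00_absolute:
  assumes "Sigma00 \<phi>" "inI I e"
  shows "sat (cmodel I S (Aset \<inter> I)) \<phi> e (\<lambda>i. s i \<inter> I) \<longleftrightarrow> sat smodel \<phi> e s"
  using assms
proof (induction arbitrary: e rule: Sigma00.induct)
  case (3 t u)
  then show ?case by (simp add: tval_cmodel) (simp add: smodel_def)
next
  case (4 t X)
  have "tval smodel e t \<in> I" using tval_I[OF 4, of UNIV "{}"] by (simp add: tval_cmodel)
  then show ?case by (cases X) (simp_all add: tval_cmodel, simp add: smodel_def)
next
  case (6 \<phi> t)
  have "tval smodel e t \<in> I" using tval_I[OF 6(3), of UNIV "{}"] by (simp add: tval_cmodel)
  then have "sat (cmodel I S (Aset \<inter> I)) (BForall t \<phi>) e (\<lambda>i. s i \<inter> I) \<longleftrightarrow>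
     (\<forall>x<tval smodel e t. sat (cmodel I S (Aset \<inter> I)) \<phi> (x ## e) (\<lambda>i. s i \<inter> I))"
    using less_I by (auto simp: tval_cmodel)
  also have "\<dots> \<longleftrightarrow> (\<forall>x<tval smodel e t. sat smodel \<phi> (x ## e) s)"
    using 6 \<open>tval smodel e t \<in> I\<close> less_I by auto
  finally show ?case by (simp add: smodel_cmodel)
next
  case (7 \<phi> t)
  have "tval smodel e t \<in> I" using tval_I[OF 7(3), of UNIV "{}"] by (simp add: tval_cmodel)
  then have "sat (cmodel I S (Aset \<inter> I)) (BExists t \<phi>) e (\<lambda>i. s i \<inter> I) \<longleftrightarrow>
     (\<exists>x<tval smodel e t. sat (cmodel I S (Aset \<inter> I)) \<phi> (x ## e) (\<lambda>i. s i \<inter> I))"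
    using less_I by (auto simp: tval_cmodel)
  also have "\<dots> \<longleftrightarrow> (\<exists>x<tval smodel e t. sat smodel \<phi> (x ## e) s)"
    using 7 \<open>tval smodel e t \<in> I\<close> less_I by auto
  finally show ?case by (simp add: smodel_cmodel)
qed (simp_all add: tval_cmodel)

end

section \<open>Reading the largeness formulas in the whole model\<close>

lemma exp_cut_UNIV: "exp_cut (UNIV :: 'a::peano set)"
  by unfold_locales (auto intro: pow_seq_exists)

lemma rest_iff: "rest m X Y \<longleftrightarrow> (\<forall>x. (memc x Y \<longrightarrow> memc x X \<and> x \<noteq> m) \<and> (memc x X \<longrightarrow> x = m \<or> memc x Y))"
  unfolding rest_def by blast

context
  fixes \<theta> :: fm
  assumes \<theta>: "Sigma00 \<theta>" "fm_below 3 0 \<theta>"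
begin

definition trel :: "'a::peano \<Rightarrow> 'a \<Rightarrow> 'a \<Rightarrow> bool" where
  "trel x y z \<longleftrightarrow> sat smodel \<theta> (\<lambda>i. if i = 0 then x else if i = 1 then y else z) (\<lambda>_. Aset)"

lemma sat_trel: "sat smodel \<theta> (\<lambda>i. if i = 0 then x else if i = 1 then y else z) s \<longleftrightarrow> trel x y (z::'a::peano)"
  unfolding trel_def by (rule sat_cong[OF \<theta>(2)]) auto

lemma ternary_trel: "ternary (trel :: 'a::peano \<Rightarrow> _)"
proof
  show "D1 (\<lambda>e::nat \<Rightarrow> 'a. trel (e 0) (e 1) (e 2))"
    unfolding trel_def
  proof (rule sat_Sigma00_D1[OF \<theta>(1)])
    show "F1 (\<lambda>e::nat \<Rightarrow> 'a. if i = 0 then e 0 else if i = 1 then e 1 else e 2)" for i :: nat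
      by (cases "i = 0"; cases "i = 1") (simp_all add: F1_var)
  qed (rule D1_rules F1_rules)+
qed

lemma sat_T_apart: "sat smodel (T_apart \<theta> X Y) e s \<longleftrightarrow>
    apart trel (tval smodel e X) (tval smodel e Y :: 'a::peano)"
proof -
  interpret U: exp_cut "UNIV :: 'a set" by (rule exp_cut_UNIV)
  show ?thesis unfolding T_apart_def apart_def smodel_cmodel
    by (simp add: numeral_eq_Suc sat_trel[unfolded smodel_cmodel One_nat_def] cong: if_cong)
qed

lemma sat_multiple_large:
  assumes L: "\<And>e s t. sat smodel (L t) e s \<longleftrightarrow> P (tval smodel e t :: 'a::peano)"
  shows "sat smodel (multiple_large \<theta> L k X) e s \<longleftrightarrow> mlarge trel P (tval smodel e k) (tval smodel e X)"
proof -
  interpret U: exp_cut "UNIV :: 'a set" by (rule exp_cut_UNIV)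
  show ?thesis unfolding multiple_large_def mlarge_def smodel_cmodel
    by (simp add: numeral_eq_Suc L[unfolded smodel_cmodel] sat_T_apart[unfolded smodel_cmodel])
qed

lemma sat_power_large: "sat smodel (power_large \<theta> n X) e s \<longleftrightarrow> large trel n (tval smodel e X :: 'a::peano)"
proof (induction n arbitrary: X e s)
  interpret U: exp_cut "UNIV :: 'a set" by (rule exp_cut_UNIV)
  case 0
  show ?case by (simp add: smodel_cmodel)
next
  interpret U: exp_cut "UNIV :: 'a set" by (rule exp_cut_UNIV)
  case (Suc n)
  show ?case
    using sat_multiple_large[of "power_large \<theta> n" "large trel n", OF Suc]
    by (simp add: smodel_cmodel numeral_eq_Suc rest_iff)
qed

lemma sat_omega_power_large: "sat smodel (omega_power_large \<theta> n X) e s \<longleftrightarrow>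
    (\<exists>m. isMin m (tval smodel e X) \<and> 3 \<le> m \<and> acst \<le> m) \<and> large trel n (tval smodel e X :: 'a::peano)"
proof -
  interpret U: exp_cut "UNIV :: 'a set" by (rule exp_cut_UNIV)
  have "sat smodel (omega_power_large \<theta> n X) e s \<longleftrightarrow>
    (\<exists>m. isMin m (tval smodel e X) \<and> 3 \<le> m \<and> acst \<le> m) \<and> sat smodel (power_large \<theta> n X) e s"
    by (simp add: omega_power_large_def smodel_cmodel le_def)
  then show ?thesis by (simp only: sat_power_large)
qed

end

section \<open>Transfer from the type class to arbitrary models\<close>

definition valid :: "'a model \<Rightarrow> fm \<Rightarrow> bool" where
  "valid M \<phi> \<longleftrightarrow> (\<forall>e s. envs M e s \<longrightarrow> sat M \<phi> e s)"

definition good :: "'a model \<Rightarrow> bool" where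
  "good M \<longleftrightarrow> wf_model M \<and> (\<forall>\<phi>\<in>ISigma01. valid M \<phi>)"

lemma envs_exist: "wf_model M \<Longrightarrow> \<exists>e s. envs M e s"
  unfolding wf_model_def envs_def by (intro exI[of _ "\<lambda>_. zro M"] exI[of _ "\<lambda>_. scst M"]) auto

lemma valid_Forall [simp]: "valid M (Forall \<phi>) \<longleftrightarrow> valid M \<phi>"
proof
  assume *: "valid M (Forall \<phi>)"
  show "valid M \<phi>" unfolding valid_def
  proof (intro allI impI)
    fix e s assume e: "envs M e s"
    then have "envs M (\<lambda>i. e (Suc i)) s" "e 0 \<in> Num M" by (auto simp: envs_def)
    then have "sat M \<phi> (e 0 ## (\<lambda>i. e (Suc i))) s" using * unfolding valid_def by simp
    moreover have "e 0 ## (\<lambda>i. e (Suc i)) = e" by (auto split: nat.splits)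
    ultimately show "sat M \<phi> e s" by simp
  qed
qed (auto simp: valid_def envs_cons)

lemma valid_ForallS [simp]: "valid M (ForallS \<phi>) \<longleftrightarrow> valid M \<phi>"
proof
  assume *: "valid M (ForallS \<phi>)"
  show "valid M \<phi>" unfolding valid_def
  proof (intro allI impI)
    fix e s assume e: "envs M e s"
    then have "envs M e (\<lambda>i. s (Suc i))" "s 0 \<in> Sets M" by (auto simp: envs_def)
    then have "sat M \<phi> e (s 0 ## (\<lambda>i. s (Suc i)))" using * unfolding valid_def by simp
    moreover have "s 0 ## (\<lambda>i. s (Suc i)) = s" by (auto split: nat.splits)
    ultimately show "sat M \<phi> e s" by simp
  qed
qed (auto simp: valid_def envs_consS)

lemma valid_closure: "valid M ((ForallS ^^ n) ((Forall ^^ m) \<phi>)) \<longleftrightarrow> valid M \<phi>"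
proof -
  have "valid M ((Forall ^^ m) \<phi>) \<longleftrightarrow> valid M \<phi>" by (induction m) auto
  then show ?thesis by (induction n) auto
qed

lemma fm_below_closure: "fm_below k l ((ForallS ^^ n) ((Forall ^^ m) \<phi>)) \<longleftrightarrow> fm_below (k + m) (l + n) \<phi>"
proof -
  have "fm_below k l ((Forall ^^ m) \<phi>) \<longleftrightarrow> fm_below (k + m) l \<phi>" for k l by (induction m arbitrary: k) auto
  then show ?thesis by (induction n arbitrary: l) auto
qed

text \<open>Every formula of a scheme has a closure by sufficiently many quantifiers, and closing
  does not change validity; so the schemes can be used with free parameters.\<close>

lemma valid_closures: "(\<forall>\<phi>\<in>closures S. valid M \<phi>) \<longleftrightarrow> (\<forall>\<phi>\<in>S. valid M \<phi>)"
proof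
  assume *: "\<forall>\<phi>\<in>closures S. valid M \<phi>"
  show "\<forall>\<phi>\<in>S. valid M \<phi>"
  proof
    fix \<phi> assume "\<phi> \<in> S"
    obtain m where "fm_below m m \<phi>" using fm_below_ex by blast
    then have "(ForallS ^^ m) ((Forall ^^ m) \<phi>) \<in> closures S"
      using \<open>\<phi> \<in> S\<close> fm_below_closure[of 0 0] unfolding closures_def by auto
    then show "valid M \<phi>" using * valid_closure by blast
  qed
qed (auto simp: closures_def valid_closure)

lemma good_iff: "good M \<longleftrightarrow> wf_model M \<and> (\<forall>\<phi>\<in>basic_axioms. valid M \<phi>) \<and>
    (\<forall>\<phi>. Sigma01 \<phi> \<longrightarrow> valid M (induction_axiom \<phi>))"
  unfolding good_def ISigma01_def ball_Un valid_closures by auto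

text \<open>Sets are matched by their traces on the number domain only, in accordance with the
  convention that they need not be subsets of it.\<close>

definition iso :: "('a \<Rightarrow> 'b) \<Rightarrow> 'a model \<Rightarrow> 'b model \<Rightarrow> bool" where
  "iso f M N \<longleftrightarrow> bij_betw f (Num M) (Num N) \<and>
     f (zro M) = zro N \<and> f (uno M) = uno N \<and> f (ncst M) = ncst N \<and>
     (\<forall>x\<in>Num M. \<forall>y\<in>Num M. f (pls M x y) = pls N (f x) (f y) \<and> f (tms M x y) = tms N (f x) (f y) \<and>
        (lss M x y \<longleftrightarrow> lss N (f x) (f y))) \<and>
     (\<forall>x\<in>Num M. x \<in> scst M \<longleftrightarrow> f x \<in> scst N) \<and> scst N \<in> Sets N \<and>
     (\<forall>X\<in>Sets M. \<exists>Y\<in>Sets N. \<forall>x\<in>Num M. x \<in> X \<longleftrightarrow> f x \<in> Y) \<and>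
     (\<forall>Y\<in>Sets N. \<exists>X\<in>Sets M. \<forall>x\<in>Num M. x \<in> X \<longleftrightarrow> f x \<in> Y)"

lemma iso_tval:
  assumes "iso f M N" "wf_model M" "\<And>i. e i \<in> Num M"
  shows "tval M e t \<in> Num M \<and> f (tval M e t) = tval N (\<lambda>i. f (e i)) t"
  using assms by (induction t) (auto simp: iso_def wf_model_def)

lemma iso_sat:
  assumes iso: "iso f M N" and wf: "wf_model M"
  shows "(\<And>i. e i \<in> Num M) \<Longrightarrow> (\<And>i x. x \<in> Num M \<Longrightarrow> x \<in> s i \<longleftrightarrow> f x \<in> s' i) \<Longrightarrow>
    sat M \<phi> e s \<longleftrightarrow> sat N \<phi> (\<lambda>i. f (e i)) s'"
proof (induction \<phi> arbitrary: e s s')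
  case (Eq t u)
  have *: "tval M e t \<in> Num M \<and> f (tval M e t) = tval N (\<lambda>i. f (e i)) t" for t
    by (rule iso_tval[OF iso wf]) (rule Eq(1))
  have "inj_on f (Num M)" using iso by (simp add: iso_def bij_betw_def)
  then have "tval M e t = tval M e u \<longleftrightarrow> f (tval M e t) = f (tval M e u)"
    using *[of t] *[of u] by (metis inj_onD)
  then show ?case using *[of t] *[of u] by simp
next
  case (Less t u)
  have *: "tval M e t \<in> Num M \<and> f (tval M e t) = tval N (\<lambda>i. f (e i)) t" for t
    by (rule iso_tval[OF iso wf]) (rule Less(1))
  show ?case using *[of t] *[of u] iso by (simp add: iso_def)
next
  case (Mem t X)
  have *: "tval M e t \<in> Num M \<and> f (tval M e t) = tval N (\<lambda>i. f (e i)) t"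
    by (rule iso_tval[OF iso wf]) (rule Mem(1))
  show ?case using * iso Mem(2) by (cases X) (auto simp: iso_def)
next
  case (Imp \<phi> \<psi>)
  then show ?case by (metis sat.simps(5))
next
  case (Forall \<phi>)
  have "sat M \<phi> (x ## e) s \<longleftrightarrow> sat N \<phi> (f x ## (\<lambda>i. f (e i))) s'" if "x \<in> Num M" for x
  proof -
    have "(\<lambda>i. f ((x ## e) i)) = f x ## (\<lambda>i. f (e i))" by (auto split: nat.splits)
    moreover have "(x ## e) i \<in> Num M" for i using that Forall.prems(1) by (cases i) auto
    ultimately show ?thesis using Forall.IH[of "x ## e" s s'] Forall.prems(2) by simp
  qed
  moreover have "Num N = f ` Num M" using iso by (simp add: iso_def bij_betw_def)
  ultimately show ?case by simp
next
  case (ForallS \<phi>)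
  have *: "sat M \<phi> e (X ## s) \<longleftrightarrow> sat N \<phi> (\<lambda>i. f (e i)) (Y ## s')"
    if "\<forall>x\<in>Num M. x \<in> X \<longleftrightarrow> f x \<in> Y" for X Y
    by (rule ForallS.IH) (use that ForallS.prems in \<open>auto split: nat.splits\<close>)
  then show ?case using iso unfolding iso_def sat.simps by meson
qed auto

lemma iso_wf: "iso f M N \<Longrightarrow> wf_model M \<Longrightarrow> wf_model N"
proof -
  assume iso: "iso f M N" and wf: "wf_model M"
  have N: "Num N = f ` Num M" using iso by (simp add: iso_def bij_betw_def)
  show ?thesis using iso wf unfolding wf_model_def N iso_def by (auto simp: image_iff) metis+
qed

lemma iso_valid:
  assumes iso: "iso f M N" and wf: "wf_model M" shows "valid M \<phi> \<longleftrightarrow> valid N \<phi>"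
proof
  have isoN: "\<forall>Y\<in>Sets N. \<exists>X\<in>Sets M. \<forall>x\<in>Num M. x \<in> X \<longleftrightarrow> f x \<in> Y"
    using iso by (simp add: iso_def)
  have N: "Num N = f ` Num M" using iso by (simp add: iso_def bij_betw_def)
  assume *: "valid M \<phi>"
  show "valid N \<phi>" unfolding valid_def
  proof (intro allI impI)
    fix e s assume e: "envs N e s"
    have "\<forall>i. e i \<in> f ` Num M" using e N by (simp add: envs_def)
    then have "\<forall>i. \<exists>x\<in>Num M. f x = e i" by (metis imageE)
    then obtain e' where e': "\<And>i. e' i \<in> Num M" "\<And>i. f (e' i) = e i" by metis
    have "\<forall>i. \<exists>X. X \<in> Sets M \<and> (\<forall>x\<in>Num M. x \<in> X \<longleftrightarrow> f x \<in> s i)"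
      using e isoN unfolding envs_def by metis
    from choice[OF this] obtain s' where s': "\<forall>i. s' i \<in> Sets M \<and> (\<forall>x\<in>Num M. x \<in> s' i \<longleftrightarrow> f x \<in> s i)" ..
    have "envs M e' s'" using e' s' by (simp add: envs_def)
    then have "sat M \<phi> e' s'" using * unfolding valid_def by blast
    moreover have "sat M \<phi> e' s' \<longleftrightarrow> sat N \<phi> (\<lambda>i. f (e' i)) s" by (rule iso_sat[OF iso wf]) (use e' s' in auto)
    ultimately show "sat N \<phi> e s" using e'(2) by simp
  qed
next
  have N: "Num N = f ` Num M" using iso by (simp add: iso_def bij_betw_def)
  have isoM: "\<forall>X\<in>Sets M. \<exists>Y\<in>Sets N. \<forall>x\<in>Num M. x \<in> X \<longleftrightarrow> f x \<in> Y"
    using iso by (simp add: iso_def)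
  assume *: "valid N \<phi>"
  show "valid M \<phi>" unfolding valid_def
  proof (intro allI impI)
    fix e s assume e: "envs M e s"
    then have e': "\<And>i. e i \<in> Num M" by (simp add: envs_def)
    have "\<forall>i. \<exists>Y. Y \<in> Sets N \<and> (\<forall>x\<in>Num M. x \<in> s i \<longleftrightarrow> f x \<in> Y)"
      using e isoM unfolding envs_def by metis
    from choice[OF this] obtain s' where s': "\<forall>i. s' i \<in> Sets N \<and> (\<forall>x\<in>Num M. x \<in> s i \<longleftrightarrow> f x \<in> s' i)" ..
    have "envs N (\<lambda>i. f (e i)) s'" using s' e' N by (simp add: envs_def)
    then have "sat N \<phi> (\<lambda>i. f (e i)) s'" using * unfolding valid_def by blast
    moreover have "sat M \<phi> e s \<longleftrightarrow> sat N \<phi> (\<lambda>i. f (e i)) s'" by (rule iso_sat[OF iso wf]) (use e' s' in auto)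
    ultimately show "sat M \<phi> e s" by simp
  qed
qed

lemma iso_good: "iso f M N \<Longrightarrow> wf_model M \<Longrightarrow> good M \<longleftrightarrow> good N"
  unfolding good_def using iso_wf iso_valid by blast

definition image_model :: "('a \<Rightarrow> 'b) \<Rightarrow> 'a model \<Rightarrow> 'b model" where
  "image_model f M = \<lparr>Num = f ` Num M, Sets = (`) f ` Sets M, ncst = f (ncst M), scst = f ` scst M,
     zro = f (zro M), uno = f (uno M), pls = (\<lambda>x y. f (pls M (inv f x) (inv f y))),
     tms = (\<lambda>x y. f (tms M (inv f x) (inv f y))), lss = (\<lambda>x y. lss M (inv f x) (inv f y))\<rparr>"

lemma iso_image_model: "inj f \<Longrightarrow> wf_model M \<Longrightarrow> iso f M (image_model f M)"
  unfolding iso_def image_model_def wf_model_def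
  by (auto simp: bij_betw_def inj_image_mem_iff intro: inj_on_subset)

definition nat_model :: "nat model" where
  "nat_model = \<lparr>Num = UNIV, Sets = UNIV, ncst = 0, scst = {}, zro = 0, uno = 1, pls = (+), tms = (*), lss = (<)\<rparr>"

lemma valid_induction_axiom:
  "valid M (induction_axiom \<phi>) \<longleftrightarrow> (\<forall>e s. envs M e s \<longrightarrow> sat M \<phi> (zro M ## e) s \<longrightarrow>
     (\<forall>x\<in>Num M. sat M \<phi> (x ## e) s \<longrightarrow> sat M \<phi> (pls M x (uno M) ## e) s) \<longrightarrow>
     (\<forall>x\<in>Num M. sat M \<phi> (x ## e) s))"
proof -
  have "(\<lambda>i. tval M (x ## e) ((NVar(0 := NVar 0 \<^bold>+ One)) i)) = pls M x (uno M) ## e" for x e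
    by (auto split: nat.splits)
  then have "sat M (induction_axiom \<phi>) e s \<longleftrightarrow> (sat M \<phi> (zro M ## e) s \<longrightarrow>
     (\<forall>x\<in>Num M. sat M \<phi> (x ## e) s \<longrightarrow> sat M \<phi> (pls M x (uno M) ## e) s) \<longrightarrow>
     (\<forall>x\<in>Num M. sat M \<phi> (x ## e) s))" for e s
    unfolding induction_axiom_def by (simp add: sat_inst sat_fsub del: fun_upd_apply) blast
  then show ?thesis unfolding valid_def by simp
qed

lemma valid_basic_axioms:
  assumes "wf_model M"
  shows "(\<forall>\<phi>\<in>basic_axioms. valid M \<phi>) \<longleftrightarrow> (\<forall>m\<in>Num M. \<forall>n\<in>Num M.
     pls M n (uno M) \<noteq> zro M \<and> (pls M m (uno M) = pls M n (uno M) \<longrightarrow> m = n) \<and> pls M m (zro M) = m \<and>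
     pls M m (pls M n (uno M)) = pls M (pls M m n) (uno M) \<and> tms M m (zro M) = zro M \<and>
     tms M m (pls M n (uno M)) = pls M (tms M m n) m \<and> \<not> lss M m (zro M) \<and>
     (lss M m (pls M n (uno M)) \<longleftrightarrow> lss M m n \<or> m = n))" (is "?L \<longleftrightarrow> (\<forall>m\<in>_. \<forall>n\<in>_. ?R m n)")
proof -
  have "(\<forall>\<phi>\<in>basic_axioms. sat M \<phi> e s) \<longleftrightarrow> ?R (e 0) (e (Suc 0))" for e s
    unfolding basic_axioms_def Let_def by (simp add: disj_commute) blast
  then have "?L \<longleftrightarrow> (\<forall>e s. envs M e s \<longrightarrow> ?R (e 0) (e (Suc 0)))" unfolding valid_def by blast
  also have "\<dots> \<longleftrightarrow> (\<forall>m\<in>Num M. \<forall>n\<in>Num M. ?R m n)"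
  proof (intro iffI ballI allI impI)
    fix m n assume *: "\<forall>e s. envs M e s \<longrightarrow> ?R (e 0) (e (Suc 0))" and mn: "m \<in> Num M" "n \<in> Num M"
    obtain e s where "envs M e s" using envs_exist[OF assms] by blast
    then have "envs M (m ## n ## e) s" by (intro envs_cons mn)
    from *[rule_format, OF this] show "?R m n" by simp
  next
    fix e s assume "\<forall>m\<in>Num M. \<forall>n\<in>Num M. ?R m n" "envs M e s"
    then show "?R (e 0) (e (Suc 0))" unfolding envs_def by blast
  qed
  finally show ?thesis .
qed

lemma good_nat_model: "good nat_model"
proof -
  have wf: "wf_model nat_model" by (simp add: wf_model_def nat_model_def)
  have "valid nat_model (induction_axiom \<phi>)" for \<phi>
    unfolding valid_induction_axiom
  proof (intro allI impI ballI)
    fix e s x assume *: "sat nat_model \<phi> (zro nat_model ## e) s"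
      "\<forall>x\<in>Num nat_model. sat nat_model \<phi> (x ## e) s \<longrightarrow> sat nat_model \<phi> (pls nat_model x (uno nat_model) ## e) s"
    show "sat nat_model \<phi> (x ## e) s"
      by (induction x) (use * in \<open>auto simp: nat_model_def\<close>)
  qed
  moreover have "\<forall>\<phi>\<in>basic_axioms. valid nat_model \<phi>"
    unfolding valid_basic_axioms[OF wf] by (auto simp: nat_model_def)
  ultimately show ?thesis unfolding good_iff using wf by blast
qed

text \<open>The standard model is copied onto the numerals. It is the candidate for
  \<open>generic_model\<close> in case there is no counterexample to transfer.\<close>

lemma good_tm_model: "\<exists>M :: tm model. good M"
proof -
  define f where "f n = ((\<lambda>t. t \<^bold>+ One) ^^ n) Zero" for n
  have "f m = f n \<Longrightarrow> m = n" for m n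
    by (induction m arbitrary: n; case_tac n) (auto simp: f_def)
  then have "inj f" by (auto simp: inj_def)
  moreover have "wf_model nat_model" using good_nat_model good_def by blast
  ultimately show ?thesis using iso_image_model iso_good good_nat_model by blast
qed

text \<open>Expressed by a formula, so that it can be read in the model given by a cut, where it
  provides the codes demanded by \<open>exp_cut\<close>.\<close>

definition pow_total :: "'a model \<Rightarrow> bool" where
  "pow_total M \<longleftrightarrow> valid M (Exists (power_eq (NVar 1) (NVar 2) (NVar 0)))"

text \<open>In \<open>shrink_fm\<close>, variable 0 is \<open>Y\<close>, variable 1 is \<open>X\<close>, and the pair of variables 2 and 3 codes a colouring.\<close>

definition shrink_fm :: "fm \<Rightarrow> fm" where
  "shrink_fm \<theta> = (NVar 0 \<^bold>\<subseteq>\<^sub>c NVar 1 \<^bold>\<and> Exists (Exists (Exists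
     (is_min (NVar 2) (NVar 4) \<^bold>\<and> is_min (NVar 1) (NVar 3) \<^bold>\<and> is_max (NVar 0) (NVar 3) \<^bold>\<and> NVar 2 \<^bold>< NVar 1 \<^bold>\<and>
      BForall (NVar 2) (BExists (NVar 2) (BForall (NVar 2) (inst3 \<theta> (NVar 2) (NVar 1) (NVar 0)))) \<^bold>\<and>
      (Exists (Exists (NVar 1 \<^bold>\<in>\<^sub>c NVar 6 \<^bold>\<and> beta (NVar 7) (NVar 8) (NVar 1) (NVar 0) \<^bold>\<and> NVar 4 \<^bold>\<le> NVar 0)) \<^bold>\<or>
       Exists (Forall (NVar 0 \<^bold>\<in>\<^sub>c NVar 5 \<^bold>\<longrightarrow> beta (NVar 7) (NVar 8) (NVar 0) (NVar 1))))))))"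

text \<open>The environment \<open>e2\<close> is quantified after \<open>Y\<close> because later it
  stores \<open>Y\<close> itself under a fresh variable.\<close>

definition shrinks :: "'a model \<Rightarrow> bool" where
  "shrinks M \<longleftrightarrow> (\<forall>\<theta> n e s. Sigma00 \<theta> \<longrightarrow> fm_below 3 0 \<theta> \<longrightarrow> envs M e s \<longrightarrow> (\<forall>X\<in>Num M. \<forall>b\<in>Num M. \<forall>c\<in>Num M.
     sat M (omega_power_large \<theta> (Suc (4 * n)) (NVar 0)) (X ## e) s \<longrightarrow> sat M (exp_sparse (NVar 0)) (X ## e) s \<longrightarrow>
     (\<exists>Y\<in>Num M. \<forall>e2. envs M e2 s \<longrightarrow> sat M (shrink_fm \<theta>) (Y ## X ## b ## c ## e2) s \<and>
        sat M (exp_sparse (NVar 0)) (Y ## e2) s \<and> sat M (omega_power_large \<theta> n (NVar 0)) (Y ## e2) s)))"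

definition large_descends :: "'a model \<Rightarrow> bool" where
  "large_descends M \<longleftrightarrow> (\<forall>\<theta> n e s. Sigma00 \<theta> \<longrightarrow> fm_below 3 0 \<theta> \<longrightarrow> envs M e s \<longrightarrow>
     sat M (omega_power_large \<theta> (Suc n) (NVar 0)) e s \<longrightarrow> sat M (omega_power_large \<theta> n (NVar 0)) e s)"

lemma sat_shrink_fm:
  assumes \<theta>: "Sigma00 \<theta>" "fm_below 3 0 \<theta>"
  shows "sat smodel (shrink_fm \<theta>) e s \<longleftrightarrow> sub (e 0) (e 1) \<and>
    (\<exists>m m' M'. isMin m (e 1) \<and> isMin m' (e 0) \<and> isMax M' (e 0) \<and> m < m' \<and>
      (\<forall>x<m. \<exists>y<m'. \<forall>z<M'. trel \<theta> x y z) \<and>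
      ((\<exists>x. memc x (e 1) \<and> m \<le> bt (e 2) (e 3) x) \<or> (\<exists>u. \<forall>x. memc x (e 0) \<longrightarrow> u = bt (e 2) (e 3 :: 'a::peano) x)))"
proof -
  interpret U: exp_cut "UNIV :: 'a set" by (rule exp_cut_UNIV)
  show ?thesis unfolding shrink_fm_def smodel_cmodel
    by (simp add: numeral_eq_Suc le_def sat_trel[OF \<theta>, unfolded smodel_cmodel One_nat_def] cong: if_cong) blast
qed

lemma pow_total_smodel: "pow_total (smodel :: 'a::peano model)"
proof -
  interpret U: exp_cut "UNIV :: 'a set" by (rule exp_cut_UNIV)
  show ?thesis unfolding pow_total_def valid_def smodel_cmodel by simp
qed

lemma shrinks_smodel: "shrinks (smodel :: 'a::peano model)"
  unfolding shrinks_def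
proof (intro allI impI ballI)
  fix \<theta> n and e :: "nat \<Rightarrow> 'a" and s and X b c :: 'a
  assume \<theta>: "Sigma00 \<theta>" "fm_below 3 0 \<theta>"
    and X: "sat smodel (omega_power_large \<theta> (Suc (4 * n)) (NVar 0)) (X ## e) s"
      "sat smodel (exp_sparse (NVar 0)) (X ## e) s"
  interpret U: exp_cut "UNIV :: 'a set" by (rule exp_cut_UNIV)
  interpret ternary "trel \<theta> :: 'a \<Rightarrow> _" by (rule ternary_trel[OF \<theta>])
  interpret colouring "trel \<theta> :: 'a \<Rightarrow> _" "bt b c"
    by unfold_locales (rule F1_rules)+
  obtain m where m: "isMin m X" "3 \<le> m" "acst \<le> m" and L: "large (trel \<theta>) (Suc (4 * n)) X"
    using X(1) unfolding sat_omega_power_large[OF \<theta>] by auto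
  have E: "expsp X" using X(2) by (simp add: smodel_cmodel)
  obtain Y m' M' where Y: "sub Y X" "large (trel \<theta>) n Y" "isMin m' Y" "isMax M' Y" "m < m'"
    "\<forall>x<m. \<exists>y<m'. \<forall>z<M'. trel \<theta> x y z" "(\<exists>x. memc x X \<and> m \<le> bt b c x) \<or> (\<exists>u. hom Y u)"
    using shrink[OF L E m(1,2)] by blast
  have "(\<exists>x. memc x X \<and> m \<le> bt b c x) \<or> (\<exists>u. \<forall>x. memc x Y \<longrightarrow> u = bt b c x)"
    using Y(7) unfolding hom_def by metis
  then have "sat smodel (shrink_fm \<theta>) (Y ## X ## b ## c ## e2) s" for e2
    unfolding sat_shrink_fm[OF \<theta>] using Y(1,3-6) m(1) by (simp add: numeral_eq_Suc) blast
  moreover have "sat smodel (exp_sparse (NVar 0)) (Y ## e2) s" for e2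
    using expsp_sub[OF E Y(1)] by (simp add: smodel_cmodel)
  moreover have "sat smodel (omega_power_large \<theta> n (NVar 0)) (Y ## e2) s" for e2
    unfolding sat_omega_power_large[OF \<theta>] using Y(2,3,5) m(2,3) by (auto intro!: exI[of _ m'])
  moreover have "Y \<in> Num smodel" by (simp add: smodel_def)
  ultimately show "\<exists>Y\<in>Num smodel. \<forall>e2. envs smodel e2 s \<longrightarrow> sat smodel (shrink_fm \<theta>) (Y ## X ## b ## c ## e2) s \<and>
      sat smodel (exp_sparse (NVar 0)) (Y ## e2) s \<and> sat smodel (omega_power_large \<theta> n (NVar 0)) (Y ## e2) s"
    by blast
qed

lemma large_descends_smodel: "large_descends (smodel :: 'a::peano model)"
  unfolding large_descends_def
proof (intro allI impI)
  fix \<theta> n and e :: "nat \<Rightarrow> 'a" and s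
  assume \<theta>: "Sigma00 \<theta>" "fm_below 3 0 \<theta>" and X: "sat smodel (omega_power_large \<theta> (Suc n) (NVar 0)) e s"
  interpret ternary "trel \<theta> :: 'a \<Rightarrow> _" by (rule ternary_trel[OF \<theta>])
  obtain m where m: "isMin m (e 0)" "3 \<le> m" "acst \<le> m" and L: "large (trel \<theta>) (Suc n) (e 0)"
    using X unfolding sat_omega_power_large[OF \<theta>] by auto
  have "m \<noteq> 0" using m(2) by auto
  then show "sat smodel (omega_power_large \<theta> n (NVar 0)) e s"
    unfolding sat_omega_power_large[OF \<theta>] using large_Suc_imp[OF L m(1)] m by auto
qed

section \<open>The cut below a descending sequence of large sets\<close>

abbreviation elts :: "'a::peano \<Rightarrow> 'a set" where
  "elts F \<equiv> {x. memc x F}"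

lemma D1_elts: "D1 (\<lambda>e. e 0 \<in> elts F)"
  unfolding mem_Collect_eq by (rule D1_rules F1_rules)+

definition iseg :: "'a::peano \<Rightarrow> 'a \<Rightarrow> bool" where
  "iseg t s \<longleftrightarrow> (\<exists>l k. isMax l t \<and> isMax k s \<and> l \<le> k \<and> (\<forall>i<l. memc i t \<longleftrightarrow> memc i s))"

lemma D1_iseg [D1_rules]: "F1 f \<Longrightarrow> F1 g \<Longrightarrow> D1 (\<lambda>e. iseg (f e) (g e :: 'a::peano))"
proof (rule D1_comp2[of iseg])
  have "iseg t s \<longleftrightarrow> (\<exists>l<t. \<exists>k<s. isMax l t \<and> isMax k s \<and> l \<le> k \<and> (\<forall>i<l. memc i t \<longleftrightarrow> memc i s))" for t s :: 'a
    unfolding iseg_def using memc_less unfolding isMax_def by blast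
  then show "D1 (\<lambda>e::nat \<Rightarrow> 'a. iseg (e 0) (e 1))" by (simp only:) (rule D1_rules F1_rules)+
qed

lemma isMax_unique: "isMax m F \<Longrightarrow> isMax m' F \<Longrightarrow> m = (m'::'a::peano)"
  unfolding isMax_def by (meson antisym)

text \<open>The prefix of length \<open>l\<close> of a binary string: its digits below
  \<open>l\<close>, topped by the leading 1 at \<open>l\<close> that marks the length.\<close>

lemma truncated_code:
  "\<exists>t<p2 (l + 1). (\<forall>i. memc i t \<longleftrightarrow> i < l \<and> memc i s \<or> i = l) \<and> isMax l (t::'a::peano)"
proof -
  have D: "D1 (\<lambda>e. e 0 < l \<and> memc (e 0) s \<or> e 0 = l)" by (rule D1_rules F1_rules)+
  obtain t where t: "t < p2 (l + 1)" "\<And>i. memc i t \<longleftrightarrow> i < l + 1 \<and> (i < l \<and> memc i s \<or> i = l)"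
    by (rule bounded_comprehension[of "\<lambda>i. i < l \<and> memc i s \<or> i = l" "l + 1", OF D]) blast
  have t2: "memc i t \<longleftrightarrow> i < l \<and> memc i s \<or> i = l" for i using t(2)[of i] by (auto simp: less_imp_le)
  then have "isMax l t" unfolding isMax_def by (auto simp: less_imp_le)
  then show ?thesis using t(1) t2 by blast
qed

text \<open>A pair treated at a stage whose minimum does not exceed its colours yields no
  homogeneity, by the first alternative of \<open>colour\<close>. Recurrence guarantees a later
  stage where the minimum is large enough.\<close>

locale descent = ternary T for T :: "'a::peano \<Rightarrow> 'a \<Rightarrow> 'a \<Rightarrow> bool" +
  fixes X b c m M :: "nat \<Rightarrow> 'a"
  assumes isMin_X: "isMin (m n) (X n)" and isMax_X: "isMax (M n) (X n)"
    and sub_Suc: "sub (X (Suc n)) (X n)" and m_Suc: "m n < m (Suc n)"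
    and witness: "x < m n \<Longrightarrow> \<exists>y<m (Suc n). \<forall>z<M (Suc n). T x y z"
    and colour: "(\<exists>x. memc x (X n) \<and> m n \<le> bt (b n) (c n) x) \<or>
      (\<exists>u. \<forall>x. memc x (X (Suc n)) \<longrightarrow> u = bt (b n) (c n) x)"
    and recurring: "\<exists>n\<ge>k. b n = b' \<and> c n = c'"
    and expsp_X: "expsp (X 0)" and m_0: "3 \<le> m 0" "acst \<le> m 0"
begin

lemma m_mono: "i \<le> j \<Longrightarrow> m i \<le> m j"
  using lift_Suc_mono_le[of m i j] m_Suc less_imp_le by blast

lemma sub_mono: "i \<le> j \<Longrightarrow> sub (X j) (X i)"
proof (induction rule: dec_induct)
  case (step n) then show ?case using sub_Suc sub_trans by blast
qed (simp add: sub_def)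

lemma m_mem: "i \<le> j \<Longrightarrow> memc (m j) (X i)"
  using sub_mono isMin_X unfolding isMin_def sub_def by blast

definition I :: "'a set" where
  "I = {x. \<exists>n. x < m n}"

lemma m_I: "m n \<in> I"
  using m_Suc unfolding I_def by blast

lemma I_D: "x \<in> I \<Longrightarrow> \<exists>n\<ge>k. x < m n"
proof -
  assume "x \<in> I"
  then obtain n where "x < m n" unfolding I_def by blast
  then have "x < m (max n k)" using m_mono[of n "max n k"] by (meson less_le_trans max.cobounded1)
  then show ?thesis by (intro exI[of _ "max n k"]) simp
qed

text \<open>The code \<open>X 0\<close> exceeds the whole cut. It serves below as the bound of
  searches and comprehensions that have to cover the cut.\<close>

lemma I_less: "x \<in> I \<Longrightarrow> x < X 0"
  using I_D[of x 0] m_mem[of 0] memc_less less_trans by blast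

lemma X0_I: "X 0 \<notin> I"
  using I_less by blast

text \<open>Consecutive minima both belong to the sparse set \<open>X 0\<close>, so the power of one
  lies below the next.\<close>

lemma pw4_I: "x \<in> I \<Longrightarrow> pw 4 x \<in> I"
proof -
  assume "x \<in> I"
  then obtain n where n: "x < m n" using I_D by blast
  have "pw 4 x \<le> pw 4 (m n)" using n by (intro pw_mono) (simp_all add: less_imp_le)
  also have "\<dots> < m (Suc n)"
    using expsp_X m_mem[of 0 n] m_mem[of 0 "Suc n"] m_Suc[of n] unfolding expsp_def by blast
  finally show ?thesis unfolding I_def by blast
qed

lemma p2_I: "x \<in> I \<Longrightarrow> p2 x \<in> I"
proof -
  assume "x \<in> I"
  then obtain n where "pw 4 x < m n" using pw4_I I_D by blast
  then show ?thesis using p2_le_pw4[of x] le_less_trans unfolding I_def by blast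
qed

sublocale closed_cut I
proof
  have le: "x \<in> I" if "x \<le> y" "y \<in> I" for x y using that unfolding I_def by (auto intro: le_less_trans)
  have "(0::'a) \<le> 3" "(1::'a) \<le> 3" by simp_all
  then show "0 \<in> I" "1 \<in> I" "acst \<in> I"
    using le[OF _ m_I[of 0]] m_0 order_trans by blast+
  show "y \<in> I \<Longrightarrow> x \<le> y \<Longrightarrow> x \<in> I" for x y using le by blast
  fix x y assume xy: "x \<in> I" "y \<in> I"
  \<comment> \<open>Both \<open>x\<close> and \<open>y\<close> are at most \<open>p2 z\<close>, and
    \<open>2 \<le> p2 z\<close> as \<open>1 \<le> z\<close>. Sum and product are then at most
    \<open>p2 z * p2 z\<close>, which is \<open>pw 4 z\<close>.\<close>
  define z where "z = max (max x y) 1"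
  have "z \<in> I" using xy \<open>1 \<in> I\<close> by (auto simp: z_def max_def)
  have z: "x \<le> p2 z" "y \<le> p2 z" "2 \<le> p2 z"
  proof -
    have "x \<le> z" "y \<le> z" "1 \<le> z" by (simp_all add: z_def le_max_iff_disj)
    then show "x \<le> p2 z" "y \<le> p2 z" "2 \<le> p2 z"
      using less_p2[of z] p2_mono[of 1 z] by (auto intro: order_trans less_imp_le)
  qed
  have "x * y \<le> pw 4 z" unfolding pw4 using z by (intro mult_mono) auto
  then show "x * y \<in> I" using le pw4_I[OF \<open>z \<in> I\<close>] by blast
  have "x + y \<le> 2 * p2 z" unfolding mult_2 using z by (intro add_mono)
  also have "\<dots> \<le> pw 4 z" unfolding pw4 using z by (intro mult_right_mono) auto
  finally show "x + y \<in> I" using le pw4_I[OF \<open>z \<in> I\<close>] by blast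
qed

section \<open>Combinatorial properties of the cut\<close>

lemma I_less_out: "x \<in> I \<Longrightarrow> y \<notin> I \<Longrightarrow> x < y"
  using down_I not_less by blast

text \<open>A Delta_1 predicate true on the cut and nowhere else would define the cut; as the cut is
  closed under successor, induction would carry it to \<open>X 0\<close>.\<close>

lemma overspill:
  assumes "D1 (\<lambda>e. P (e 0))" "\<And>t. t \<in> I \<Longrightarrow> P t"
  shows "\<exists>t. t \<notin> I \<and> P t"
proof (rule ccontr)
  assume *: "\<not> ?thesis"
  have "P (X 0)"
  proof (rule S1_induct[of P])
    show "P (x + 1)" if "P x" for x
    proof -
      have "x \<in> I" using * that by blast
      then show ?thesis using assms(2) add_I one_I by blast
    qed
  qed (use assms zero_I in \<open>auto intro: S1_D1\<close>)
  then show False using * X0_I by blast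
qed

text \<open>Choosing a colour for each \<open>t < X 0\<close> gives a coded colouring. It is treated
  at some stage whose minimum exceeds \<open>a\<close>, which makes the next set homogeneous. All
  later minima belong to that set, and they are cofinal in the cut.\<close>

lemma regularity:
  assumes S: "S1 (\<lambda>e. S (e 0) (e 1))" and a: "a \<in> I" and ex: "\<And>t. \<exists>u<a. S t u"
  shows "\<exists>u<a. \<forall>x\<in>I. \<exists>t\<in>I. x \<le> t \<and> S t u"
proof -
  have S': "S1 (\<lambda>e. e 1 < a \<and> S (e 0) (e 1))" by (rule S1_conj[OF S1_D1[OF D1_less[OF F1_var F1_const]] S])
  obtain b' c' where bc: "\<And>t. t < X 0 \<Longrightarrow> bt b' c' t < a \<and> S t (bt b' c' t)"
    using S1_choice[of "\<lambda>t u. u < a \<and> S t u" "X 0", OF S'] ex by blast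
  obtain k where k: "a < m k" using I_D[OF a] by blast
  obtain n where n: "n \<ge> k" "b n = b'" "c n = c'" using recurring by blast
  have "\<not> (\<exists>x. memc x (X n) \<and> m n \<le> bt (b n) (c n) x)"
  proof
    assume "\<exists>x. memc x (X n) \<and> m n \<le> bt (b n) (c n) x"
    then obtain x where x: "memc x (X n)" "m n \<le> bt b' c' x" using n by blast
    have "x < X 0" using x(1) sub_mono[of 0 n] memc_less unfolding sub_def by blast
    then have "bt b' c' x < m n" using bc k m_mono[OF n(1)] by (meson less_trans less_le_trans)
    then show False using x(2) by simp
  qed
  then obtain u where u: "\<And>x. memc x (X (Suc n)) \<Longrightarrow> u = bt b' c' x" using colour[of n] n by blast
  have "\<exists>t\<in>I. x \<le> t \<and> u < a \<and> S t u" if x: "x \<in> I" for x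
  proof -
    obtain r where r: "r \<ge> Suc n" "x < m r" using I_D[OF x] by blast
    have "u = bt b' c' (m r)" using u m_mem[OF r(1)] by blast
    moreover have "m r < X 0" using I_less m_I by blast
    ultimately show ?thesis using bc[of "m r"] r(2) m_I by (intro bexI[of _ "m r"]) (auto simp: less_imp_le)
  qed
  then show ?thesis using zero_I by blast
qed

text \<open>Regularity implies semiregularity: let the colour of \<open>t\<close> be an argument whose value is minimal among
  the values above \<open>t\<close>.\<close>

lemma semiregularity:
  assumes f: "F1 (\<lambda>e. f (e 0))" and n: "n \<in> I"
  shows "\<exists>w\<in>I. \<forall>x<n. f x \<in> I \<longrightarrow> f x < w"
proof (cases "n = 0")
  case True
  then show ?thesis by (intro bexI[OF _ zero_I]) simp
next
  case False
  \<comment> \<open>The second disjunct is a default that makes every colour admissible when no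
    value reaches \<open>t\<close>.\<close>
  let ?S = "\<lambda>t x. (t \<le> f x \<and> (\<forall>y<n. t \<le> f y \<longrightarrow> f x \<le> f y)) \<or> (\<forall>y<n. f y < t)"
  have S: "S1 (\<lambda>e. ?S (e 0) (e 1))" by (rule S1_D1, (rule D1_rules F1_rules F1_comp1[OF f])+)
  have "\<exists>x<n. ?S t x" for t
  proof (cases "\<exists>y<n. t \<le> f y")
    case True
    then obtain y where y: "y < n" "t \<le> f y" by blast
    have D: "D1 (\<lambda>e. \<exists>y<n. t \<le> f y \<and> f y = e 0)" by (rule D1_rules F1_rules F1_comp1[OF f])+
    obtain v where v: "\<exists>y<n. t \<le> f y \<and> f y = v" "\<And>w. w < v \<Longrightarrow> \<not> (\<exists>y<n. t \<le> f y \<and> f y = w)"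
      by (rule least_element[of "\<lambda>v. \<exists>y<n. t \<le> f y \<and> f y = v" "f y", OF D]) (use y in blast)+
    then obtain x where x: "x < n" "t \<le> f x" "f x = v" by blast
    have "f x \<le> f z" if "z < n" "t \<le> f z" for z using v(2)[of "f z"] x(3) that not_less by blast
    then show ?thesis using x by blast
  next
    case none: False
    have "0 < n" using False by simp
    moreover have "\<forall>y<n. f y < t" using none by (auto simp: not_le)
    ultimately show ?thesis by blast
  qed
  from regularity[of ?S, OF S n this] obtain u where u: "u < n" "\<And>x. x \<in> I \<Longrightarrow> \<exists>t\<in>I. x \<le> t \<and> ?S t u" by blast
  \<comment> \<open>If \<open>f u\<close> is in the cut, a \<open>t\<close> beyond it leaves only
    the default, which says that \<open>t\<close> bounds all values. If not, every value from
    \<open>t\<close> onwards is at least \<open>f u\<close>, hence outside the cut, and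
    \<open>t\<close> bounds those inside.\<close>
  show ?thesis
  proof (cases "f u \<in> I")
    case True
    then obtain t where t: "t \<in> I" "f u + 1 \<le> t" "?S t u" using u(2)[of "f u + 1"] add_I one_I by blast
    then have "\<not> t \<le> f u" by (simp add: not_le)
    then show ?thesis using t by blast
  next
    case False
    obtain t where t: "t \<in> I" "?S t u" using u(2)[OF zero_I] by blast
    have "f u < t \<Longrightarrow> f u \<in> I" using less_I t(1) by blast
    then have *: "\<forall>y<n. t \<le> f y \<longrightarrow> f u \<le> f y" using t(2) u(1) False by blast
    have "f y < t" if "y < n" "f y \<in> I" for y
      using * that False down_I not_less by blast
    then show ?thesis using t(1) by blast
  qed
qed

text \<open>The least witness, with default value \<open>X 0\<close> outside the cut, is a coded
  function of \<open>x\<close>; semiregularity bounds those of its values that lie in the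
  cut.\<close>

lemma bounding_D1:
  assumes R: "D1 (\<lambda>e. R (e 0) (e 1))" and n: "n \<in> I"
  shows "\<exists>w\<in>I. \<forall>x<n. (\<exists>y\<in>I. R x y) \<longrightarrow> (\<exists>y<w. R x y)"
proof -
  let ?L = "\<lambda>x y. (y < X 0 \<and> R x y \<and> (\<forall>z<y. \<not> R x z)) \<or> (y = X 0 \<and> (\<forall>z<X 0. \<not> R x z))"
  have L: "D1 (\<lambda>e. ?L (e 0) (e 1))" by (rule D1_comp2[OF R] D1_rules F1_rules)+
  have ex: "\<exists>y. ?L x y" for x
  proof (cases "\<exists>y<X 0. R x y")
    case True
    then obtain y where y: "y < X 0" "R x y" by blast
    have D: "D1 (\<lambda>e. R x (e 0))" by (rule D1_comp2[OF R] F1_rules)+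
    obtain v where "R x v" "\<And>z. z < v \<Longrightarrow> \<not> R x z" "v \<le> y"
      by (rule least_element[of "R x" y, OF D y(2)]) blast
    then show ?thesis using y(1) by (meson le_less_trans)
  next
    case False
    then show ?thesis by blast
  qed
  obtain b' c' where bc: "\<And>x. x < n \<Longrightarrow> ?L x (bt b' c' x)"
    using S1_choice[of ?L n, OF S1_D1[OF L]] ex by blast
  have "F1 (\<lambda>e. bt b' c' (e 0))" by (rule F1_rules)+
  from semiregularity[OF this n] obtain w where w: "w \<in> I" "\<And>x. x < n \<Longrightarrow> bt b' c' x \<in> I \<Longrightarrow> bt b' c' x < w" by blast
  have "\<exists>y<w. R x y" if x: "x < n" "y \<in> I" "R x y" for x y
  proof -
    have "y < X 0" using I_less x(2) by blast
    then have *: "R x (bt b' c' x)" "\<And>z. z < bt b' c' x \<Longrightarrow> \<not> R x z" using bc[OF x(1)] x(3) by blast+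
    then have "bt b' c' x \<le> y" using x(3) not_less by blast
    then show ?thesis using * w(2)[OF x(1)] down_I x(2) by blast
  qed
  then show ?thesis using w(1) by blast
qed

text \<open>Sigma_1 induction in the cut: bounding replaces the quantifier over the cut by one below
  a fixed \<open>w\<close>, and induction in the surrounding model applies.\<close>

lemma cut_induction:
  assumes R: "D1 (\<lambda>e. R (e 0) (e 1))" and zero: "\<exists>y\<in>I. R 0 y"
    and step: "\<And>x. x \<in> I \<Longrightarrow> \<exists>y\<in>I. R x y \<Longrightarrow> \<exists>y\<in>I. R (x + 1) y" and n: "n \<in> I"
  shows "\<exists>y\<in>I. R n y"
proof -
  obtain w where w: "w \<in> I" "\<And>x. x < n + 1 \<Longrightarrow> \<exists>y\<in>I. R x y \<Longrightarrow> \<exists>y<w. R x y"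
    using bounding_D1[OF R, of "n + 1"] n add_I one_I by blast
  have "x \<le> n \<longrightarrow> (\<exists>y<w. R x y)" for x
  proof (rule S1_induct[of "\<lambda>x. x \<le> n \<longrightarrow> (\<exists>y<w. R x y)"])
    show "S1 (\<lambda>e. e 0 \<le> n \<longrightarrow> (\<exists>y<w. R (e 0) y))"
      by (rule S1_D1, (rule D1_comp2[OF R] D1_rules F1_rules)+)
    show "0 \<le> n \<longrightarrow> (\<exists>y<w. R 0 y)" using w(2)[of 0] zero by simp
    fix x assume *: "x \<le> n \<longrightarrow> (\<exists>y<w. R x y)"
    show "x + 1 \<le> n \<longrightarrow> (\<exists>y<w. R (x + 1) y)"
    proof
      assume "x + 1 \<le> n"
      then have x: "x < n" by simp
      then obtain y where "y < w" "R x y" using * by (auto simp: less_imp_le)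
      then have "\<exists>y\<in>I. R (x + 1) y" using step[of x] less_I[OF n x] less_I[OF w(1)] by blast
      then show "\<exists>y<w. R (x + 1) y" using w(2)[of "x + 1"] x by simp
    qed
  qed
  then show ?thesis using less_I[OF w(1)] by blast
qed

text \<open>Delta_1 comprehension in the cut. The predicate \<open>?P\<close> is decidable in the
  surrounding model: it seeks a \<open>y\<close> with \<open>R x y\<close> such that
  \<open>R'\<close> has not failed up to \<open>y\<close>. If the \<open>y\<close> found lies beyond
  the cut, then \<open>R'\<close> holds throughout the cut, and \<open>eq\<close> supplies a witness
  inside.\<close>

lemma cut_comprehension:
  assumes R: "D1 (\<lambda>e. R (e 0) (e 1))" and R': "D1 (\<lambda>e. R' (e 0) (e 1))"
    and eq: "\<And>x. x \<in> I \<Longrightarrow> (\<exists>y\<in>I. R x y) \<longleftrightarrow> (\<forall>y\<in>I. R' x y)"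
  shows "\<exists>F. \<forall>x\<in>I. memc x F \<longleftrightarrow> (\<exists>y\<in>I. R x y)"
proof -
  let ?P = "\<lambda>x. \<exists>y<X 0. R x y \<and> (\<forall>z\<le>y. R' x z)"
  have D: "D1 (\<lambda>e. ?P (e 0))" by (rule D1_comp2[OF R] D1_comp2[OF R'] D1_rules F1_rules)+
  obtain F where F: "\<And>x. memc x F \<longleftrightarrow> x < X 0 \<and> ?P x" by (rule bounded_comprehension[of ?P "X 0", OF D]) blast
  have P: "?P x \<longleftrightarrow> (\<exists>y\<in>I. R x y)" if x: "x \<in> I" for x
  proof
    assume "\<exists>y\<in>I. R x y"
    then obtain y where "y \<in> I" "R x y" "\<And>z. z \<in> I \<Longrightarrow> R' x z" using eq[OF x] by blast
    then show "?P x" using I_less down_I by blast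
  next
    assume "?P x"
    then obtain y where y: "R x y" "\<And>z. z \<le> y \<Longrightarrow> R' x z" by blast
    show "\<exists>y\<in>I. R x y"
    proof (cases "y \<in> I")
      case False
      then have "\<forall>z\<in>I. R' x z" using y(2) I_less_out less_imp_le by blast
      then show ?thesis using eq[OF x] by blast
    qed (use y in blast)
  qed
  show ?thesis
  proof (intro exI ballI)
    fix x assume "x \<in> I"
    then show "memc x F \<longleftrightarrow> (\<exists>y\<in>I. R x y)" unfolding F P[symmetric, OF \<open>x \<in> I\<close>] using I_less by simp
  qed
qed

text \<open>The bounding scheme for \<open>\<exists>w \<forall>z R x y w z\<close>: colour \<open>t\<close> by an \<open>x < u\<close> for which the least bound on a pair
  \<open>y, w\<close> that works for all \<open>z \<le> t\<close> is largest.\<close>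

lemma cut_bounding:
  assumes R: "D1 (\<lambda>e. R (e 0) (e 1) (e 2) (e 3))" and u: "u \<in> I"
    and ex: "\<And>x. x < u \<Longrightarrow> \<exists>y\<in>I. \<exists>w\<in>I. \<forall>z\<in>I. R x y w z"
  shows "\<exists>v\<in>I. \<forall>x<u. \<exists>y<v. \<exists>w\<in>I. \<forall>z\<in>I. R x y w z"
proof (cases "u = 0")
  case True
  then show ?thesis by (intro bexI[OF _ zero_I]) simp
next
  case False
  let ?A = "\<lambda>t x q. \<exists>y\<le>q. \<exists>w\<le>q. \<forall>z\<le>t. R x y w z"
  have A: "D1 (\<lambda>e. ?A (e 0) (e 1) (e 2))" by (rule D1_comp4[OF R] D1_rules F1_rules)+
  have A_mono: "?A t x q \<Longrightarrow> q \<le> q' \<Longrightarrow> ?A t x q'" for t x q q' using order_trans by blast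
  \<comment> \<open>\<open>x\<close> is a hardest argument at \<open>t\<close>: any bound up to
    \<open>t\<close> that works for it works for all others.\<close>
  let ?S = "\<lambda>t x. \<forall>x'<u. \<forall>q\<le>t. ?A t x q \<longrightarrow> ?A t x' q"
  have S: "S1 (\<lambda>e. ?S (e 0) (e 1))" by (rule S1_D1, (rule D1_comp4[OF R] D1_rules F1_rules)+)
  have "\<exists>x<u. ?S t x" for t
  proof -
    have D: "D1 (\<lambda>e. e 0 = t + 1 \<or> (\<forall>x'<u. ?A t x' (e 0)))" by (rule D1_comp4[OF R] D1_rules F1_rules)+
    \<comment> \<open>\<open>q\<close> is the least bound that works for all arguments, with
      \<open>t + 1\<close> as default. Its predecessor fails for some \<open>x\<close>, so that
      \<open>x\<close> needs a bound of at least \<open>q\<close>.\<close>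
    obtain q where q: "q = t + 1 \<or> (\<forall>x'<u. ?A t x' q)" "\<And>z. z < q \<Longrightarrow> \<not> (z = t + 1 \<or> (\<forall>x'<u. ?A t x' z))"
      by (rule least_element[of "\<lambda>q. q = t + 1 \<or> (\<forall>x'<u. ?A t x' q)" "t + 1", OF D]) blast+
    show ?thesis
    proof (cases q rule: peano_cases)
      case 1
      have "0 < u" using False by simp
      moreover have "?A t x' q'" if "x' < u" for x' q'
      proof (rule A_mono)
        show "?A t x' 0" using q(1) that unfolding 1 by (metis add1_neq_0)
      qed simp
      ultimately show ?thesis by blast
    next
      case (2 p)
      then obtain x where x: "x < u" "\<not> ?A t x p" using q(2)[of p] by auto
      have "?A t x' q'" if "x' < u" "q' \<le> t" "?A t x q'" for x' q'
      proof -
        have "\<not> q' \<le> p" using x(2) A_mono[OF that(3)] by blast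
        then have "q \<le> q'" using 2 by (simp add: not_le)
        moreover have "q \<noteq> t + 1" using calculation that(2) by auto
        ultimately show ?thesis using q(1) that(1) A_mono by blast
      qed
      then show ?thesis using x(1) by blast
    qed
  qed
  from regularity[of ?S, OF S u this] obtain x0 where x0: "x0 < u" "\<And>x. x \<in> I \<Longrightarrow> \<exists>t\<in>I. x \<le> t \<and> ?S t x0" by blast
  obtain y0 w0 where yw: "y0 \<in> I" "w0 \<in> I" "\<And>z. z \<in> I \<Longrightarrow> R x0 y0 w0 z" using ex[OF x0(1)] by blast
  define q where "q = max y0 w0"
  have qI: "q \<in> I" and "y0 \<le> q" "w0 \<le> q" using yw by (auto simp: q_def max_def)
  then have A0: "?A t x0 q" if "t \<in> I" for t using yw(3) down_I[OF that] by blast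
  have all: "\<forall>x'<u. ?A t x' q" if t: "t \<in> I" for t
  proof -
    have "max t q \<in> I" using t qI by (simp add: max_def)
    then obtain t' where t': "t' \<in> I" "max t q \<le> t'" "?S t' x0" using x0(2) by blast
    then have "t \<le> t'" "q \<le> t'" by simp_all
    have "?A t x' q" if "x' < u" for x'
    proof -
      have "?A t' x' q" using t'(3)[rule_format, OF that \<open>q \<le> t'\<close> A0[OF t'(1)]] .
      then show ?thesis using order_trans[OF _ \<open>t \<le> t'\<close>] by blast
    qed
    then show ?thesis by blast
  qed
  have D: "D1 (\<lambda>e. \<forall>x'<u. ?A (e 0) x' q)" by (rule D1_comp4[OF R] D1_rules F1_rules)+
  \<comment> \<open>For \<open>t\<close> in the cut the witnesses \<open>y, w\<close> may vary with
    \<open>t\<close>. At a \<open>t\<close> beyond the cut, one choice works for all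
    \<open>z\<close> in the cut.\<close>
  obtain t where "t \<notin> I \<and> (\<forall>x'<u. ?A t x' q)" using overspill[of "\<lambda>t. \<forall>x'<u. ?A t x' q", OF D all] ..
  then have t: "t \<notin> I" "\<forall>x'<u. ?A t x' q" by (rule conjunct1, rule conjunct2)
  have "\<exists>y<q + 1. \<exists>w\<in>I. \<forall>z\<in>I. R x y w z" if x: "x < u" for x
  proof -
    obtain y w where yw: "y \<le> q" "w \<le> q" "\<And>z. z \<le> t \<Longrightarrow> R x y w z" using t(2) x by blast
    have "\<forall>z\<in>I. R x y w z" using yw(3) I_less_out[OF _ t(1)] less_imp_le by blast
    moreover have "w \<in> I" "y < q + 1" using yw(1,2) down_I[OF qI] by auto
    ultimately show ?thesis by blast
  qed
  then show ?thesis using add_I[OF qI one_I] by blast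
qed

text \<open>By overspill there is a string of a length beyond the cut all of whose initial segments
  below \<open>X 0\<close> belong to \<open>F\<close>. Its code serves directly as the path.\<close>

lemma cut_weak_Koenig:
  assumes max: "\<And>x. x \<in> I \<Longrightarrow> memc x F \<Longrightarrow> \<exists>l. isMax l x"
    and closed: "\<And>s t. s \<in> I \<Longrightarrow> t \<in> I \<Longrightarrow> memc s F \<Longrightarrow> iseg t s \<Longrightarrow> memc t F"
    and inf: "\<And>x. x \<in> I \<Longrightarrow> \<exists>y\<in>I. x < y \<and> memc y F"
  shows "\<exists>P. \<forall>l\<in>I. \<exists>t\<in>I. memc t F \<and> isMax l t \<and> (\<forall>i<l. memc i t \<longleftrightarrow> memc i P)"
proof -
  have p2': "p2 (l + 1) \<in> I" if "l \<in> I" for l using that p2_I add_I one_I by blast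
  \<comment> \<open>Closure under initial segments is part of the predicate, because outside the cut
    \<open>F\<close> need not be a tree.\<close>
  let ?Q = "\<lambda>l. \<exists>s<X 0. memc s F \<and> isMax l s \<and> (\<forall>t<X 0. iseg t s \<longrightarrow> memc t F)"
  have Q: "D1 (\<lambda>e. ?Q (e 0))" by (rule D1_rules F1_rules)+
  have "?Q l" if l: "l \<in> I" for l
  proof -
    obtain s' where s': "s' \<in> I" "p2 (l + 1) < s'" "memc s' F" using inf[OF p2'[OF l]] by blast
    obtain l' where l': "isMax l' s'" using max s' by blast
    \<comment> \<open>A string shorter than \<open>l\<close> has a code below
      \<open>p2 (l + 1)\<close>, whereas \<open>s'\<close> was chosen above this number.\<close>
    have "l \<le> l'"
    proof (rule ccontr)
      assume "\<not> l \<le> l'"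
      then have "i < l + 1" if "memc i s'" for i
        using that l' unfolding isMax_def by (meson less_add1_iff less_imp_le not_le order_trans)
      then have "s' < p2 (l + 1)" by (rule code_less_p2)
      then show False using s'(2) by simp
    qed
    obtain s where s: "s < p2 (l + 1)" "\<And>i. memc i s \<longleftrightarrow> i < l \<and> memc i s' \<or> i = l" "isMax l s"
      using truncated_code[of l s'] by blast
    have "s \<in> I" using less_I[OF p2'[OF l] s(1)] .
    have "iseg s s'" unfolding iseg_def using s l' \<open>l \<le> l'\<close> by blast
    then have "memc s F" using closed s'(1,3) \<open>s \<in> I\<close> by blast
    moreover have "memc t F" if ts: "iseg t s" for t
    proof -
      obtain k where k: "isMax k t" "k \<le> l" "\<And>i. i < k \<Longrightarrow> memc i t \<longleftrightarrow> memc i s"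
        using ts s(3) isMax_unique unfolding iseg_def by metis
      have "i < l + 1" if "memc i t" for i using that k(1,2) unfolding isMax_def less_add1_iff by (meson order_trans)
      then have "t < p2 (l + 1)" by (rule code_less_p2)
      then have "t \<in> I" using less_I[OF p2'[OF l]] by blast
      moreover have "memc i t \<longleftrightarrow> memc i s'" if "i < k" for i
        using k(2,3) s(2)[of i] that by auto
      then have "iseg t s'" unfolding iseg_def using k(1,2) l' \<open>l \<le> l'\<close> order_trans by blast
      ultimately show ?thesis using closed s'(1,3) by blast
    qed
    ultimately show ?thesis using s(3) I_less[OF \<open>s \<in> I\<close>] by blast
  qed
  from overspill[of ?Q, OF Q this] obtain l s where ls: "l \<notin> I" "isMax l s" "\<And>t. t < X 0 \<Longrightarrow> iseg t s \<Longrightarrow> memc t F" by blast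
  have "\<exists>t\<in>I. memc t F \<and> isMax k t \<and> (\<forall>i<k. memc i t \<longleftrightarrow> memc i s)" if k: "k \<in> I" for k
  proof -
    obtain t where t: "t < p2 (k + 1)" "\<And>i. memc i t \<longleftrightarrow> i < k \<and> memc i s \<or> i = k" "isMax k t"
      using truncated_code[of k s] by blast
    have "t \<in> I" using less_I[OF p2'[OF k] t(1)] .
    have *: "memc i t \<longleftrightarrow> memc i s" if "i < k" for i using t(2)[of i] that by auto
    have "k \<le> l" using I_less_out[OF k ls(1)] by simp
    then have "iseg t s" unfolding iseg_def using t(3) ls(2) * by blast
    then show ?thesis using ls(3) I_less[OF \<open>t \<in> I\<close>] \<open>t \<in> I\<close> t(3) * by blast
  qed
  then show ?thesis by blast
qed

text \<open>The maximum of each set of the descent lies above the whole cut, so a witness for all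
  \<open>z\<close> below it works for all \<open>z\<close> in the cut.\<close>

lemma cut_T: "x \<in> I \<Longrightarrow> \<exists>y\<in>I. \<forall>z\<in>I. T x y z"
proof -
  assume "x \<in> I"
  then obtain n where "x < m n" using I_D by blast
  then obtain y where y: "y < m (Suc n)" "\<And>z. z < M (Suc n) \<Longrightarrow> T x y z" using witness by blast
  have "z < M (Suc n)" if z: "z \<in> I" for z
  proof -
    obtain r where "r \<ge> Suc n" "z < m r" using I_D[OF z] by blast
    then show ?thesis using m_mem[of "Suc n" r] isMax_X[of "Suc n"] unfolding isMax_def by (meson less_le_trans)
  qed
  then show ?thesis using y less_I m_I by blast
qed

end

section \<open>Strings, trees and paths read in a cut\<close>

context exp_cut
begin

lemma sat_initial_segment [simp]:
  assumes e: "inI I e"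
  shows "sat (cmodel I S A) (initial_segment t s) e \<sigma> \<longleftrightarrow> iseg (tval (cmodel I S A) e t) (tval (cmodel I S A) e s)"
proof -
  let ?v = "tval (cmodel I S A) e"
  have "sat (cmodel I S A) (initial_segment t s) e \<sigma> \<longleftrightarrow>
    (\<exists>l\<in>I. \<exists>k\<in>I. isMax l (?v t) \<and> isMax k (?v s) \<and> l \<le> k \<and> (\<forall>i\<in>I. i < l \<longrightarrow> (memc i (?v t) \<longleftrightarrow> memc i (?v s))))"
    unfolding initial_segment_def using e by (simp add: numeral_eq_Suc le_def iff_conv_conj_imp cong: ball_cong bex_cong)
  also have "\<dots> \<longleftrightarrow> iseg (?v t) (?v s)"
  proof
    assume "\<exists>l\<in>I. \<exists>k\<in>I. isMax l (?v t) \<and> isMax k (?v s) \<and> l \<le> k \<and> (\<forall>i\<in>I. i < l \<longrightarrow> (memc i (?v t) \<longleftrightarrow> memc i (?v s)))"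
    then obtain l k where lk: "l \<in> I" "isMax l (?v t)" "isMax k (?v s)" "l \<le> k"
      "\<And>i. i \<in> I \<Longrightarrow> i < l \<Longrightarrow> memc i (?v t) \<longleftrightarrow> memc i (?v s)" by blast
    have "memc i (?v t) \<longleftrightarrow> memc i (?v s)" if "i < l" for i using lk(5)[OF less_I[OF lk(1) that] that] .
    then show "iseg (?v t) (?v s)" using lk(2-4) unfolding iseg_def by blast
  next
    assume "iseg (?v t) (?v s)"
    then obtain l k where lk: "isMax l (?v t)" "isMax k (?v s)" "l \<le> k"
      "\<And>i. i < l \<Longrightarrow> memc i (?v t) \<longleftrightarrow> memc i (?v s)" unfolding iseg_def by blast
    have "l \<in> I" "k \<in> I" using lk(1,2) memc_I[OF tval_I[OF e]] unfolding isMax_def by blast+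
    then show "\<exists>l\<in>I. \<exists>k\<in>I. isMax l (?v t) \<and> isMax k (?v s) \<and> l \<le> k \<and> (\<forall>i\<in>I. i < l \<longrightarrow> (memc i (?v t) \<longleftrightarrow> memc i (?v s)))"
      using lk by blast
  qed
  finally show ?thesis .
qed

lemma sat_binary_tree: "inI I e \<Longrightarrow> sat (cmodel I S A) (binary_tree X) e \<sigma> \<longleftrightarrow>
    (\<forall>x\<in>I. x \<in> sval (cmodel I S A) \<sigma> X \<longrightarrow> (\<exists>l\<in>I. isMax l x)) \<and>
    (\<forall>s\<in>I. \<forall>t\<in>I. s \<in> sval (cmodel I S A) \<sigma> X \<and> iseg t s \<longrightarrow> t \<in> sval (cmodel I S A) \<sigma> X)"
  unfolding binary_tree_def by (simp cong: ball_cong bex_cong) blast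

lemma sat_path_through: "inI I e \<Longrightarrow> sat (cmodel I S A) (path_through P X) e \<sigma> \<longleftrightarrow>
    (\<forall>l\<in>I. \<exists>t\<in>I. isMax l t \<and> t \<in> sval (cmodel I S A) \<sigma> X \<and>
       (\<forall>i\<in>I. i < l \<longrightarrow> (memc i t \<longrightarrow> i \<in> sval (cmodel I S A) \<sigma> P) \<and>
         (i \<in> sval (cmodel I S A) \<sigma> P \<longrightarrow> memc i t)))"
  unfolding path_through_def by (simp cong: ball_cong bex_cong)

end

lemma sat_infinite_set: "sat (cmodel I S A) (infinite_set X) e \<sigma> \<longleftrightarrow>
    (\<forall>x\<in>I. \<exists>y\<in>I. x < y \<and> y \<in> sval (cmodel I S A) \<sigma> X)"
  unfolding infinite_set_def by (simp cong: ball_cong bex_cong)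

section \<open>The cut with the traces of coded sets as a model of WKL_0 and B Sigma_2\<close>

context descent
begin

definition Cod :: "'a set set" where
  "Cod = range (\<lambda>F. elts F \<inter> I)"

abbreviation CM :: "'a model" where
  "CM \<equiv> cmodel I Cod (Aset \<inter> I)"

lemma elts_Cod: "elts F \<inter> I \<in> Cod"
  by (simp add: Cod_def)

lemma Aset_Cod: "Aset \<inter> I \<in> Cod"
proof -
  have D: "D1 (\<lambda>e::nat \<Rightarrow> 'a. e 0 \<in> Aset)" by (rule D1_rules F1_rules)+
  obtain F where "\<And>x. memc x F \<longleftrightarrow> x < X 0 \<and> x \<in> Aset"
    by (rule bounded_comprehension[of "\<lambda>x. x \<in> Aset" "X 0", OF D]) blast
  then have "elts F \<inter> I = Aset \<inter> I" using I_less by auto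
  then show ?thesis using elts_Cod by metis
qed

lemma wf_CM: "wf_model CM"
  by (simp add: wf_model_def Aset_Cod add_I mul_I)

lemma envs_CM:
  assumes "envs CM e s" obtains F where "inI I e" "s = (\<lambda>i. elts (F i) \<inter> I)"
proof -
  have "\<forall>i. \<exists>F. s i = elts F \<inter> I" using assms by (auto simp: envs_def Cod_def image_iff)
  then obtain F where "\<forall>i. s i = elts (F i) \<inter> I" using choice[of "\<lambda>i F. s i = elts F \<inter> I"] by blast
  then have "s = (\<lambda>i. elts (F i) \<inter> I)" by auto
  moreover have "inI I e" using assms by (simp add: envs_def inI_def)
  ultimately show thesis using that by blast
qed

lemmas absolute = Sigma00_absolute[where s = "\<lambda>i. elts (F i)" for F :: "nat \<Rightarrow> 'a"]

lemma D1_sat_elts: "Sigma00 \<phi> \<Longrightarrow> (\<And>i. F1 (\<lambda>e. \<sigma> e i)) \<Longrightarrow> D1 (\<lambda>e. sat smodel \<phi> (\<sigma> e) (\<lambda>i. elts (F i)))"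
  by (rule sat_Sigma00_D1) (auto intro: D1_elts[simplified])

lemma F1_econs: "F1 f \<Longrightarrow> (\<And>i. F1 (\<lambda>e. \<sigma> e i)) \<Longrightarrow> F1 (\<lambda>e. (f e ## \<sigma> e) i)"
  by (cases i) simp_all

lemmas F1_env = F1_econs F1_var F1_const

lemma good_CM: "good CM"
  unfolding good_iff
proof (intro conjI wf_CM)
  show "\<forall>\<phi>\<in>basic_axioms. valid CM \<phi>"
    unfolding valid_basic_axioms[OF wf_CM] by (auto simp: add.assoc distrib_left less_add1)
  show "\<forall>\<phi>. Sigma01 \<phi> \<longrightarrow> valid CM (induction_axiom \<phi>)"
    unfolding valid_induction_axiom
  proof (intro allI impI ballI)
    fix \<phi> e s x
    assume "Sigma01 \<phi>" and e: "envs CM e s" and zero: "sat CM \<phi> (zro CM ## e) s"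
      and step: "\<forall>x\<in>Num CM. sat CM \<phi> (x ## e) s \<longrightarrow> sat CM \<phi> (pls CM x (uno CM) ## e) s" and x: "x \<in> Num CM"
    obtain \<theta> where \<theta>: "Sigma00 \<theta>" "\<phi> = Exists \<theta>" using \<open>Sigma01 \<phi>\<close> unfolding Sigma01_def by blast
    obtain F where F: "inI I e" "s = (\<lambda>i. elts (F i) \<inter> I)" by (rule envs_CM[OF e])
    define R where "R x y = sat smodel \<theta> (y ## x ## e) (\<lambda>i. elts (F i))" for x y
    have R: "D1 (\<lambda>e. R (e 0) (e 1))"
      unfolding R_def by (rule D1_sat_elts[OF \<theta>(1)], (rule F1_env)+)
    have sat: "sat CM \<phi> (z ## e) s \<longleftrightarrow> (\<exists>y\<in>I. R z y)" if "z \<in> I" for z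
      unfolding \<theta>(2) F(2) R_def using absolute[OF \<theta>(1)] F(1) that by simp
    have "\<exists>y\<in>I. R x y"
      by (rule cut_induction[OF R]) (use zero step x sat add_I one_I in auto)
    then show "sat CM \<phi> (x ## e) s" using sat x by simp
  qed
qed

lemma valid_comprehension:
  assumes "Sigma01 \<phi>" "Pi01 \<psi>" shows "valid CM (comprehension_axiom \<phi> \<psi>)"
  unfolding valid_def
proof (intro allI impI)
  fix e s assume "envs CM e s"
  then obtain F where F: "inI I e" "s = (\<lambda>i. elts (F i) \<inter> I)" by (rule envs_CM)
  obtain \<theta> \<eta> where \<theta>: "Sigma00 \<theta>" "\<phi> = Exists \<theta>" and \<eta>: "Sigma00 \<eta>" "\<psi> = Forall \<eta>"
    using assms unfolding Sigma01_def Pi01_def by blast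
  define R where "R x y = sat smodel \<theta> (y ## x ## e) (\<lambda>i. elts (F i))" for x y
  define R' where "R' x y = sat smodel \<eta> (y ## x ## e) (\<lambda>i. elts (F i))" for x y
  have R: "D1 (\<lambda>e. R (e 0) (e 1))" unfolding R_def by (rule D1_sat_elts[OF \<theta>(1)], (rule F1_env)+)
  have R': "D1 (\<lambda>e. R' (e 0) (e 1))" unfolding R'_def by (rule D1_sat_elts[OF \<eta>(1)], (rule F1_env)+)
  have sat: "sat CM \<phi> (z ## e) s \<longleftrightarrow> (\<exists>y\<in>I. R z y)" if "z \<in> I" for z
    unfolding \<theta>(2) F(2) R_def using absolute[OF \<theta>(1)] F(1) that by simp
  have sat': "sat CM \<psi> (z ## e) s \<longleftrightarrow> (\<forall>y\<in>I. R' z y)" if "z \<in> I" for z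
    unfolding \<eta>(2) F(2) R'_def using absolute[OF \<eta>(1)] F(1) that by simp
  have ex: "\<exists>Y\<in>Cod. \<forall>x\<in>I. x \<in> Y \<longleftrightarrow> sat CM \<phi> (x ## e) s" if eq: "\<forall>x\<in>I. sat CM \<phi> (x ## e) s \<longleftrightarrow> sat CM \<psi> (x ## e) s"
  proof -
    have "(\<exists>y\<in>I. R x y) \<longleftrightarrow> (\<forall>y\<in>I. R' x y)" if "x \<in> I" for x
      using eq sat sat' that by blast
    from cut_comprehension[OF R R' this] obtain G where "\<forall>x\<in>I. memc x G \<longleftrightarrow> (\<exists>y\<in>I. R x y)" ..
    then show ?thesis using sat by (intro bexI[OF _ elts_Cod[of G]]) auto
  qed
  show "sat CM (comprehension_axiom \<phi> \<psi>) e s"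
    unfolding comprehension_axiom_def using ex by (simp add: iff_conv_conj_imp cong: ball_cong bex_cong)
qed

lemma valid_bounding:
  assumes "Sigma02 \<phi>" shows "valid CM (bounding_axiom \<phi>)"
  unfolding valid_def
proof (intro allI impI)
  fix e s assume "envs CM e s"
  then obtain F where F: "inI I e" "s = (\<lambda>i. elts (F i) \<inter> I)" by (rule envs_CM)
  obtain \<theta> where \<theta>: "Sigma00 \<theta>" "\<phi> = Exists (Forall \<theta>)" using assms unfolding Sigma02_def by blast
  define R where "R x y w z = sat smodel \<theta> (z ## w ## y ## x ## e) (\<lambda>i. elts (F i))" for x y w z
  have R: "D1 (\<lambda>e. R (e 0) (e 1) (e 2) (e 3))"
    unfolding R_def by (rule D1_sat_elts[OF \<theta>(1)], (rule F1_env)+)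
  have sat: "sat CM \<phi> (y ## x ## e) s \<longleftrightarrow> (\<exists>w\<in>I. \<forall>z\<in>I. R x y w z)" if "x \<in> I" "y \<in> I" for x y
    unfolding \<theta>(2) F(2) R_def using absolute[OF \<theta>(1)] F(1) that by simp
  have "(\<lambda>i. tval CM (y ## x ## v ## e) (if i < 2 then NVar i else NVar (Suc i))) = y ## x ## e" for v x y
    by (auto split: nat.splits simp: numeral_eq_Suc)
  then have sat': "sat CM (fsub (\<lambda>i. if i < 2 then NVar i else NVar (Suc i)) SVar \<phi>) (y ## x ## v ## e) s \<longleftrightarrow>
     sat CM \<phi> (y ## x ## e) s" for v x y
    unfolding sat_fsub by simp
  show "sat CM (bounding_axiom \<phi>) e s"
    unfolding bounding_axiom_def
  proof (simp add: sat', intro impI)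
    assume "\<forall>x\<in>I. x < e 0 \<longrightarrow> (\<exists>y\<in>I. sat CM \<phi> (y ## x ## e) s)"
    then have ex: "\<exists>y\<in>I. \<exists>w\<in>I. \<forall>z\<in>I. R x y w z" if "x < e 0" for x
      using sat less_I[of "e 0" x] F(1) that by auto
    have "e 0 \<in> I" using F(1) by simp
    then obtain v where v: "v \<in> I" "\<And>x. x < e 0 \<Longrightarrow> \<exists>y<v. \<exists>w\<in>I. \<forall>z\<in>I. R x y w z"
      using cut_bounding[OF R _ ex] by blast
    show "\<exists>v\<in>I. \<forall>x\<in>I. x < e 0 \<longrightarrow> (\<exists>y\<in>I. y < v \<and> sat CM \<phi> (y ## x ## e) s)"
      using v sat less_I[OF v(1)] by (intro bexI[OF _ v(1)]) blast
  qed
qed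

text \<open>Exponentiation is total in the cut as a model in its own right, so the codes of
  computations are found inside it.\<close>

lemma exp_cut_I: assumes "pow_total CM" shows "exp_cut I"
proof unfold_locales
  fix s t assume st: "s \<in> I" "t \<in> I"
  have "envs CM (s ## t ## (\<lambda>_. 0)) (\<lambda>_. Aset \<inter> I)"
    using st zero_I Aset_Cod by (auto simp: envs_def split: nat.splits)
  then have "sat CM (Exists (power_eq (NVar 1) (NVar 2) (NVar 0))) (s ## t ## (\<lambda>_. 0)) (\<lambda>_. Aset \<inter> I)"
    using assms unfolding pow_total_def valid_def by blast
  moreover have "inI I (\<lambda>_. 0)" by (simp add: inI_def)
  ultimately show "\<exists>b\<in>I. \<exists>c\<in>I. pow_seq s t b c"
    using st by (auto simp: sat_power_eq_seq numeral_eq_Suc cong: bex_cong)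
qed

lemma valid_weak_Koenig: assumes "exp_cut I" shows "valid CM weak_Koenig"
  unfolding valid_def
proof (intro allI impI)
  interpret E: exp_cut I by (rule assms)
  fix e s assume "envs CM e s"
  then have e: "inI I e" by (rule envs_CM)
  have "\<exists>P\<in>Cod. sat CM (path_through (SVar 0) (SVar 1)) e (P ## Y ## s)"
    if Y: "Y \<in> Cod" and t: "sat CM (binary_tree (SVar 0)) e (Y ## s)" and i: "sat CM (infinite_set (SVar 0)) e (Y ## s)" for Y
  proof -
    obtain F where F: "Y = elts F \<inter> I" using Y unfolding Cod_def by blast
    have tree: "\<forall>x\<in>I. x \<in> Y \<longrightarrow> (\<exists>l\<in>I. isMax l x)" "\<forall>s\<in>I. \<forall>t\<in>I. s \<in> Y \<and> iseg t s \<longrightarrow> t \<in> Y"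
      using t unfolding E.sat_binary_tree[OF e] sval.simps nat.case by (rule conjunct1, rule conjunct2)
    have inf: "\<forall>x\<in>I. \<exists>y\<in>I. x < y \<and> y \<in> Y" using i unfolding sat_infinite_set sval.simps nat.case .
    have YF: "x \<in> Y \<longleftrightarrow> memc x F" if "x \<in> I" for x using that F by simp
    have "\<exists>P. \<forall>l\<in>I. \<exists>t\<in>I. memc t F \<and> isMax l t \<and> (\<forall>i<l. memc i t \<longleftrightarrow> memc i P)"
    proof (rule cut_weak_Koenig)
      show "\<exists>l. isMax l x" if "x \<in> I" "memc x F" for x using tree(1) YF that by blast
      show "memc t F" if "s \<in> I" "t \<in> I" "memc s F" "iseg t s" for s t using tree(2) YF that by blast
      show "\<exists>y\<in>I. x < y \<and> memc y F" if "x \<in> I" for x using inf YF that by blast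
    qed
    then obtain P where "\<forall>l\<in>I. \<exists>t\<in>I. memc t F \<and> isMax l t \<and> (\<forall>i<l. memc i t \<longleftrightarrow> memc i P)" ..
    then show ?thesis
      by (intro bexI[OF _ elts_Cod[of P]]) (simp add: E.sat_path_through[OF e] F, blast)
  qed
  then show "sat CM weak_Koenig e s" unfolding weak_Koenig_def by (auto simp del: One_nat_def)
qed

end

text \<open>With exponent 0 only the convention on the minimum and nonemptiness remain. Larger
  exponents are needed to build the descent, not to analyse the cut.\<close>

definition start_fm :: "fm \<Rightarrow> fm" where
  "start_fm \<theta> = (Forall (NVar 0 \<^bold>\<in>\<^sub>c NVar 1 \<^bold>\<longrightarrow> NVar 2 \<^bold>< NVar 0) \<^bold>\<and>
     omega_power_large \<theta> 0 (NVar 0) \<^bold>\<and> exp_sparse (NVar 0))"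

definition concl_fm :: "fm \<Rightarrow> fm" where
  "concl_fm \<psi> = Exists (NVar 0 \<^bold>\<subseteq>\<^sub>c NVar 1 \<^bold>\<and>
     Exists (is_max (NVar 0) (NVar 2) \<^bold>\<and> BExists (NVar 0) (inst3 \<psi> (NVar 4) (NVar 0) (NVar 2))))"

text \<open>The sequences \<open>X\<close>, \<open>b\<close>, \<open>c\<close> are external, but
  every condition on the model is expressed by satisfaction of formulas or equality of elements, so
  an isomorphism preserves the property.\<close>

definition cut_property :: "'a model \<Rightarrow> bool" where
  "cut_property M \<longleftrightarrow> (\<forall>\<theta> \<psi> X b c e s. Sigma00 \<theta> \<longrightarrow> fm_below 3 0 \<theta> \<longrightarrow> Sigma0 \<psi> \<longrightarrow> fm_below 3 0 \<psi> \<longrightarrow>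
     (WKL0 \<union> BSigma02 \<union> {T_sentence \<theta>} \<turnstile> infinite_sentence \<psi>) \<longrightarrow> envs M e s \<longrightarrow>
     (\<forall>n::nat. X n \<in> Num M \<and> b n \<in> Num M \<and> c n \<in> Num M) \<longrightarrow>
     (\<forall>n. sat M (shrink_fm \<theta>) (X (Suc n) ## X n ## b n ## c n ## X 0 ## e) s) \<longrightarrow>
     (\<forall>b'\<in>Num M. \<forall>c'\<in>Num M. \<forall>k. \<exists>n\<ge>k. b n = b' \<and> c n = c') \<longrightarrow>
     sat M (start_fm \<theta>) (X 0 ## e) s \<longrightarrow> sat M (concl_fm \<psi>) (X 0 ## e) s)"

text \<open>The cut is a model on the type \<open>'a\<close>, whereas \<open>pow\<close> speaks of
  models on terms. The injection \<open>f\<close> copies the cut to terms, where exponentiation is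
  known to be total.\<close>

theorem cut_property_smodel:
  fixes f :: "'a::peano \<Rightarrow> tm"
  assumes f: "inj f" and pow: "\<And>M :: tm model. good M \<Longrightarrow> pow_total M"
  shows "cut_property (smodel :: 'a model)"
  unfolding cut_property_def
proof (intro allI impI)
  fix \<theta> \<psi> and X b c :: "nat \<Rightarrow> 'a" and e :: "nat \<Rightarrow> 'a" and s
  assume \<theta>: "Sigma00 \<theta>" "fm_below 3 0 \<theta>" and \<psi>: "Sigma0 \<psi>" "fm_below 3 0 \<psi>"
    and proves: "WKL0 \<union> BSigma02 \<union> {T_sentence \<theta>} \<turnstile> infinite_sentence \<psi>"
    and shrink: "\<forall>n. sat smodel (shrink_fm \<theta>) (X (Suc n) ## X n ## b n ## c n ## X 0 ## e) s"
    and rec: "\<forall>b'\<in>Num smodel. \<forall>c'\<in>Num smodel. \<forall>k. \<exists>n\<ge>k. b n = b' \<and> c n = c'"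
    and start: "sat smodel (start_fm \<theta>) (X 0 ## e) s"
  interpret U: exp_cut "UNIV :: 'a set" by (rule exp_cut_UNIV)
  interpret ternary "trel \<theta> :: 'a \<Rightarrow> _" by (rule ternary_trel[OF \<theta>])
  have sh: "sub (X (Suc n)) (X n) \<and>
    (\<exists>m m' M'. isMin m (X n) \<and> isMin m' (X (Suc n)) \<and> isMax M' (X (Suc n)) \<and> m < m' \<and>
      (\<forall>x<m. \<exists>y<m'. \<forall>z<M'. trel \<theta> x y z) \<and>
      ((\<exists>x. memc x (X n) \<and> m \<le> bt (b n) (c n) x) \<or> (\<exists>u. \<forall>x. memc x (X (Suc n)) \<longrightarrow> u = bt (b n) (c n) x)))" for n
    using shrink[rule_format, of n] unfolding sat_shrink_fm[OF \<theta>] by (simp add: numeral_eq_Suc)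
  have "\<forall>n. \<exists>m. isMin m (X n)" using sh by blast
  then obtain m where m: "\<And>n. isMin (m n) (X n)" by metis
  have "\<forall>n. \<exists>M. isMax M (X n)" using m isMax_exists unfolding isMin_def by blast
  then obtain M where M: "\<And>n. isMax (M n) (X n)" by metis
  have start': "\<And>x. memc x (X 0) \<Longrightarrow> e 0 < x" "\<exists>k. isMin k (X 0) \<and> 3 \<le> k \<and> acst \<le> k" "expsp (X 0)"
  proof -
    have "sat smodel (start_fm \<theta>) (X 0 ## e) s \<longleftrightarrow> (\<forall>x. memc x (X 0) \<longrightarrow> e 0 < x) \<and>
        sat smodel (omega_power_large \<theta> 0 (NVar 0)) (X 0 ## e) s \<and> expsp (X 0)"
      unfolding start_fm_def smodel_cmodel by (simp add: numeral_eq_Suc)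
    then show "\<And>x. memc x (X 0) \<Longrightarrow> e 0 < x" "\<exists>k. isMin k (X 0) \<and> 3 \<le> k \<and> acst \<le> k" "expsp (X 0)"
      using start unfolding sat_omega_power_large[OF \<theta>] by auto
  qed
  interpret descent "trel \<theta>" X b c m M
  proof
    fix n
    obtain k m' M' where k: "isMin k (X n)" "isMin m' (X (Suc n))" "isMax M' (X (Suc n))" "k < m'"
      "\<forall>x<k. \<exists>y<m'. \<forall>z<M'. trel \<theta> x y z"
      "(\<exists>x. memc x (X n) \<and> k \<le> bt (b n) (c n) x) \<or> (\<exists>u. \<forall>x. memc x (X (Suc n)) \<longrightarrow> u = bt (b n) (c n) x)"
      using sh[of n] by blast
    have eq: "m n = k" "m (Suc n) = m'" "M (Suc n) = M'"
      using isMin_unique m k(1,2) isMax_unique M k(3) by blast+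
    show "isMin (m n) (X n)" "isMax (M n) (X n)" by (rule m, rule M)
    show "sub (X (Suc n)) (X n)" using sh by blast
    show "m n < m (Suc n)" using k(4) eq by simp
    show "\<exists>y<m (Suc n). \<forall>z<M (Suc n). trel \<theta> x y z" if "x < m n" for x using k(5) eq that by simp
    show "(\<exists>x. memc x (X n) \<and> m n \<le> bt (b n) (c n) x) \<or> (\<exists>u. \<forall>x. memc x (X (Suc n)) \<longrightarrow> u = bt (b n) (c n) x)"
      using k(6) eq by simp
  next
    fix k b' c' show "\<exists>n\<ge>k. b n = b' \<and> c n = c'" using rec by (auto simp: smodel_def)
  qed (use start' m isMin_unique in blast)+
  have iso: "iso f CM (image_model f CM)" by (rule iso_image_model[OF f wf_CM])
  have "pow_total (image_model f CM)" using pow iso_good[OF iso wf_CM] good_CM by blast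
  then have "pow_total CM" using iso_valid[OF iso wf_CM] unfolding pow_total_def by blast
  then have E: "exp_cut I" by (rule exp_cut_I)
  interpret E: exp_cut I by (rule E)
  have T: "valid CM (T_sentence \<theta>)"
  proof -
    have "sat CM \<theta> (\<lambda>i. if i = 0 then x else if i = 1 then y else z) \<sigma> \<longleftrightarrow> trel \<theta> x y z"
      if "x \<in> I" "y \<in> I" "z \<in> I" for x y z \<sigma>
    proof -
      have "sat CM \<theta> (\<lambda>i. if i = 0 then x else if i = 1 then y else z) \<sigma> \<longleftrightarrow>
          sat CM \<theta> (\<lambda>i. if i = 0 then x else if i = 1 then y else z) (\<lambda>i. Aset \<inter> I)"
        by (rule sat_cong[OF \<theta>(2)]) auto
      then show ?thesis unfolding trel_def[OF \<theta>]
        using Sigma00_absolute[OF \<theta>(1), of "\<lambda>i. if i = 0 then x else if i = 1 then y else z" Cod "\<lambda>_. Aset"] that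
        by (simp add: inI_def)
    qed
    then show ?thesis unfolding valid_def T_sentence_def
      using cut_T by (simp add: numeral_eq_Suc cong: if_cong)
  qed
  have "valid CM \<gamma>" if "\<gamma> \<in> WKL0 \<union> BSigma02 \<union> {T_sentence \<theta>}" for \<gamma>
  proof -
    have "\<forall>\<gamma>\<in>BSigma02. valid CM \<gamma>" unfolding BSigma02_def valid_closures using valid_bounding by blast
    moreover have "\<forall>\<gamma>\<in>RCA0. valid CM \<gamma>"
      unfolding RCA0_def ball_Un valid_closures using valid_comprehension good_CM unfolding good_def by blast
    ultimately show ?thesis using that T valid_weak_Koenig[OF E] unfolding WKL0_def by blast
  qed
  moreover obtain e0 s0 where env0: "envs CM e0 s0" using envs_exist[OF wf_CM] by blast
  ultimately have "sat CM (infinite_sentence \<psi>) e0 s0"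
    using soundness[OF proves wf_CM env0] unfolding valid_def by blast
  moreover have "sat CM (infinite_set (SVar 0)) e' ((elts (X 0) \<inter> I) ## s')" for e' s'
    unfolding sat_infinite_set
  proof
    fix x assume "x \<in> I"
    then obtain n where "x < m n" using I_D by blast
    then show "\<exists>y\<in>I. x < y \<and> y \<in> sval CM ((elts (X 0) \<inter> I) ## s') (SVar 0)"
      using m_I m_mem[of 0 n] by auto
  qed
  moreover have e0: "inI I e0" by (rule envs_CM[OF env0])
  moreover have xI: "e 0 \<in> I" using start'(1) m[of 0] unfolding I_def isMin_def by blast
  ultimately obtain F y where F: "F \<in> I" "\<And>z. memc z F \<Longrightarrow> memc z (X 0)" and y: "y \<in> I"
    "sat CM (inst3 \<psi> (NVar 2) (NVar 0) (NVar 1)) (y ## F ## e 0 ## e0) ((elts (X 0) \<inter> I) ## s0)"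
    unfolding infinite_sentence_def using elts_Cod[of "X 0"]
    by (auto simp del: sat_inst3 dest!: bspec[of I _ "e 0"] bspec[of Cod _ "elts (X 0) \<inter> I"])
  have "sat smodel \<psi> (\<lambda>i. if i = 0 then e 0 else if i = 1 then y else F) s"
  proof -
    have \<psi>0: "Sigma00 \<psi>" using \<psi>(1) by (simp add: Sigma0_def)
    let ?e = "\<lambda>i::nat. if i = 0 then e 0 else if i = 1 then y else F"
    have "sat CM \<psi> ?e ((elts (X 0) \<inter> I) ## s0)" using y(2) by (simp add: numeral_eq_Suc cong: if_cong)
    \<comment> \<open>As \<open>\<psi>\<close> has no free set variables, their values may be
      replaced by empty sets, which brings the environment into the form required for
      absoluteness.\<close>
    then have "sat CM \<psi> ?e (\<lambda>i. {} \<inter> I)" using sat_cong[OF \<psi>(2), of ?e ?e] by blast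
    then have "sat smodel \<psi> ?e (\<lambda>i. {})"
      using Sigma00_absolute[OF \<psi>0, of ?e Cod "\<lambda>_. {}"] xI y(1) F(1) by (simp add: inI_def)
    then show ?thesis using sat_cong[OF \<psi>(2), of ?e ?e] by blast
  qed
  moreover have "sub F (X 0)" using F(2) by (simp add: sub_def)
  moreover have "y < M 0"
  proof -
    obtain n where "y < m n" using I_D[OF y(1)] by blast
    then show ?thesis using m_mem[of 0 n] M[of 0] unfolding isMax_def by (meson le0 less_le_trans)
  qed
  ultimately show "sat smodel (concl_fm \<psi>) (X 0 ## e) s"
    unfolding concl_fm_def smodel_cmodel using M[of 0]
    by (auto simp: numeral_eq_Suc cong: if_cong)
qed

section \<open>Transport of the properties along isomorphisms\<close>

lemma iso_pullback:
  assumes iso: "iso f M N" and wf: "wf_model M" and e': "envs N e' s'"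
  obtains e s where "envs M e s" "e' = (\<lambda>i. f (e i))"
    "\<forall>\<phi> e2. envs M e2 s \<longrightarrow> (sat M \<phi> e2 s \<longleftrightarrow> sat N \<phi> (\<lambda>i. f (e2 i)) s')"
proof -
  have N: "Num N = f ` Num M" using iso by (simp add: iso_def bij_betw_def)
  have isoN: "\<forall>Y\<in>Sets N. \<exists>X\<in>Sets M. \<forall>x\<in>Num M. x \<in> X \<longleftrightarrow> f x \<in> Y" using iso by (simp add: iso_def)
  have "\<forall>i. e' i \<in> f ` Num M" using e' N by (simp add: envs_def)
  then have "\<forall>i. \<exists>x\<in>Num M. f x = e' i" by (metis imageE)
  then obtain e where e: "\<And>i. e i \<in> Num M" "\<And>i. f (e i) = e' i" by metis
  have "\<forall>i. \<exists>X. X \<in> Sets M \<and> (\<forall>x\<in>Num M. x \<in> X \<longleftrightarrow> f x \<in> s' i)" using e' isoN unfolding envs_def by metis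
  from choice[OF this] obtain s where s: "\<forall>i. s i \<in> Sets M \<and> (\<forall>x\<in>Num M. x \<in> s i \<longleftrightarrow> f x \<in> s' i)" ..
  show thesis
  proof (rule that[of e s])
    show "envs M e s" using e s by (simp add: envs_def)
    show "e' = (\<lambda>i. f (e i))" using e by auto
    show "\<forall>\<phi> e2. envs M e2 s \<longrightarrow> (sat M \<phi> e2 s \<longleftrightarrow> sat N \<phi> (\<lambda>i. f (e2 i)) s')"
      by (intro allI impI iso_sat[OF iso wf]) (use s in \<open>auto simp: envs_def\<close>)
  qed
qed

lemma comp_econs: "(\<lambda>i. f ((x ## e) i)) = f x ## (\<lambda>i. f (e i))"
  by (auto split: nat.splits)

lemma iso_surj: "iso f M N \<Longrightarrow> y \<in> Num N \<Longrightarrow> \<exists>x\<in>Num M. y = f x"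
  by (auto simp: iso_def bij_betw_def)

lemma iso_Num: "iso f M N \<Longrightarrow> x \<in> Num M \<Longrightarrow> f x \<in> Num N"
  by (auto simp: iso_def bij_betw_def)

lemma iso_shrinks: assumes iso: "iso f M N" and wf: "wf_model M" and M: "shrinks M" shows "shrinks N"
  unfolding shrinks_def
proof (intro allI impI ballI)
  fix \<theta> n e' s' X' b' c'
  assume \<theta>: "Sigma00 \<theta>" "fm_below 3 0 \<theta>" and env: "envs N e' s'" and X': "X' \<in> Num N" "b' \<in> Num N" "c' \<in> Num N"
    and large: "sat N (omega_power_large \<theta> (Suc (4 * n)) (NVar 0)) (X' ## e') s'" "sat N (exp_sparse (NVar 0)) (X' ## e') s'"
  obtain e s where e: "envs M e s" "e' = (\<lambda>i. f (e i))"
    and sat': "\<forall>\<phi> e2. envs M e2 s \<longrightarrow> (sat M \<phi> e2 s \<longleftrightarrow> sat N \<phi> (\<lambda>i. f (e2 i)) s')"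
    by (rule iso_pullback[OF iso wf env])
  note sat = sat'[rule_format]
  obtain X b c where X: "X \<in> Num M" "b \<in> Num M" "c \<in> Num M" "X' = f X" "b' = f b" "c' = f c"
    using iso_surj[OF iso] X' by metis
  have "sat M (omega_power_large \<theta> (Suc (4 * n)) (NVar 0)) (X ## e) s" "sat M (exp_sparse (NVar 0)) (X ## e) s"
    using large unfolding sat[OF envs_cons[OF e(1) X(1)]] comp_econs X e by simp_all
  then obtain Y where Y: "Y \<in> Num M" "\<And>e2. envs M e2 s \<Longrightarrow> sat M (shrink_fm \<theta>) (Y ## X ## b ## c ## e2) s \<and>
        sat M (exp_sparse (NVar 0)) (Y ## e2) s \<and> sat M (omega_power_large \<theta> n (NVar 0)) (Y ## e2) s"
    using M[unfolded shrinks_def, rule_format, OF \<theta> e(1) X(1-3)] by blast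
  have "sat N (shrink_fm \<theta>) (f Y ## X' ## b' ## c' ## e2') s' \<and> sat N (exp_sparse (NVar 0)) (f Y ## e2') s' \<and>
      sat N (omega_power_large \<theta> n (NVar 0)) (f Y ## e2') s'" if env2: "envs N e2' s'" for e2'
  proof -
    have "\<forall>i. \<exists>x. x \<in> Num M \<and> e2' i = f x" using env2 iso_surj[OF iso] unfolding envs_def by blast
    from choice[OF this] obtain e2 where e2: "\<forall>i. e2 i \<in> Num M \<and> e2' i = f (e2 i)" ..
    then have e2'': "e2' = (\<lambda>i. f (e2 i))" by auto
    have "envs M e2 s" using e2 e(1) by (simp add: envs_def)
    note envs = envs_cons[OF this Y(1)] envs_cons[OF envs_cons[OF envs_cons[OF envs_cons[OF this X(3)] X(2)] X(1)] Y(1)]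
    show ?thesis
      using Y(2)[OF \<open>envs M e2 s\<close>] unfolding sat[OF envs(1)] sat[OF envs(2)] comp_econs X e2'' by simp
  qed
  then show "\<exists>Y\<in>Num N. \<forall>e2. envs N e2 s' \<longrightarrow> sat N (shrink_fm \<theta>) (Y ## X' ## b' ## c' ## e2) s' \<and>
      sat N (exp_sparse (NVar 0)) (Y ## e2) s' \<and> sat N (omega_power_large \<theta> n (NVar 0)) (Y ## e2) s'"
    using iso_Num[OF iso Y(1)] by blast
qed

lemma iso_large_descends:
  assumes iso: "iso f M N" and wf: "wf_model M" and M: "large_descends M" shows "large_descends N"
  unfolding large_descends_def
proof (intro allI impI)
  fix \<theta> n e' s'
  assume \<theta>: "Sigma00 \<theta>" "fm_below 3 0 \<theta>" and env: "envs N e' s'"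
    and large: "sat N (omega_power_large \<theta> (Suc n) (NVar 0)) e' s'"
  obtain e s where e: "envs M e s" "e' = (\<lambda>i. f (e i))"
    and sat': "\<forall>\<phi> e2. envs M e2 s \<longrightarrow> (sat M \<phi> e2 s \<longleftrightarrow> sat N \<phi> (\<lambda>i. f (e2 i)) s')"
    by (rule iso_pullback[OF iso wf env])
  note sat = sat'[rule_format]
  show "sat N (omega_power_large \<theta> n (NVar 0)) e' s'"
    using M \<theta> e large sat[OF e(1)] unfolding large_descends_def by metis
qed

lemma iso_cut_property:
  assumes iso: "iso f M N" and wf: "wf_model M" and M: "cut_property M" shows "cut_property N"
  unfolding cut_property_def
proof (intro allI impI)
  fix \<theta> \<psi> and X' b' c' :: "nat \<Rightarrow> _" and e' s'
  assume \<theta>: "Sigma00 \<theta>" "fm_below 3 0 \<theta>" "Sigma0 \<psi>" "fm_below 3 0 \<psi>"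
    "WKL0 \<union> BSigma02 \<union> {T_sentence \<theta>} \<turnstile> infinite_sentence \<psi>" and env: "envs N e' s'"
    and X': "\<forall>n. X' n \<in> Num N \<and> b' n \<in> Num N \<and> c' n \<in> Num N"
    and shrink: "\<forall>n. sat N (shrink_fm \<theta>) (X' (Suc n) ## X' n ## b' n ## c' n ## X' 0 ## e') s'"
    and rec: "\<forall>b\<in>Num N. \<forall>c\<in>Num N. \<forall>k. \<exists>n\<ge>k. b' n = b \<and> c' n = c"
    and start: "sat N (start_fm \<theta>) (X' 0 ## e') s'"
  obtain e s where e: "envs M e s" "e' = (\<lambda>i. f (e i))"
    and sat': "\<forall>\<phi> e2. envs M e2 s \<longrightarrow> (sat M \<phi> e2 s \<longleftrightarrow> sat N \<phi> (\<lambda>i. f (e2 i)) s')"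
    by (rule iso_pullback[OF iso wf env])
  note sat = sat'[rule_format]
  have surj: "\<exists>g. \<forall>n. g n \<in> Num M \<and> h n = f (g n)" if "\<forall>n. h n \<in> Num N" for h :: "nat \<Rightarrow> _"
  proof (rule choice)
    show "\<forall>n. \<exists>x. x \<in> Num M \<and> h n = f x" using that iso_surj[OF iso] by blast
  qed
  have Num: "\<forall>n. X' n \<in> Num N" "\<forall>n. b' n \<in> Num N" "\<forall>n. c' n \<in> Num N" using X' by simp_all
  obtain X where X0: "\<forall>n. X n \<in> Num M \<and> X' n = f (X n)" using surj[OF Num(1)] ..
  obtain b where b0: "\<forall>n. b n \<in> Num M \<and> b' n = f (b n)" using surj[OF Num(2)] ..
  obtain c where c0: "\<forall>n. c n \<in> Num M \<and> c' n = f (c n)" using surj[OF Num(3)] ..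
  note X = X0[rule_format, THEN conjunct1] X0[rule_format, THEN conjunct2]
  note b = b0[rule_format, THEN conjunct1] b0[rule_format, THEN conjunct2]
  note c = c0[rule_format, THEN conjunct1] c0[rule_format, THEN conjunct2]
  have "inj_on f (Num M)" using iso by (simp add: iso_def bij_betw_def)
  note inj = inj_onD[OF this]
  note env0 = envs_cons[OF e(1) X(1)[of 0]]
  have env4: "envs M (X (Suc n) ## X n ## b n ## c n ## X 0 ## e) s" for n
    by (intro envs_cons e X(1) b(1) c(1))
  have sh: "\<forall>n. sat M (shrink_fm \<theta>) (X (Suc n) ## X n ## b n ## c n ## X 0 ## e) s"
    using shrink unfolding sat[OF env4] comp_econs X(2) b(2) c(2) e(2) .
  have st: "sat M (start_fm \<theta>) (X 0 ## e) s"
    using start unfolding sat[OF env0] comp_econs X(2) e(2) .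
  have rec': "\<forall>b0\<in>Num M. \<forall>c0\<in>Num M. \<forall>k. \<exists>n\<ge>k. b n = b0 \<and> c n = c0"
  proof (intro ballI allI)
    fix b0 c0 k assume 0: "b0 \<in> Num M" "c0 \<in> Num M"
    then obtain n where "n \<ge> k" "b' n = f b0" "c' n = f c0" using rec iso_Num[OF iso] by blast
    then show "\<exists>n\<ge>k. b n = b0 \<and> c n = c0" using inj[of "b n" b0] inj[of "c n" c0] b c 0 by auto
  qed
  have "sat M (concl_fm \<psi>) (X 0 ## e) s"
    using M[unfolded cut_property_def, rule_format, OF \<theta> e(1), of X b c] X(1) b(1) c(1) sh rec' st by blast
  then show "sat N (concl_fm \<psi>) (X' 0 ## e') s'"
    unfolding sat[OF env0] comp_econs X(2) e(2) .
qed

text \<open>Every theorem about the type class holds for all models of \<open>I\<Sigma>\<^sub>1\<close> on terms: the type \<open>mdl\<close> below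
  carries a counterexample to the property \<open>transfers\<close>, if there is one. Totality of exponentiation comes
  first since the analysis of cuts uses it for further models.\<close>

definition transfers :: "tm model \<Rightarrow> bool" where
  "transfers M \<longleftrightarrow> (good M \<longrightarrow> pow_total M \<and> shrinks M \<and> large_descends M \<and>
     ((\<forall>M'::tm model. good M' \<longrightarrow> pow_total M') \<longrightarrow> cut_property M))"

definition generic_model :: "tm model" where
  "generic_model = (SOME M. good M \<and> (transfers M \<longrightarrow> (\<forall>M'. transfers M')))"

text \<open>The drinker principle: a good model violating \<open>transfers\<close> is chosen if
  there is one, and any good model otherwise.\<close>

lemma generic_model: "good generic_model" "transfers generic_model \<Longrightarrow> transfers M"
proof -
  have "\<exists>M. good M \<and> (transfers M \<longrightarrow> (\<forall>M'. transfers M'))"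
    using good_tm_model unfolding transfers_def by blast
  from someI_ex[OF this] show "good generic_model" "transfers generic_model \<Longrightarrow> transfers M"
    unfolding generic_model_def by blast+
qed

lemma wf_generic_model: "wf_model generic_model"
  using generic_model(1) good_def by blast

typedef mdl = "Num generic_model"
  using wf_generic_model unfolding wf_model_def by blast

instantiation mdl :: arith
begin

definition "zero_mdl = Abs_mdl (zro generic_model)"
definition "one_mdl = Abs_mdl (uno generic_model)"
definition "plus_mdl x y = Abs_mdl (pls generic_model (Rep_mdl x) (Rep_mdl y))"
definition "times_mdl x y = Abs_mdl (tms generic_model (Rep_mdl x) (Rep_mdl y))"
definition "less_mdl x y \<longleftrightarrow> lss generic_model (Rep_mdl x) (Rep_mdl y)"
definition "less_eq_mdl x y \<longleftrightarrow> x < y \<or> x = (y :: mdl)"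
definition "minus_mdl m n = (if \<exists>k. m = n + k then THE k. m = n + k else (0 :: mdl))"
definition "acst_mdl = Abs_mdl (ncst generic_model)"
definition "Aset_mdl = {x. Rep_mdl x \<in> scst generic_model}"
definition "Asets_mdl = (\<lambda>X. {x. Rep_mdl x \<in> X}) ` Sets generic_model"

instance ..

end

lemma iso_mdl: "iso Rep_mdl (smodel :: mdl model) generic_model"
proof -
  have "bij_betw Rep_mdl UNIV (Num generic_model)"
    by (metis bij_betw_def injI Rep_mdl_inject type_definition.Rep_range type_definition_mdl)
  then show ?thesis
    using wf_generic_model Rep_mdl unfolding iso_def wf_model_def
    by (auto simp: smodel_def zero_mdl_def one_mdl_def plus_mdl_def times_mdl_def less_mdl_def
        acst_mdl_def Aset_mdl_def Asets_mdl_def Abs_mdl_inverse)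
qed

lemma good_mdl: "good (smodel :: mdl model)"
proof -
  have "wf_model (smodel :: mdl model)"
    using wf_generic_model by (auto simp: wf_model_def smodel_def Aset_mdl_def Asets_mdl_def)
  then show ?thesis using iso_good[OF iso_mdl] generic_model(1) by blast
qed

instance mdl :: peano
proof
  have good: "wf_model (smodel :: mdl model)" "\<forall>\<phi>\<in>basic_axioms. valid (smodel :: mdl model) \<phi>"
    "\<And>\<phi>. Sigma01 \<phi> \<Longrightarrow> valid (smodel :: mdl model) (induction_axiom \<phi>)"
    using good_mdl unfolding good_iff by blast+
  fix m n :: mdl
  have *: "n + 1 \<noteq> 0 \<and> (m + 1 = n + 1 \<longrightarrow> m = n) \<and> m + 0 = m \<and> m + (n + 1) = (m + n) + 1 \<and> m * 0 = 0 \<and>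
     m * (n + 1) = m * n + m \<and> \<not> m < 0 \<and> (m < n + 1 \<longleftrightarrow> m < n \<or> m = n)"
    using good(2) unfolding valid_basic_axioms[OF good(1)] by (simp add: smodel_def)
  show "n + 1 \<noteq> 0" using * by blast
  have "m + 1 = n + 1 \<longrightarrow> m = n" using * by (elim conjE)
  then show "m + 1 = n + 1 \<Longrightarrow> m = n" by (rule mp)
  show "m + 0 = m" using * by blast
  show "m + (n + 1) = (m + n) + 1" using * by blast
  show "m * 0 = 0" using * by blast
  show "m * (n + 1) = m * n + m" using * by blast
  show "\<not> m < 0" using * by blast
  show "m < n + 1 \<longleftrightarrow> m < n \<or> m = n" using * by blast
  show "m \<le> n \<longleftrightarrow> m < n \<or> m = n" by (rule less_eq_mdl_def)
  show "m - n = (if \<exists>k. m = n + k then THE k. m = n + k else 0)" by (rule minus_mdl_def)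
  fix \<phi> and e :: "nat \<Rightarrow> mdl" and x
  assume \<phi>: "Sigma01 \<phi>" and 0: "sat smodel \<phi> (0 ## e) (\<lambda>_. Aset)"
    and Suc: "\<And>x. sat smodel \<phi> (x ## e) (\<lambda>_. Aset) \<Longrightarrow> sat smodel \<phi> ((x + 1) ## e) (\<lambda>_. Aset)"
  have smodel: "Num (smodel :: mdl model) = UNIV" "zro (smodel :: mdl model) = 0"
    "pls (smodel :: mdl model) y (uno smodel) = y + 1" for y
    by (simp_all add: smodel_def)
  have env: "envs (smodel :: mdl model) e (\<lambda>_. Aset)"
    using good(1) by (simp add: envs_def wf_model_def smodel_def)
  show "sat smodel \<phi> (x ## e) (\<lambda>_. Aset)"
    by (rule good(3)[OF \<phi>, unfolded valid_induction_axiom smodel, rule_format, OF env 0 Suc UNIV_I])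
qed

text \<open>The single model \<open>generic_model\<close> has to be examined, and it is isomorphic
  to the structure on the type \<open>mdl\<close>, to which the theorems about the class
  apply.\<close>

lemma transfers: "transfers M"
proof (rule generic_model(2))
  have wf: "wf_model (smodel :: mdl model)" using good_mdl good_def by blast
  have "pow_total generic_model"
    using pow_total_smodel[where 'a = mdl] iso_valid[OF iso_mdl wf] unfolding pow_total_def by blast
  moreover have "cut_property generic_model" if "\<forall>M'::tm model. good M' \<longrightarrow> pow_total M'"
    by (rule iso_cut_property[OF iso_mdl wf], rule cut_property_smodel[of Rep_mdl])
       (use that in \<open>auto intro: injI simp: Rep_mdl_inject\<close>)
  ultimately show "transfers generic_model"
    unfolding transfers_def
    using iso_shrinks[OF iso_mdl wf shrinks_smodel] iso_large_descends[OF iso_mdl wf large_descends_smodel] by blast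
qed

lemma good_properties:
  assumes "good (M :: tm model)"
  shows "shrinks M" "large_descends M" "cut_property M"
  using transfers assms unfolding transfers_def by blast+

section \<open>The main theorem\<close>

lemma bounded_ISigma01: "bounded ISigma01"
  unfolding bounded_def ISigma01_def closures_def by blast

lemma good_of_sat:
  assumes "wf_model M" "envs M e s" "\<And>\<gamma>. \<gamma> \<in> ISigma01 \<Longrightarrow> sat M \<gamma> e s"
  shows "good M"
proof -
  have "sentence \<gamma>" if "\<gamma> \<in> ISigma01" for \<gamma> using that by (auto simp: ISigma01_def closures_def)
  then show ?thesis using assms sentence_sat unfolding good_def valid_def by blast
qed

section \<open>Theories that assert largeness for every exponent\<close>

definition big :: "fm \<Rightarrow> nat \<Rightarrow> nat \<Rightarrow> fm" where
  "big \<theta> k n = inst (omega_power_large \<theta> n (NVar 0)) (NVar k)"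

definition sparse :: "nat \<Rightarrow> fm" where
  "sparse k = inst (exp_sparse (NVar 0)) (NVar k)"

definition shrink_step :: "fm \<Rightarrow> tm \<Rightarrow> tm \<Rightarrow> nat \<Rightarrow> nat \<Rightarrow> fm" where
  "shrink_step \<theta> b c k k' =
     fsub (case_nat (NVar k') (case_nat (NVar k) (case_nat b (case_nat c NVar)))) SVar (shrink_fm \<theta>)"

lemma sat_big: "sat M (big \<theta> k n) e s \<longleftrightarrow> sat M (omega_power_large \<theta> n (NVar 0)) (e k ## e) s"
  by (simp add: big_def sat_inst)

lemma sat_sparse: "sat M (sparse k) e s \<longleftrightarrow> sat M (exp_sparse (NVar 0)) (e k ## e) s"
  by (simp add: sparse_def sat_inst)

lemma sat_shrink_step: "sat M (shrink_step \<theta> b c k k') e s \<longleftrightarrow>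
    sat M (shrink_fm \<theta>) (e k' ## e k ## tval M e b ## tval M e c ## e) s"
proof -
  have "(\<lambda>i. tval M e (case_nat (NVar k') (case_nat (NVar k) (case_nat b (case_nat c NVar))) i))
      = e k' ## e k ## tval M e b ## tval M e c ## e"
    by (auto split: nat.splits)
  then show ?thesis by (simp add: shrink_step_def sat_fsub)
qed

lemma large_descends_le:
  assumes "large_descends M" "Sigma00 \<theta>" "fm_below 3 0 \<theta>" "envs M e s"
    and "sat M (omega_power_large \<theta> N (NVar 0)) e s" "n \<le> N"
  shows "sat M (omega_power_large \<theta> n (NVar 0)) e s"
  using assms(6,5)
proof (induction N rule: dec_induct)
  case (step N) then show ?case using assms(1-4) unfolding large_descends_def by blast
qed simp

text \<open>A derivation of a contradiction mentions finitely many exponents, and largeness for the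
  greatest of them implies the rest. The models may therefore vary with \<open>N\<close>.\<close>

lemma con_large:
  assumes \<theta>: "Sigma00 \<theta>" "fm_below 3 0 \<theta>"
    and models: "\<And>N. \<exists>(M :: tm model) e s. good M \<and> envs M e s \<and> (\<forall>\<gamma>\<in>\<Gamma>. sat M \<gamma> e s) \<and> sat M (big \<theta> k N) e s"
  shows "con (\<Gamma> \<union> range (big \<theta> k))"
  unfolding con_def
proof
  assume "\<Gamma> \<union> range (big \<theta> k) \<turnstile> Fls"
  then obtain D where D: "D \<subseteq> \<Gamma> \<union> range (big \<theta> k)" "finite D" "D \<turnstile> Fls" using proves_finite by blast
  have "finite (D - \<Gamma>)" "D - \<Gamma> \<subseteq> range (big \<theta> k)" using D by auto
  then obtain A where A: "finite A" "D - \<Gamma> = big \<theta> k ` A" by (meson finite_subset_image)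
  define N where "N = Max (insert 0 A)"
  have N: "n \<le> N" if "n \<in> A" for n using that A(1) unfolding N_def by simp
  obtain M :: "tm model" and e s where M: "good M" "envs M e s" "\<And>\<gamma>. \<gamma> \<in> \<Gamma> \<Longrightarrow> sat M \<gamma> e s" "sat M (big \<theta> k N) e s"
    using models by metis
  have "envs M (e k ## e) s" using M(2) by (intro envs_cons) (auto simp: envs_def)
  then have big: "sat M (big \<theta> k n) e s" if "n \<in> A" for n
    using large_descends_le[OF good_properties(2)[OF M(1)] \<theta>] M(4) N[OF that] unfolding sat_big by blast
  have "sat M \<gamma> e s" if "\<gamma> \<in> D" for \<gamma>
  proof (cases "\<gamma> \<in> \<Gamma>")
    case False
    then have "\<gamma> \<in> big \<theta> k ` A" using A(2) that by blast
    then show ?thesis using big by blast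
  qed (rule M(3))
  then have "sat M Fls e s" using soundness[OF D(3)] M(1,2) unfolding good_def by blast
  then show False by simp
qed

lemma tm_below_tsub: "tm_below m t \<Longrightarrow> (\<And>i. i < m \<Longrightarrow> tm_below m' (\<sigma> i)) \<Longrightarrow> tm_below m' (tsub \<sigma> t)"
  by (induction t) auto

lemma st_below_ssub: "st_below n X \<Longrightarrow> (\<And>i. i < n \<Longrightarrow> st_below n' (\<tau> i)) \<Longrightarrow> st_below n' (ssub \<tau> X)"
  by (cases X) auto

lemma tm_below_lift [simp]: "tm_below (Suc m) (t \<up> Suc k) \<longleftrightarrow> tm_below m (t \<up> k)"
  unfolding tlift_def by (induction t) auto

lemma fm_below_fsub:
  "fm_below m n \<phi> \<Longrightarrow> (\<And>i. i < m \<Longrightarrow> tm_below m' (\<sigma> i)) \<Longrightarrow> (\<And>i. i < n \<Longrightarrow> st_below n' (\<tau> i)) \<Longrightarrow>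
   fm_below m' n' (fsub \<sigma> \<tau> \<phi>)"
proof (induction \<phi> arbitrary: m n m' n' \<sigma> \<tau>)
  case (Eq t u) then show ?case using tm_below_tsub[of m] by simp
next
  case (Less t u) then show ?case using tm_below_tsub[of m] by simp
next
  case (Mem t X) then show ?case using tm_below_tsub[of m] st_below_ssub[of n] by simp
next
  case (Imp \<phi> \<psi>)
  then show ?case unfolding fsub.simps fm_below.simps by blast
next
  case (Forall \<phi>)
  show ?case unfolding fsub.simps fm_below.simps One_nat_def
    by (rule Forall.IH[of "Suc m" n]) (use Forall.prems in \<open>auto split: nat.splits\<close>)
next
  case (ForallS \<phi>)
  have "st_below (Suc n') (ssub (\<lambda>j. SVar (Suc j)) (\<tau> i))" if "i < n" for i
    using ForallS.prems(3)[OF that] by (rule st_below_ssub) simp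
  then show ?case unfolding fsub.simps fm_below.simps
    by (intro ForallS.IH[of m "Suc n"]) (use ForallS.prems in \<open>auto split: nat.splits\<close>)
qed auto

lemma fm_below_inst3:
  assumes "fm_below 3 0 \<phi>" "tm_below m t" "tm_below m u" "tm_below m v" shows "fm_below m 0 (inst3 \<phi> t u v)"
  unfolding inst3_def by (rule fm_below_fsub[OF assms(1)]) (use assms in auto)

lemma fm_below_exp_sparse: "tm_below m X \<Longrightarrow> fm_below m 0 (exp_sparse X)"
  by (simp add: exp_sparse_def in_code_def power_eq_def beta_def numeral_eq_Suc)

lemma fm_below_power_large:
  assumes \<theta>: "fm_below 3 0 \<theta>" shows "tm_below m X \<Longrightarrow> fm_below m 0 (power_large \<theta> n X)"
proof (induction n arbitrary: m X)
  case (Suc n)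
  have "fm_below m 0 (multiple_large \<theta> (power_large \<theta> n) k Y)" if "tm_below m k" "tm_below m Y" for m k Y
    using that by (simp add: multiple_large_def T_apart_def subset_code_def set_before_def is_min_def is_max_def
        in_code_def power_eq_def beta_def numeral_eq_Suc Suc.IH fm_below_inst3[OF \<theta>])
  then show ?case using Suc.prems
    by (simp add: is_min_def in_code_def power_eq_def beta_def numeral_eq_Suc)
qed (simp add: in_code_def power_eq_def beta_def numeral_eq_Suc)

lemma fm_below_omega_power_large:
  "fm_below 3 0 \<theta> \<Longrightarrow> tm_below m X \<Longrightarrow> fm_below m 0 (omega_power_large \<theta> n X)"
  unfolding omega_power_large_def using fm_below_power_large[of \<theta> m X n]
  by (simp add: is_min_def in_code_def power_eq_def beta_def numeral_eq_Suc)

lemma bounded_big: "fm_below 3 0 \<theta> \<Longrightarrow> bounded (range (big \<theta> k))"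
proof -
  assume \<theta>: "fm_below 3 0 \<theta>"
  have "fm_below (Suc k) 0 (big \<theta> k n)" for n
    unfolding big_def inst_def
    by (rule fm_below_fsub[OF fm_below_omega_power_large[OF \<theta>, of 1]]) auto
  then show ?thesis unfolding bounded_def using fm_below_mono[of "Suc k" 0 _ "Suc k" "Suc k"] by blast
qed

lemma sat_big_0: "fm_below 3 0 \<theta> \<Longrightarrow> sat M (big \<theta> 0 n) e s \<longleftrightarrow> sat M (omega_power_large \<theta> n (NVar 0)) e s"
  unfolding sat_big by (rule sat_cong[OF fm_below_omega_power_large[of _ 1]]) auto

lemma sat_sparse_0: "sat M (sparse 0) e s \<longleftrightarrow> sat M (exp_sparse (NVar 0)) e s"
  unfolding sat_sparse by (rule sat_cong[OF fm_below_exp_sparse[of 1]]) auto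

text \<open>For a target exponent \<open>N\<close>, the exponent \<open>4 * N + 1\<close> of the
  current set is used, and the set \<open>Y\<close> obtained depends on \<open>N\<close>. Letting
  the fresh variable \<open>j\<close> denote it in each case, \<open>con_large\<close> makes all
  target exponents consistent together.\<close>

lemma shrink_extension:
  assumes \<theta>: "Sigma00 \<theta>" "fm_below 3 0 \<theta>"
    and \<Gamma>: "con \<Gamma>" "bounded \<Gamma>" "ISigma01 \<subseteq> \<Gamma>" "sparse k \<in> \<Gamma>" "range (big \<theta> k) \<subseteq> \<Gamma>"
  shows "\<exists>\<Gamma>' k'. \<Gamma> \<subseteq> \<Gamma>' \<and> con \<Gamma>' \<and> bounded \<Gamma>' \<and>
    (ISigma01 \<subseteq> \<Gamma>' \<and> sparse k' \<in> \<Gamma>' \<and> range (big \<theta> k') \<subseteq> \<Gamma>') \<and> shrink_step \<theta> b c k k' \<in> \<Gamma>'"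
proof -
  \<comment> \<open>The two equations are not assumed anywhere; they only force the bound
    \<open>j\<close> to lie beyond \<open>k\<close> and the variables of \<open>b\<close> and
    \<open>c\<close>.\<close>
  have "bounded (insert (NVar k \<^bold>= NVar k) (insert (b \<^bold>= c) \<Gamma>))" using \<Gamma>(2) by (simp add: bounded_insert)
  then obtain j where j: "\<And>\<gamma>. \<gamma> \<in> \<Gamma> \<Longrightarrow> fm_below j j \<gamma>" "k < j" "tm_below j b" "tm_below j c"
    unfolding bounded_def by auto
  let ?\<Gamma> = "insert (shrink_step \<theta> b c k j) (insert (sparse j) \<Gamma>)"
  have "con (?\<Gamma> \<union> range (big \<theta> j))"
  proof (rule con_large[OF \<theta>])
    fix N
    obtain M :: "tm model" and e s where M: "wf_model M" "envs M e s" "\<forall>\<gamma>\<in>\<Gamma>. sat M \<gamma> e s"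
      by (rule model_existence[OF \<Gamma>(1,2)])
    have good: "good M" using good_of_sat[OF M(1,2)] M(3) \<Gamma>(3) by blast
    have "sat M (sparse k) e s" "sat M (big \<theta> k (Suc (4 * N))) e s" using M(3) \<Gamma>(4,5) by blast+
    moreover have "e k \<in> Num M" "tval M e b \<in> Num M" "tval M e c \<in> Num M"
      using M(2) tval_closed[OF M(1,2)] by (auto simp: envs_def)
    ultimately obtain Y where Y: "Y \<in> Num M" "\<And>e2. envs M e2 s \<Longrightarrow>
        sat M (shrink_fm \<theta>) (Y ## e k ## tval M e b ## tval M e c ## e2) s \<and>
        sat M (exp_sparse (NVar 0)) (Y ## e2) s \<and> sat M (omega_power_large \<theta> N (NVar 0)) (Y ## e2) s"
      using good_properties(1)[OF good, unfolded shrinks_def, rule_format, OF \<theta> M(2)] unfolding sat_big sat_sparse by meson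
    let ?e = "e(j := Y)"
    have env: "envs M ?e s" using M(2) Y(1) by (simp add: envs_def)
    have "sat M \<gamma> ?e s" if "\<gamma> \<in> \<Gamma>" for \<gamma>
      using M(3)[rule_format, OF that] sat_cong[OF j(1)[OF that], of ?e e s s M] by simp
    moreover have "tval M ?e b = tval M e b" "tval M ?e c = tval M e c"
      using tval_cong[OF j(3), of ?e e M] tval_cong[OF j(4), of ?e e M] by simp_all
    ultimately have "good M \<and> envs M ?e s \<and> (\<forall>\<gamma>\<in>?\<Gamma>. sat M \<gamma> ?e s) \<and> sat M (big \<theta> j N) ?e s"
      using good env Y(2)[OF env] j(2) by (simp add: sat_shrink_step sat_sparse sat_big)
    then show "\<exists>(M :: tm model) e s. good M \<and> envs M e s \<and> (\<forall>\<gamma>\<in>?\<Gamma>. sat M \<gamma> e s) \<and> sat M (big \<theta> j N) e s"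
      by blast
  qed
  moreover have "bounded (?\<Gamma> \<union> range (big \<theta> j))"
    by (rule bounded_Un) (use \<Gamma>(2) bounded_big[OF \<theta>(2)] in \<open>simp_all add: bounded_insert\<close>)
  ultimately show ?thesis using \<Gamma>(3)
    by (intro exI[of _ "?\<Gamma> \<union> range (big \<theta> j)"] exI[of _ j]) auto
qed

lemma sat_finite_sentence:
  "sat M (finite_sentence \<theta> \<psi> n) e s \<longleftrightarrow> (\<forall>x\<in>Num M. \<forall>Z\<in>Num M.
     sat M (Forall (NVar 0 \<^bold>\<in>\<^sub>c NVar 1 \<^bold>\<longrightarrow> NVar 2 \<^bold>< NVar 0)) (Z ## x ## e) s \<longrightarrow>
     sat M (omega_power_large \<theta> n (NVar 0)) (Z ## x ## e) s \<longrightarrow> sat M (exp_sparse (NVar 0)) (Z ## x ## e) s \<longrightarrow>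
     sat M (concl_fm \<psi>) (Z ## x ## e) s)"
  unfolding finite_sentence_def concl_fm_def[symmetric] by (simp only: sat.simps(1,5) sat.simps(6)) blast

theorem theorem1p6:
  fixes \<theta> \<psi> :: fm
  assumes "Sigma00 \<theta>" and "fm_below 3 0 \<theta>"
    and "Sigma0 \<psi>" and "fm_below 3 0 \<psi>"
    and "WKL0 \<union> BSigma02 \<union> {T_sentence \<theta>} \<turnstile> infinite_sentence \<psi>"
  shows "\<exists>n. ISigma01 \<turnstile> finite_sentence \<theta> \<psi> n"
proof (rule ccontr)
  assume none: "\<not> ?thesis"
  note \<theta> = assms(1,2)
  \<comment> \<open>Variable 0 names the set \<open>Z\<close> and variable 1 the number
    \<open>x\<close>. Sparseness of \<open>Z\<close> is repeated as \<open>sparse 0\<close>, the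
    shape that the stages of the construction pass on.\<close>
  let ?\<Gamma> = "ISigma01 \<union> {start_fm \<theta>, \<^bold>\<not> concl_fm \<psi>, sparse 0}"
  have con: "con (?\<Gamma> \<union> range (big \<theta> 0))"
  proof (rule con_large[OF \<theta>])
    fix N
    have "con (insert (\<^bold>\<not> finite_sentence \<theta> \<psi> N) ISigma01)"
      using none Contr unfolding con_def by blast
    moreover have "bounded (insert (\<^bold>\<not> finite_sentence \<theta> \<psi> N) ISigma01)"
      using bounded_ISigma01 by (simp add: bounded_insert)
    ultimately obtain M :: "tm model" and e s where M: "wf_model M" "envs M e s"
      "\<forall>\<gamma>\<in>insert (\<^bold>\<not> finite_sentence \<theta> \<psi> N) ISigma01. sat M \<gamma> e s"
      by (rule model_existence)
    have good: "good M" using good_of_sat[OF M(1,2)] M(3) by blast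
    have "\<not> sat M (finite_sentence \<theta> \<psi> N) e s" using M(3) by simp
    then obtain x Z where xZ: "x \<in> Num M" "Z \<in> Num M"
      "sat M (Forall (NVar 0 \<^bold>\<in>\<^sub>c NVar 1 \<^bold>\<longrightarrow> NVar 2 \<^bold>< NVar 0)) (Z ## x ## e) s"
      "sat M (omega_power_large \<theta> N (NVar 0)) (Z ## x ## e) s" "sat M (exp_sparse (NVar 0)) (Z ## x ## e) s"
      "\<not> sat M (concl_fm \<psi>) (Z ## x ## e) s"
      unfolding sat_finite_sentence by blast
    have env: "envs M (Z ## x ## e) s" using M(2) xZ by (intro envs_cons)
    have "sat M (omega_power_large \<theta> 0 (NVar 0)) (Z ## x ## e) s"
      by (rule large_descends_le[OF good_properties(2)[OF good] \<theta> env xZ(4)]) simp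
    then have "sat M (start_fm \<theta>) (Z ## x ## e) s" using xZ unfolding start_fm_def by simp
    moreover have "sat M \<gamma> (Z ## x ## e) s" if "\<gamma> \<in> ISigma01" for \<gamma>
      using good env that unfolding good_def valid_def by blast
    ultimately have "\<forall>\<gamma>\<in>?\<Gamma>. sat M \<gamma> (Z ## x ## e) s" "sat M (big \<theta> 0 N) (Z ## x ## e) s"
      using xZ(4-6) by (auto simp: sat_sparse_0 sat_big_0[OF \<theta>(2)])
    then show "\<exists>(M :: tm model) e s. good M \<and> envs M e s \<and> (\<forall>\<gamma>\<in>?\<Gamma>. sat M \<gamma> e s) \<and> sat M (big \<theta> 0 N) e s"
      using good env by blast
  qed
  have "bounded {start_fm \<theta>, \<^bold>\<not> concl_fm \<psi>, sparse 0}" by (rule bounded_finite) simp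
  then have bounded: "bounded (?\<Gamma> \<union> range (big \<theta> 0))"
    by (intro bounded_Un bounded_ISigma01 bounded_big \<theta>(2))
  \<comment> \<open>\<open>n\<close> encodes a pair of terms together with a counter. Ignoring the
    counter makes each pair of terms occur at infinitely many stages.\<close>
  define b c :: "nat \<Rightarrow> tm" where "b n = from_nat (fst (prod_decode (fst (prod_decode n))))"
    and "c n = from_nat (snd (prod_decode (fst (prod_decode n))))" for n
  let ?Q = "\<lambda>\<Gamma> k. ISigma01 \<subseteq> \<Gamma> \<and> sparse k \<in> \<Gamma> \<and> range (big \<theta> k) \<subseteq> \<Gamma>"
  obtain M :: "tm model" and e s and kk :: "nat \<Rightarrow> nat" where M: "wf_model M" "envs M e s" "Num M = range (tval M e)"
    and sat: "\<And>\<gamma>. \<gamma> \<in> ?\<Gamma> \<union> range (big \<theta> 0) \<Longrightarrow> sat M \<gamma> e s" and kk0: "kk 0 = 0"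
    and step: "\<And>n \<gamma>. \<gamma> \<in> {shrink_step \<theta> (b n) (c n) (kk n) (kk (Suc n))} \<Longrightarrow> sat M \<gamma> e s"
  proof (rule interleaved_model_existence[of "?\<Gamma> \<union> range (big \<theta> 0)" ?Q 0 "\<lambda>n k k'. {shrink_step \<theta> (b n) (c n) k k'}", OF con bounded])
    show "?Q (?\<Gamma> \<union> range (big \<theta> 0)) 0" by blast
    show "?Q \<Gamma> k \<Longrightarrow> \<Gamma> \<subseteq> \<Gamma>' \<Longrightarrow> ?Q \<Gamma>' k" for \<Gamma> \<Gamma>' k by blast
    show "\<exists>\<Gamma>' k'. \<Gamma> \<subseteq> \<Gamma>' \<and> con \<Gamma>' \<and> bounded \<Gamma>' \<and> ?Q \<Gamma>' k' \<and> {shrink_step \<theta> (b n) (c n) k k'} \<subseteq> \<Gamma>'"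
      if "con \<Gamma>" "bounded \<Gamma>" "?Q \<Gamma> k" for n \<Gamma> k
      using shrink_extension[OF \<theta> that(1,2), of k "b n" "c n"] that(3) by auto
  qed (rule that)
  have good: "good M" using good_of_sat[OF M(1,2)] sat by blast
  \<comment> \<open>\<open>X 0\<close> is the value of variable \<open>kk 0 = 0\<close>. Splitting
    it off brings the environment into the form that \<open>cut_property\<close> expects.\<close>
  define e' where "e' = (\<lambda>i. e (Suc i))"
  have e': "e (kk 0) ## e' = e" unfolding e'_def kk0 by (auto split: nat.splits)
  have env': "envs M e' s" using M(2) by (simp add: envs_def e'_def)
  have "sat M (concl_fm \<psi>) (e (kk 0) ## e') s"
  proof (rule good_properties(3)[OF good, unfolded cut_property_def, rule_format, OF assms env'])
    fix n
    show "e (kk n) \<in> Num M \<and> tval M e (b n) \<in> Num M \<and> tval M e (c n) \<in> Num M"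
      using M(2) tval_closed[OF M(1,2)] by (auto simp: envs_def)
    show "sat M (shrink_fm \<theta>) (e (kk (Suc n)) ## e (kk n) ## tval M e (b n) ## tval M e (c n) ## e (kk 0) ## e') s"
      unfolding e' using step[of _ n] by (simp add: sat_shrink_step)
  next
    fix b' c' k assume "b' \<in> Num M" "c' \<in> Num M"
    then obtain t u where "b' = tval M e t" "c' = tval M e u" using M(3) by blast
    then show "\<exists>n\<ge>k. tval M e (b n) = b' \<and> tval M e (c n) = c'"
      \<comment> \<open>With \<open>k\<close> as counter, the code of the stage is at least
        \<open>k\<close>.\<close>
      using le_prod_encode_2[of k "prod_encode (to_nat t, to_nat u)"]
      by (intro exI[of _ "prod_encode (prod_encode (to_nat t, to_nat u), k)"]) (simp add: b_def c_def)
  next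
    show "sat M (start_fm \<theta>) (e (kk 0) ## e') s" unfolding e' by (rule sat) simp
  qed
  moreover have "sat M (\<^bold>\<not> concl_fm \<psi>) e s" by (rule sat) simp
  ultimately show False unfolding e' by simp
qed

end
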